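(* Let $A\in\mathbb{R}^{n\times d}$, $b\in\mathbb{R}^n$, let $g:\mathbb{R}^d\to\mathbb{R}$ be convex and twice differentiable with constant psd Hessian $H^g$, and let $h:\mathbb{R}^d\to\mathbb{R}\cup\{+\infty\}$ be a closed proper convex function. Consider the problem \[ \text{minimize}_{x\in\mathbb{R}^d}\ \tfrac12\|Ax-b\|_2^2+g(x)+h(x), \] and assume it has a solution. Fix initial iterates $\tilde x^0,\tilde z^0,\tilde u^0\in\mathbb{R}^d$, a stepsize $\rho>0$, a summable sequence of tolerances $\{\varepsilon^k\}_{k\ge0}\subset(0,\infty)$, and $\delta\in(0,1)$. Let $H=A^{T}A+H^{g}$ and construct the randomized Nyström preconditioner $P$ of $H$ (with regularization $\rho$) from a $d\times s$ standard Gaussian test matrix with \[ s\geq 8\left(\sqrt{d_{\mathrm{eff}}(\rho)}+\sqrt{8\log(16/\delta)}\right)^{2}. \] Run NysADMM: for $k=0,1,2,\dots$, (i) let $r^k=\rho\tilde z^k-\rho\tilde u^k+A^{T}A\tilde x^k+H^{g}\tilde x^k-A^{T}(A\tilde x^k-b)-\nabla g(\tilde x^k)$, and let $\tilde x^{k+1}$ be the output of $T^k=4+\big\lceil 2\log\big(R/(\varepsilon^k\rho)\big)\big\rceil$ iterations of preconditioned conjugate gradients with preconditioner $P$ (started from $0$) on the system $(H+\rho I)x=r^k$; (ii) $\tilde z^{k+1}=\mathrm{argmin}_z\{h(z)+\frac{\rho}{2}\|\tilde x^{k+1}-z+\tilde u^k\|_2^2\}$; (iii) $\tilde u^{k+1}=\tilde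 u^k+\tilde x^{k+1}-\tilde z^{k+1}$. Assume $\|r^k\|_2\le R$ for all $k$, for some constant $R$. Then with probability at least $1-\delta$: 1. for all $k\ge0$, $\|\tilde x^{k+1}-x^{k+1}\|_2\le\varepsilon^k$, where $x^{k+1}$ is the exact solution of $(H+\rho I)x=r^k$; 2. as $k\to\infty$, $\tilde x^k$ converges to a solution of the primal problem above and $\rho\tilde u^k$ converges to a solution of its dual problem $\text{maximize}_{y}\ -\big(f^*(-y)+h^*(y)\big)$, where $f(x)=\tfrac12\|Ax-b\|_2^2+g(x)$ and $^*$ denotes the convex conjugate.
   Context: For symmetric psd $H$ and $\rho>0$, $d_{\mathrm{eff}}(\rho)=\mathrm{tr}\big(H(H+\rho I)^{-1}\big)$. Given $\Omega\in\mathbb{R}^{d\times s}$ with i.i.d. $N(0,1)$ entries, the Nyström approximation is $H\langle\Omega\rangle=(H\Omega)(\Omega^{T}H\Omega)^{\dagger}(H\Omega)^{T}=U\hat\Lambda U^{T}$ with $U\in\mathbb{R}^{d\times s}$ having orthonormal columns and $\hat\Lambda=\mathrm{diag}(\hat\lambda_1\ge\dots\ge\hat\lambda_s)$; the randomized Nyström preconditioner is $P=\frac{1}{\hat\lambda_s+\rho}U(\hat\Lambda+\rho I)U^{T}+(I-UU^{T})$. The preconditioner is built once and reused in every iteration. $\log$ is the natural logarithm. A sequence $\{\varepsilon^k\}$ of positive numbers is summable if $\sum_k\varepsilon^k<\infty$. *)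

theory Defs
  imports "HOL-Analysis.Analysis" "HOL-Probability.Probability"
begin

definition pinv :: "real^'s^'s \<Rightarrow> real^'s^'s" where
  "pinv M = (THE X. M ** X ** M = M \<and> X ** M ** X = X \<and>
                   transpose (M ** X) = M ** X \<and> transpose (X ** M) = X ** M)"

definition deff :: "real^'d^'d \<Rightarrow> real \<Rightarrow> real" where
  "deff H rho = trace (H ** matrix_inv (H + rho *\<^sub>R mat 1))"

definition nystrom :: "real^'d^'d \<Rightarrow> real^'s^'d \<Rightarrow> real^'d^'d" where
  "nystrom H Om = (H ** Om) ** pinv (transpose Om ** H ** Om) ** transpose (H ** Om)"

definition diagm :: "('s \<Rightarrow> real) \<Rightarrow> real^'s^'s" where
  "diagm lam = (\<chi> i j. if i = j then lam i else 0)"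

text \<open>Randomized Nystrom preconditioner built from U (orthonormal columns) and the
  Nystrom eigenvalues lam; lam_s is the smallest of them.\<close>
definition nys_precond :: "real^'s^'d \<Rightarrow> ('s::finite \<Rightarrow> real) \<Rightarrow> real \<Rightarrow> real^'d^'d" where
  "nys_precond U lam rho =
     (1 / (Min (range lam) + rho)) *\<^sub>R (U ** diagm (\<lambda>i. lam i + rho) ** transpose U)
     + (mat 1 - U ** transpose U)"

definition pcg_step :: "real^'d^'d \<Rightarrow> real^'d^'d \<Rightarrow>
    ((real^'d) \<times> (real^'d) \<times> (real^'d) \<times> (real^'d)) \<Rightarrow> ((real^'d) \<times> (real^'d) \<times> (real^'d) \<times> (real^'d))" where
  "pcg_step M Pinv st = (case st of (x, r, z, p) \<Rightarrow>
     let \<alpha> = (r \<bullet> z) / (p \<bullet> (M *v p));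
         x' = x + \<alpha> *\<^sub>R p;
         r' = r - \<alpha> *\<^sub>R (M *v p);
         z' = Pinv *v r';
         \<beta> = (r' \<bullet> z') / (r \<bullet> z);
         p' = z' + \<beta> *\<^sub>R p
     in (x', r', z', p'))"

definition pcg :: "real^'d^'d \<Rightarrow> real^'d^'d \<Rightarrow> real^'d \<Rightarrow> nat \<Rightarrow> real^'d" where
  "pcg M P rhs T =
     fst ((pcg_step M (matrix_inv P) ^^ T) (0, rhs, matrix_inv P *v rhs, matrix_inv P *v rhs))"

definition proper_fun :: "('a \<Rightarrow> ereal) \<Rightarrow> bool" where
  "proper_fun h \<longleftrightarrow> (\<forall>x. h x \<noteq> -\<infinity>) \<and> (\<exists>x. h x \<noteq> \<infinity>)"

definition epigraph :: "('a \<Rightarrow> ereal) \<Rightarrow> ('a \<times> real) set" where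
  "epigraph h = {(x, t). h x \<le> ereal t}"

definition convex_fun :: "('a::real_vector \<Rightarrow> ereal) \<Rightarrow> bool" where
  "convex_fun h \<longleftrightarrow> convex (epigraph h)"

definition closed_fun :: "('a::topological_space \<Rightarrow> ereal) \<Rightarrow> bool" where
  "closed_fun h \<longleftrightarrow> closed (epigraph h)"

definition fconj :: "('a::real_inner \<Rightarrow> ereal) \<Rightarrow> 'a \<Rightarrow> ereal" where
  "fconj phi y = (SUP x. ereal (y \<bullet> x) - phi x)"

definition fsmooth :: "real^'d^'n \<Rightarrow> real^'n \<Rightarrow> (real^'d \<Rightarrow> real) \<Rightarrow> real^'d \<Rightarrow> real" where
  "fsmooth A b g x = 1/2 * (norm (A *v x - b))^2 + g x"

definition primal_obj :: "real^'d^'n \<Rightarrow> real^'n \<Rightarrow> (real^'d \<Rightarrow> real) \<Rightarrow> (real^'d \<Rightarrow> ereal)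
    \<Rightarrow> real^'d \<Rightarrow> ereal" where
  "primal_obj A b g h x = ereal (fsmooth A b g x) + h x"

definition dual_obj :: "real^'d^'n \<Rightarrow> real^'n \<Rightarrow> (real^'d \<Rightarrow> real) \<Rightarrow> (real^'d \<Rightarrow> ereal)
    \<Rightarrow> real^'d \<Rightarrow> ereal" where
  "dual_obj A b g h y = - (fconj (\<lambda>x. ereal (fsmooth A b g x)) (- y) + fconj h y)"

definition is_primal_sol where
  "is_primal_sol A b g h x \<longleftrightarrow> (\<forall>x'. primal_obj A b g h x \<le> primal_obj A b g h x')"

definition is_dual_sol where
  "is_dual_sol A b g h y \<longleftrightarrow> (\<forall>y'. dual_obj A b g h y' \<le> dual_obj A b g h y)"

definition nys_rhs :: "real^'d^'n \<Rightarrow> real^'n \<Rightarrow> real^'d^'d \<Rightarrow> (real^'d \<Rightarrow> real^'d) \<Rightarrow> real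
    \<Rightarrow> real^'d \<Rightarrow> real^'d \<Rightarrow> real^'d \<Rightarrow> real^'d" where
  "nys_rhs A b Hg gradg rho x z u =
     rho *\<^sub>R z - rho *\<^sub>R u + (transpose A ** A) *v x + Hg *v x
     - transpose A *v (A *v x - b) - gradg x"

definition pcg_iters :: "real \<Rightarrow> real \<Rightarrow> real \<Rightarrow> nat" where
  "pcg_iters R e rho = nat (4 + \<lceil>2 * ln (R / (e * rho))\<rceil>)"

end

theory Submission
  imports Defs
begin

text \<open>
  Randomness enters only through one event. Factor H = B (transpose B); on the event, every w with
  (transpose Om) B w = 0 satisfies |B w|^2 \<le> 14 rho |w|^2. Its probability is bounded by a
  PAC-Bayes argument. The function exp(-2 sum_j (y . om_j)^2) of the columns om_j, normalised to
  have mean 1, is averaged over y from a Gaussian prior with covariance proportional to H(H+rho)^-1.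
  The average is rarely large, whereas recentring the prior at a null vector and applying Jensen's
  inequality bounds it from below. The effective dimension, being the trace of H(H+rho)^-1, is the
  price of the averaging.

  On that event N \<le> H \<le> N + 14 rho for the Nystrom approximation N, and the smallest
  retained eigenvalue of N is at most rho, whence rho P \<le> H + rho \<le> 16 rho P. For condition
  number 16 the Chebyshev bound gives preconditioned conjugate gradients the rate 3/5 < exp(-1/2),
  which matches the iteration count.

  Since the smooth part is quadratic, the linearised x-update is the exact ADMM update up to the
  conjugate gradient error. In the variable z + u the iteration is a firmly nonexpansive map
  perturbed by summable errors, so it converges to a point satisfying the optimality conditions of
  both problems.
\<close>

section \<open>Symmetric and positive definite matrices\<close>

declare transpose_matrix_vector [simp del]

lemma inner_matrix_transpose:
  fixes A :: "real^'n^'m"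
  shows "x \<bullet> (A *v y) = (transpose A *v x) \<bullet> y"
  by (simp add: dot_lmul_matrix transpose_matrix_vector)

lemma inner_symmetric_matrix_commute:
  fixes A :: "real^'n^'n"
  assumes "transpose A = A"
  shows "x \<bullet> (A *v y) = y \<bullet> (A *v x)"
  by (metis assms inner_matrix_transpose inner_commute)

lemma inner_congruence:
  fixes G :: "real^'m^'n" and A :: "real^'n^'n"
  shows "(G *v y) \<bullet> (A *v (G *v y)) = y \<bullet> ((transpose G ** A ** G) *v y)"
  using inner_matrix_transpose[of y "transpose G" "A *v (G *v y)"]
  by (simp flip: matrix_vector_mul_assoc)

lemma norm_matrix_vector_power2:
  fixes G :: "real^'m^'n"
  shows "(norm (G *v y))\<^sup>2 = y \<bullet> ((transpose G ** G) *v y)"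
  using inner_congruence[of G y "mat 1"] by (simp add: power2_norm_eq_inner)

lemma transpose_add: "transpose (A + B) = transpose A + transpose B" for A B :: "real^'n^'m"
  by (simp add: transpose_def vec_eq_iff)

lemma transpose_diff: "transpose (A - B) = transpose A - transpose B" for A B :: "real^'n^'m"
  by (simp add: transpose_def vec_eq_iff)

lemma matrix_add_scaled_id_mult_vec: "(A + c *\<^sub>R mat 1) *v x = A *v x + c *\<^sub>R x" for A :: "real^'n^'n"
  by (simp add: matrix_vector_mult_add_rdistrib flip: scaleR_matrix_vector_assoc)

definition pos_def_matrix :: "real^'n^'n \<Rightarrow> bool" where
  "pos_def_matrix A \<longleftrightarrow> (\<forall>v. v \<noteq> 0 \<longrightarrow> 0 < v \<bullet> (A *v v))"

definition loewner_le :: "real^'n^'n \<Rightarrow> real^'n^'n \<Rightarrow> bool" (infix "\<preceq>" 50) where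
  "A \<preceq> B \<longleftrightarrow> (\<forall>v. v \<bullet> (A *v v) \<le> v \<bullet> (B *v v))"

lemma psd_inner_nonneg: "0 \<preceq> A \<Longrightarrow> 0 \<le> v \<bullet> (A *v v)"
  by (simp add: loewner_le_def)

lemma loewner_le_trans [trans]: "A \<preceq> B \<Longrightarrow> B \<preceq> C \<Longrightarrow> A \<preceq> C"
  unfolding loewner_le_def by (meson order_trans)

lemma scaleR_loewner_le_mono:
  assumes "0 \<preceq> A" "a \<le> b"
  shows "a *\<^sub>R A \<preceq> b *\<^sub>R A"
  using assms by (simp add: loewner_le_def mult_right_mono flip: scaleR_matrix_vector_assoc)

lemma pos_def_matrix_psd: "pos_def_matrix A \<Longrightarrow> 0 \<preceq> A"
  unfolding pos_def_matrix_def loewner_le_def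
  by (metis inner_zero_left less_imp_le matrix_vector_mult_0 order_refl inner_zero_right)

lemma pos_def_matrix_loewner_le:
  fixes A B :: "real^'n^'n"
  assumes "pos_def_matrix A" "0 < c" "c *\<^sub>R A \<preceq> B"
  shows "pos_def_matrix B"
  unfolding pos_def_matrix_def
proof (intro allI impI)
  fix v :: "real^'n" assume "v \<noteq> 0"
  then have "0 < v \<bullet> (A *v v)" using assms(1) by (simp add: pos_def_matrix_def)
  then have "0 < c * (v \<bullet> (A *v v))" using assms(2) by simp
  also have "\<dots> \<le> v \<bullet> (B *v v)"
    using assms(3) by (simp add: loewner_le_def flip: scaleR_matrix_vector_assoc)
  finally show "0 < v \<bullet> (B *v v)" .
qed

lemma pos_def_matrix_id: "pos_def_matrix (mat 1)"
  by (simp add: pos_def_matrix_def)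

lemma scaled_id_loewner_le_add: "0 \<preceq> A \<Longrightarrow> c *\<^sub>R mat 1 \<preceq> A + c *\<^sub>R mat 1"
  by (simp add: loewner_le_def matrix_vector_mult_add_rdistrib inner_add_right)

lemma pos_def_matrix_add_scaled_id: "0 \<preceq> A \<Longrightarrow> 0 < c \<Longrightarrow> pos_def_matrix (A + c *\<^sub>R mat 1)"
  using pos_def_matrix_loewner_le pos_def_matrix_id scaled_id_loewner_le_add by blast

lemma matrix_inv_unique:
  fixes A B :: "real^'n^'n"
  assumes "A ** B = mat 1"
  shows "matrix_inv A = B"
proof -
  have left_inverse: "B ** A = mat 1" using assms by (rule matrix_left_right_inverse[THEN iffD1])
  have "A ** matrix_inv A = mat 1 \<and> matrix_inv A ** A = mat 1"
    unfolding matrix_inv_def by (rule someI[of _ B]) (simp add: assms left_inverse)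
  then have "matrix_inv A ** (A ** B) = B" by (simp add: matrix_mul_assoc)
  then show ?thesis by (simp add: assms)
qed

lemma pos_def_matrix_inv_right:
  fixes A :: "real^'n^'n"
  assumes "pos_def_matrix A"
  shows "A ** matrix_inv A = mat 1"
proof -
  have "v = 0" if "A *v v = 0" for v
    using assms that by (metis inner_zero_right less_irrefl pos_def_matrix_def)
  then obtain B where "A ** B = mat 1"
    using matrix_left_invertible_ker[of A] by (metis matrix_left_right_inverse)
  then show ?thesis using matrix_inv_unique by blast
qed

lemma transpose_pos_def_matrix_inv:
  fixes A :: "real^'n^'n"
  assumes "transpose A = A" "pos_def_matrix A"
  shows "transpose (matrix_inv A) = matrix_inv A"
proof -
  have "transpose (matrix_inv A) ** A = mat 1"
    using pos_def_matrix_inv_right[OF assms(2)] assms(1) by (metis matrix_transpose_mul transpose_mat)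
  then show ?thesis using matrix_inv_unique by (metis matrix_left_right_inverse)
qed

lemma pos_def_matrix_inv:
  fixes A :: "real^'n^'n"
  assumes "pos_def_matrix A"
  shows "pos_def_matrix (matrix_inv A)"
  unfolding pos_def_matrix_def
proof (intro allI impI)
  fix v :: "real^'n" assume "v \<noteq> 0"
  define w where "w = matrix_inv A *v v"
  have "A *v w = v" by (simp add: w_def matrix_vector_mul_assoc pos_def_matrix_inv_right[OF assms])
  moreover have "w \<noteq> 0" using calculation \<open>v \<noteq> 0\<close> by auto
  ultimately have "0 < w \<bullet> v" using assms by (metis pos_def_matrix_def)
  then show "0 < v \<bullet> (matrix_inv A *v v)" by (simp add: w_def inner_commute)
qed

lemma contraction_transpose:
  fixes C :: "real^'n^'m"
  assumes "\<And>x. norm (C *v x) \<le> norm x"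
  shows "norm (transpose C *v y) \<le> norm y"
proof -
  let ?w = "transpose C *v y"
  have "norm ?w * norm ?w = y \<bullet> (C *v ?w)"
    by (simp add: inner_matrix_transpose dot_square_norm power2_eq_square)
  also have "\<dots> \<le> norm y * norm (C *v ?w)" by (rule norm_cauchy_schwarz)
  also have "\<dots> \<le> norm y * norm ?w" by (intro mult_left_mono assms) simp
  finally show ?thesis by (cases "?w = 0") auto
qed

lemma norm_orthonormal_columns:
  fixes U :: "real^'m^'n"
  assumes "transpose U ** U = mat 1"
  shows "norm (U *v y) = norm y"
  using norm_matrix_vector_power2[of U y] assms by (simp add: norm_eq_sqrt_inner power2_norm_eq_inner)

lemma bessel_inequality:
  fixes U :: "real^'m^'n"
  assumes "transpose U ** U = mat 1"
  shows "norm (transpose U *v v) \<le> norm v"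
  by (rule contraction_transpose) (simp add: norm_orthonormal_columns[OF assms])

section \<open>The spectral theorem\<close>

lemma quadratic_nonneg_imp_linear_coeff_zero:
  fixes a b :: real
  assumes nonneg: "\<And>t. 0 \<le> a * t\<^sup>2 + b * t"
  shows "b = 0"
proof (rule ccontr)
  assume "b \<noteq> 0"
  define D where "D = \<bar>a\<bar> + 1"
  have D_bounds: "0 < D" "a < D" by (auto simp: D_def)
  have "D\<^sup>2 * (a * (- b / D)\<^sup>2 + b * (- b / D)) = b\<^sup>2 * (a - D)"
    using D_bounds(1) by (simp add: power_divide power2_eq_square field_simps)
  also have "\<dots> < 0" using \<open>b \<noteq> 0\<close> D_bounds(2) by (simp add: mult_pos_neg)
  finally show False using nonneg[of "- b / D"] D_bounds(1) by (simp add: mult_less_0_iff)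
qed

lemma psd_on_subspace_null_vector:
  fixes S :: "real^'n^'n"
  assumes symmetric: "transpose S = S" and subspace: "subspace V"
    and psd: "\<And>v. v \<in> V \<Longrightarrow> 0 \<le> v \<bullet> (S *v v)"
    and null_vector: "x \<in> V" "x \<bullet> (S *v x) = 0" and w_in_V: "w \<in> V"
  shows "w \<bullet> (S *v x) = 0"
proof -
  have "0 \<le> (w \<bullet> (S *v w)) * t\<^sup>2 + (2 * (w \<bullet> (S *v x))) * t" for t
  proof -
    have "0 \<le> (x + t *\<^sub>R w) \<bullet> (S *v (x + t *\<^sub>R w))"
      by (intro psd subspace_add subspace_scale subspace null_vector w_in_V)
    then show ?thesis
      using null_vector(2) inner_symmetric_matrix_commute[OF symmetric, of x w]
      by (simp add: matrix_vector_right_distrib matrix_vector_mult_scaleR inner_simps power2_eq_square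
          algebra_simps)
  qed
  then have "2 * (w \<bullet> (S *v x)) = 0" by (rule quadratic_nonneg_imp_linear_coeff_zero)
  then show ?thesis by simp
qed

lemma rayleigh_quotient_attains_max:
  fixes A :: "real^'n^'n"
  assumes subspace: "subspace V" "V \<noteq> {0}"
  obtains x where "x \<in> V" "norm x = 1" "\<And>v. v \<in> V \<Longrightarrow> v \<bullet> (A *v v) \<le> (x \<bullet> (A *v x)) * (v \<bullet> v)"
proof -
  let ?S = "sphere 0 1 \<inter> V"
  have normalized: "v /\<^sub>R norm v \<in> ?S" if "v \<in> V" "v \<noteq> 0" for v
    using that subspace by (auto simp: subspace_scale)
  have "compact ?S" by (intro compact_Int_closed closed_subspace subspace) auto
  moreover obtain y where "y \<in> V" "y \<noteq> 0" using subspace subspace_0 by blast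
  then have "?S \<noteq> {}" using normalized by blast
  moreover have "continuous_on ?S (\<lambda>x. x \<bullet> (A *v x))"
    by (intro continuous_intros matrix_vector_mult_linear_continuous_on)
  ultimately have "\<exists>x\<in>?S. \<forall>y\<in>?S. y \<bullet> (A *v y) \<le> x \<bullet> (A *v x)"
    by (rule continuous_attains_sup)
  then obtain x where x_in_sphere: "x \<in> ?S" and maximal: "\<And>y. y \<in> ?S \<Longrightarrow> y \<bullet> (A *v y) \<le> x \<bullet> (A *v x)"
    by blast
  have "v \<bullet> (A *v v) \<le> (x \<bullet> (A *v x)) * (v \<bullet> v)" if "v \<in> V" for v
  proof (cases "v = 0")
    case False
    from maximal[OF normalized[OF that this]] show ?thesis using False
      by (simp add: matrix_vector_mult_scaleR divide_simps power2_eq_square flip: power2_norm_eq_inner)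
  qed simp
  then show thesis using that x_in_sphere by auto
qed

lemma symmetric_matrix_has_eigenvector:
  fixes A :: "real^'n^'n"
  assumes symmetric: "transpose A = A" and subspace: "subspace V" "V \<noteq> {0}"
    and invariant: "\<And>x. x \<in> V \<Longrightarrow> A *v x \<in> V"
  obtains x l where "x \<in> V" "norm x = 1" "A *v x = l *\<^sub>R x"
proof -
  obtain x where unit_vector: "x \<in> V" "norm x = 1"
    and maximal: "\<And>v. v \<in> V \<Longrightarrow> v \<bullet> (A *v v) \<le> (x \<bullet> (A *v x)) * (v \<bullet> v)"
    using rayleigh_quotient_attains_max[OF subspace] by blast
  define l where "l = x \<bullet> (A *v x)"
  define S where "S = l *\<^sub>R mat 1 - A"
  have S_mult_vec: "S *v v = l *\<^sub>R v - A *v v" for v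
    by (simp add: S_def matrix_vector_mult_diff_rdistrib flip: scaleR_matrix_vector_assoc)
  have "(S *v x) \<bullet> (S *v x) = 0"
  proof (rule psd_on_subspace_null_vector[OF _ subspace(1)])
    show "transpose S = S" by (simp add: S_def transpose_diff transpose_scalar symmetric)
    show "0 \<le> v \<bullet> (S *v v)" if "v \<in> V" for v
      using maximal[OF that] by (simp add: S_mult_vec l_def inner_simps)
    show "x \<bullet> (S *v x) = 0"
      using unit_vector(2) by (simp add: S_mult_vec l_def inner_simps dot_square_norm)
    show "S *v x \<in> V"
      unfolding S_mult_vec by (intro subspace_diff subspace_scale subspace unit_vector invariant)
  qed (rule unit_vector)
  then have "A *v x = l *\<^sub>R x" by (simp add: S_mult_vec)
  then show thesis using that unit_vector by blast
qed

lemma symmetric_matrix_orthonormal_eigenvectors: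
  fixes A :: "real^'n^'n"
  assumes symmetric: "transpose A = A" and "subspace V" and "\<And>x. x \<in> V \<Longrightarrow> A *v x \<in> V"
  shows "\<exists>B\<subseteq>V. finite B \<and> card B = dim V \<and> pairwise orthogonal B \<and>
    (\<forall>x\<in>B. norm x = 1 \<and> (\<exists>l. A *v x = l *\<^sub>R x))"
  using assms(2,3)
proof (induction "dim V" arbitrary: V)
  case 0
  then show ?case by (intro exI[of _ "{}"]) auto
next
  case (Suc k)
  have "V \<noteq> {0}" using Suc.hyps(2) by auto
  then obtain x l where eigenvector: "x \<in> V" "norm x = 1" "A *v x = l *\<^sub>R x"
    using symmetric_matrix_has_eigenvector[OF symmetric Suc.prems(1)] Suc.prems(2) by blast
  define W where "W = {y \<in> V. \<forall>z\<in>span {x}. orthogonal z y}"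
  have W_eq: "W = {y \<in> V. x \<bullet> y = 0}"
    unfolding W_def by (auto simp: span_singleton orthogonal_def)
  have "span {x} \<subseteq> V" using eigenvector Suc.prems by (simp add: span_minimal)
  then have "dim W + dim (span {x}) = dim V"
    unfolding W_def by (intro dim_subspace_orthogonal_to_vectors Suc.prems) auto
  moreover have "dim (span {x}) = 1" using eigenvector by (auto simp: dim_singleton)
  ultimately have dim_W: "k = dim W" using Suc.hyps(2) by simp
  have "subspace W" unfolding W_eq subspace_def using Suc.prems(1)
    by (auto simp: subspace_0 subspace_add subspace_scale inner_simps)
  moreover have "A *v y \<in> W" if "y \<in> W" for y
    using that Suc.prems(2) eigenvector(3)
    unfolding W_eq by (simp add: inner_matrix_transpose symmetric)
  ultimately obtain B where W_basis: "B \<subseteq> W" "finite B" "card B = dim W" "pairwise orthogonal B"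
    "\<forall>x\<in>B. norm x = 1 \<and> (\<exists>l. A *v x = l *\<^sub>R x)"
    using Suc.hyps(1)[OF dim_W] by blast
  have "x \<notin> B" using W_basis(1) eigenvector(2) unfolding W_eq by (auto simp: dot_square_norm)
  then show ?case using W_basis eigenvector dim_W Suc.hyps(2) unfolding W_eq
    by (intro exI[of _ "insert x B"]) (auto simp: pairwise_insert orthogonal_def inner_commute)
qed

lemma diagm_mult_vec: "diagm f *v y = (\<chi> i. f i * y $ i)"
  by (simp add: diagm_def matrix_vector_mult_def vec_eq_iff mult_delta_left)

lemma diagm_mult_diagm: "diagm f ** diagm g = diagm (\<lambda>i. f i * g i)"
  by (simp add: diagm_def matrix_matrix_mult_def vec_eq_iff mult_delta_left)

lemma transpose_diagm [simp]: "transpose (diagm f) = diagm f"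
  by (auto simp: diagm_def transpose_def vec_eq_iff)

lemma diagm_one [simp]: "diagm (\<lambda>i. 1) = mat 1"
  by (simp add: diagm_def mat_def)

lemma inner_diagm: "y \<bullet> (diagm f *v y) = (\<Sum>i\<in>UNIV. f i * (y $ i)\<^sup>2)"
  by (simp add: diagm_mult_vec inner_vec_def power2_eq_square algebra_simps)

definition spectral_matrix :: "real^'m^'n \<Rightarrow> ('m \<Rightarrow> real) \<Rightarrow> real^'n^'n" where
  "spectral_matrix U f = U ** diagm f ** transpose U"

theorem symmetric_matrix_diagonalizable:
  fixes A :: "real^'n^'n"
  assumes symmetric: "transpose A = A"
  obtains Q l where "orthogonal_matrix Q" "A = spectral_matrix Q l"
proof -
  obtain B where eigenbasis: "finite B" "card B = CARD('n)" "pairwise orthogonal B"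
     "\<And>x. x \<in> B \<Longrightarrow> norm x = 1 \<and> (\<exists>l. A *v x = l *\<^sub>R x)"
    using symmetric_matrix_orthonormal_eigenvectors[OF symmetric, of UNIV] by (auto simp: dim_UNIV)
  obtain q where q_bij: "bij_betw q (UNIV :: 'n set) B"
    using eigenbasis(1,2) by (metis finite_same_card_bij finite)
  then have q_in_basis: "q j \<in> B" for j by (auto simp: bij_betw_def)
  obtain l where eigenvalue: "\<And>j. A *v q j = l j *\<^sub>R q j" using eigenbasis(4)[OF q_in_basis] by metis
  define Q :: "real^'n^'n" where "Q = (\<chi> i j. q j $ i)"
  have "q i \<bullet> q j = (if i = j then 1 else 0)" for i j
  proof (cases "i = j")
    case False
    then have "q i \<noteq> q j" using q_bij by (auto simp: bij_betw_def inj_on_def)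
    then show ?thesis using False eigenbasis(3) q_in_basis unfolding pairwise_def orthogonal_def by auto
  qed (use eigenbasis(4)[OF q_in_basis] in \<open>simp add: dot_square_norm\<close>)
  then have Q_orthogonal: "orthogonal_matrix Q"
    by (simp add: orthogonal_matrix matrix_mult_transpose_dot_column column_def Q_def mat_def)
  have "(\<Sum>k\<in>UNIV. A $ i $ k * q j $ k) = l j * q j $ i" for i j
    using arg_cong[OF eigenvalue[of j], of "\<lambda>v. v $ i"] by (simp add: matrix_vector_mult_def)
  then have eigen_equation: "A ** Q = Q ** diagm l"
    by (simp add: matrix_matrix_mult_def vec_eq_iff Q_def diagm_def if_distrib sum.delta mult.commute
        cong: if_cong)
  have "A = A ** (Q ** transpose Q)" using Q_orthogonal by (simp add: orthogonal_matrix_def)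
  also have "\<dots> = spectral_matrix Q l" by (simp add: spectral_matrix_def matrix_mul_assoc eigen_equation)
  finally show thesis using that Q_orthogonal by blast
qed

lemma transpose_spectral_matrix [simp]: "transpose (spectral_matrix U f) = spectral_matrix U f"
  by (simp add: spectral_matrix_def matrix_transpose_mul matrix_mul_assoc)

lemma inner_spectral_matrix: "v \<bullet> (spectral_matrix U f *v v)
    = (\<Sum>i\<in>UNIV. f i * ((transpose U *v v) $ i)\<^sup>2)"
  by (simp add: spectral_matrix_def inner_matrix_transpose[of v U] inner_diagm
      flip: matrix_vector_mul_assoc)

lemma spectral_matrix_add_scaleR:
  "spectral_matrix U f + c *\<^sub>R spectral_matrix U g = spectral_matrix U (\<lambda>i. f i + c * g i)"
proof -
  have "diagm (\<lambda>i. f i + c * g i) *v y = diagm f *v y + c *\<^sub>R (diagm g *v y)" for y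
    by (simp add: diagm_mult_vec vec_eq_iff algebra_simps)
  then show ?thesis
    by (simp add: matrix_eq spectral_matrix_def matrix_vector_mult_add_rdistrib
        matrix_vector_right_distrib matrix_vector_mult_scaleR
        flip: matrix_vector_mul_assoc scaleR_matrix_vector_assoc)
qed

lemma spectral_matrix_one: "orthogonal_matrix Q \<Longrightarrow> spectral_matrix Q (\<lambda>_. 1) = mat 1"
  by (simp add: spectral_matrix_def orthogonal_matrix_def)

context
  fixes U :: "real^'m^'n"
  assumes orthonormal: "transpose U ** U = mat 1"
begin

lemma spectral_matrix_mult:
  "spectral_matrix U f ** spectral_matrix U g = spectral_matrix U (\<lambda>i. f i * g i)"
proof -
  have "spectral_matrix U f ** spectral_matrix U g
      = U ** diagm f ** (transpose U ** U) ** diagm g ** transpose U"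
    by (simp only: spectral_matrix_def matrix_mul_assoc)
  also have "\<dots> = U ** (diagm f ** diagm g) ** transpose U"
    by (simp add: orthonormal matrix_mul_assoc)
  finally show ?thesis by (simp only: diagm_mult_diagm spectral_matrix_def)
qed

lemma trace_spectral_matrix: "trace (spectral_matrix U f) = sum f UNIV"
proof -
  have "trace (spectral_matrix U f) = trace (transpose U ** U ** diagm f)"
    by (metis spectral_matrix_def matrix_mul_assoc trace_mul_sym)
  then show ?thesis by (simp add: orthonormal trace_def diagm_def)
qed

lemma compress_spectral_matrix: "transpose U ** spectral_matrix U f ** U = diagm f"
proof -
  have "transpose U ** spectral_matrix U f ** U = (transpose U ** U) ** diagm f ** (transpose U ** U)"
    by (simp only: spectral_matrix_def matrix_mul_assoc)
  then show ?thesis by (simp add: orthonormal)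
qed

lemma inner_spectral_matrix_column: "column i U \<bullet> (spectral_matrix U f *v column i U) = f i"
  using inner_congruence[of U "axis i 1" "spectral_matrix U f"]
  by (simp add: compress_spectral_matrix inner_axis' diagm_mult_vec flip: matrix_vector_mult_basis)

lemma norm_column_orthonormal: "norm (column i U) = 1"
  using norm_orthonormal_columns[OF orthonormal, of "axis i 1"] by (simp add: matrix_vector_mult_basis)

lemma spectral_matrix_psd_iff: "0 \<preceq> spectral_matrix U f \<longleftrightarrow> (\<forall>i. 0 \<le> f i)"
proof
  show "\<forall>i. 0 \<le> f i" if "0 \<preceq> spectral_matrix U f"
    using psd_inner_nonneg[OF that] inner_spectral_matrix_column by metis
qed (simp add: loewner_le_def inner_spectral_matrix sum_nonneg)

end

lemma trace_compression_le:
  fixes A :: "real^'n^'n" and U :: "real^'m^'n"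
  assumes "transpose A = A" "0 \<preceq> A" and U_orthonormal: "transpose U ** U = mat 1"
  shows "(\<Sum>k\<in>UNIV. column k U \<bullet> (A *v column k U)) \<le> trace A"
proof -
  obtain Q l where Q_orthogonal: "orthogonal_matrix Q" and A_eq: "A = spectral_matrix Q l"
    using symmetric_matrix_diagonalizable[OF assms(1)] .
  have Q_orthonormal: "transpose Q ** Q = mat 1" using Q_orthogonal by (simp add: orthogonal_matrix_def)
  have l_nonneg: "0 \<le> l i" for i
    using assms(2) spectral_matrix_psd_iff[OF Q_orthonormal] by (simp add: A_eq)
  have component: "(transpose Q *v column k U) $ i = (transpose U *v column i Q) $ k" for i k
    by (simp add: matrix_vector_mult_def transpose_def column_def mult.commute)
  have "(\<Sum>k\<in>UNIV. column k U \<bullet> (A *v column k U))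
      = (\<Sum>k\<in>UNIV. \<Sum>i\<in>UNIV. l i * ((transpose U *v column i Q) $ k)\<^sup>2)"
    by (simp add: A_eq inner_spectral_matrix component)
  also have "\<dots> = (\<Sum>i\<in>UNIV. l i * (norm (transpose U *v column i Q))\<^sup>2)"
    by (subst sum.swap) (simp add: sum_distrib_left norm_vec_def L2_set_def sum_nonneg)
  also have "\<dots> \<le> (\<Sum>i\<in>UNIV. l i * 1)"
    using bessel_inequality[OF U_orthonormal, of "column _ Q"]
      norm_column_orthonormal[OF Q_orthonormal] l_nonneg
    by (intro sum_mono mult_left_mono) (auto simp: power_le_one)
  finally show ?thesis by (simp add: A_eq trace_spectral_matrix[OF Q_orthonormal])
qed

lemma pos_def_matrix_whitening:
  fixes P :: "real^'n^'n"
  assumes "transpose P = P" "pos_def_matrix P"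
  obtains S :: "real^'n^'n" where "transpose S ** P ** S = mat 1"
proof -
  obtain Q l where Q_orthogonal: "orthogonal_matrix Q" and P_eq: "P = spectral_matrix Q l"
    using symmetric_matrix_diagonalizable[OF assms(1)] .
  have Q_orthonormal: "transpose Q ** Q = mat 1" using Q_orthogonal by (simp add: orthogonal_matrix_def)
  have l_pos: "0 < l i" for i
  proof -
    have "column i Q \<noteq> 0" using norm_column_orthonormal[OF Q_orthonormal, of i] by auto
    then show ?thesis
      using assms(2) inner_spectral_matrix_column[OF Q_orthonormal]
      unfolding P_eq pos_def_matrix_def by metis
  qed
  let ?D = "diagm (\<lambda>i. 1 / sqrt (l i))"
  have "transpose (Q ** ?D) ** P ** (Q ** ?D) = ?D ** (transpose Q ** P ** Q) ** ?D"
    by (simp add: matrix_transpose_mul matrix_mul_assoc)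
  also have "\<dots> = mat 1"
    using l_pos
    by (simp add: P_eq compress_spectral_matrix[OF Q_orthonormal] diagm_mult_diagm less_imp_le
        less_imp_neq[THEN not_sym])
  finally show thesis using that by blast
qed

lemma simultaneous_diagonalization:
  fixes P A :: "real^'n^'n"
  assumes "transpose P = P" "pos_def_matrix P" "transpose A = A"
  obtains G :: "real^'n^'n" and \<mu>
    where "transpose G ** P ** G = mat 1" "transpose G ** A ** G = diagm \<mu>"
proof -
  obtain S :: "real^'n^'n" where whitening: "transpose S ** P ** S = mat 1"
    using pos_def_matrix_whitening assms by blast
  obtain V \<mu> where V_orthogonal: "orthogonal_matrix V"
    and diagonalized: "transpose S ** A ** S = spectral_matrix V \<mu>"
    using symmetric_matrix_diagonalizable[of "transpose S ** A ** S"] assms(3)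
    by (auto simp: matrix_transpose_mul matrix_mul_assoc)
  have V_orthonormal: "transpose V ** V = mat 1" using V_orthogonal by (simp add: orthogonal_matrix_def)
  have congruence: "transpose (S ** V) ** X ** (S ** V)
      = transpose V ** (transpose S ** X ** S) ** V" for X
    by (simp add: matrix_transpose_mul matrix_mul_assoc)
  show thesis
  proof (rule that)
    show "transpose (S ** V) ** P ** (S ** V) = mat 1" by (simp add: congruence whitening V_orthonormal)
    show "transpose (S ** V) ** A ** (S ** V) = diagm \<mu>"
      by (simp add: congruence diagonalized compress_spectral_matrix[OF V_orthonormal])
  qed
qed

lemma matrix_inv_eq_whitening:
  fixes P G :: "real^'n^'n"
  assumes "transpose G ** P ** G = mat 1"
  shows "matrix_inv P = G ** transpose G"
proof (rule matrix_inv_unique)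
  have "G ** (transpose G ** P) = mat 1" using assms by (rule matrix_left_right_inverse[THEN iffD1])
  then have "(G ** transpose G) ** P = mat 1" by (simp add: matrix_mul_assoc)
  then show "P ** (G ** transpose G) = mat 1" by (rule matrix_left_right_inverse[THEN iffD1])
qed

section \<open>Preconditioned conjugate gradients\<close>

locale pcg_iteration =
  fixes A P :: "real^'n^'n" and b :: "real^'n"
  assumes A_sym: "transpose A = A" and A_pos: "pos_def_matrix A"
    and P_sym: "transpose P = P" and P_pos: "pos_def_matrix P"
begin

abbreviation B :: "real^'n^'n" where "B \<equiv> matrix_inv P"

definition state :: "nat \<Rightarrow> (real^'n) \<times> (real^'n) \<times> (real^'n) \<times> (real^'n)" where
  "state k = (pcg_step A B ^^ k) (0, b, B *v b, B *v b)"

definition x :: "nat \<Rightarrow> real^'n" where "x k = fst (state k)"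
definition r :: "nat \<Rightarrow> real^'n" where "r k = fst (snd (state k))"
definition z :: "nat \<Rightarrow> real^'n" where "z k = fst (snd (snd (state k)))"
definition p :: "nat \<Rightarrow> real^'n" where "p k = snd (snd (snd (state k)))"
definition \<alpha> :: "nat \<Rightarrow> real" where "\<alpha> k = (r k \<bullet> z k) / (p k \<bullet> (A *v p k))"
definition \<beta> :: "nat \<Rightarrow> real" where "\<beta> k = (r (Suc k) \<bullet> z (Suc k)) / (r k \<bullet> z k)"

lemma pcg_eq_x: "pcg A P b k = x k"
  by (simp add: pcg_def x_def state_def)

lemma state_eq: "state k = (x k, r k, z k, p k)"
  by (simp add: x_def r_def z_def p_def)

lemma iterates_0: "x 0 = 0" "r 0 = b" "p 0 = z 0"
  by (simp_all add: x_def r_def z_def p_def state_def)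

lemma iterates_Suc:
  shows x_Suc: "x (Suc k) = x k + \<alpha> k *\<^sub>R p k"
    and r_Suc: "r (Suc k) = r k - \<alpha> k *\<^sub>R (A *v p k)"
    and z_Suc: "z (Suc k) = B *v r (Suc k)"
    and p_Suc: "p (Suc k) = z (Suc k) + \<beta> k *\<^sub>R p k"
proof -
  have "(x (Suc k), r (Suc k), z (Suc k), p (Suc k)) = pcg_step A B (x k, r k, z k, p k)"
    by (simp add: state_def flip: state_eq)
  then show "x (Suc k) = x k + \<alpha> k *\<^sub>R p k" "r (Suc k) = r k - \<alpha> k *\<^sub>R (A *v p k)"
    "z (Suc k) = B *v r (Suc k)" "p (Suc k) = z (Suc k) + \<beta> k *\<^sub>R p k"
    by (simp_all add: pcg_step_def Let_def \<alpha>_def \<beta>_def)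
qed

lemma z_eq: "z k = B *v r k"
  by (cases k) (simp_all only: z_Suc, simp add: z_def r_def state_def)

lemma residual_eq: "r k = b - A *v x k"
  by (induction k)
     (auto simp: iterates_0 x_Suc r_Suc matrix_vector_right_distrib matrix_vector_mult_scaleR)

lemma residual_zero_stays: "r j = 0 \<Longrightarrow> j \<le> k \<Longrightarrow> r k = 0"
  by (induction k) (auto simp: le_Suc_eq r_Suc \<alpha>_def)

lemma A_psd: "0 \<le> v \<bullet> (A *v v)"
  using pos_def_matrix_psd[OF A_pos] by (rule psd_inner_nonneg)

lemma rz_commute: "r i \<bullet> z j = r j \<bullet> z i"
  by (simp add: z_eq inner_symmetric_matrix_commute[OF transpose_pos_def_matrix_inv[OF P_sym P_pos]])

lemma rz_pos: "r k \<noteq> 0 \<Longrightarrow> 0 < r k \<bullet> z k"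
  using pos_def_matrix_inv[OF P_pos] by (simp add: z_eq pos_def_matrix_def)

lemma residual_Suc_inner_direction:
  assumes "r k \<bullet> p k = r k \<bullet> z k"
  shows "r (Suc k) \<bullet> p k = 0"
proof (cases "p k = 0")
  case False
  then have "0 < p k \<bullet> (A *v p k)" using A_pos by (simp add: pos_def_matrix_def)
  then show ?thesis using assms by (simp add: r_Suc \<alpha>_def inner_simps inner_commute[of "A *v p k"])
qed simp

lemma residual_inner_direction: "r k \<bullet> p k = r k \<bullet> z k"
proof (induction k)
  case (Suc k)
  then show ?case using residual_Suc_inner_direction[of k] by (simp add: p_Suc inner_simps)
qed (simp add: iterates_0)

lemma direction_energy_pos:
  assumes "r k \<noteq> 0"
  shows "0 < p k \<bullet> (A *v p k)"
proof -
  have "p k \<noteq> 0" using rz_pos[OF assms] residual_inner_direction[of k] by auto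
  then show ?thesis using A_pos by (simp add: pos_def_matrix_def)
qed

lemma step_size_pos: "r k \<noteq> 0 \<Longrightarrow> 0 < \<alpha> k"
  unfolding \<alpha>_def by (intro divide_pos_pos rz_pos direction_energy_pos)

lemma residual_orthogonal_precond_residual:
  assumes "\<And>i. i \<le> m \<Longrightarrow> r k \<bullet> p i = 0"
  shows "r k \<bullet> z m = 0"
proof (cases m)
  case 0
  then show ?thesis using assms[of 0] by (simp add: iterates_0)
next
  case (Suc i)
  have "z m = p m - \<beta> i *\<^sub>R p i" by (simp add: Suc p_Suc)
  then show ?thesis using assms[of m] assms[of i] by (simp add: Suc inner_simps)
qed

lemma residual_orthogonal_and_directions_conjugate:
  assumes "\<And>j. j < k \<Longrightarrow> r j \<noteq> 0" "i < k"
  shows "r k \<bullet> p i = 0 \<and> p k \<bullet> (A *v p i) = 0"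
  using assms
proof (induction k arbitrary: i)
  case (Suc k)
  have orth: "r (Suc k) \<bullet> p j = 0" if "j \<le> k" for j
  proof (cases "j = k")
    case False
    then have "r k \<bullet> p j = 0" "p k \<bullet> (A *v p j) = 0" using Suc that by auto
    then show ?thesis
      using inner_symmetric_matrix_commute[OF A_sym, of "p j" "p k"]
      by (simp add: r_Suc inner_simps inner_commute)
  qed (simp add: residual_Suc_inner_direction residual_inner_direction)
  then have orth_precond: "r (Suc k) \<bullet> z j = 0" if "j \<le> k" for j
    using that by (intro residual_orthogonal_precond_residual) auto
  have step_pos: "0 < \<alpha> i" using Suc.prems by (intro step_size_pos) simp
  have "\<alpha> i * (z (Suc k) \<bullet> (A *v p i)) = z (Suc k) \<bullet> (r i - r (Suc i))" by (simp add: r_Suc)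
  also have "\<dots> = - (r (Suc i) \<bullet> z (Suc k))"
    using orth_precond[of i] Suc.prems(2)
    by (simp add: inner_simps inner_commute[of "z (Suc k)"] rz_commute[of _ "Suc k"])
  finally have energy_product: "\<alpha> i * (z (Suc k) \<bullet> (A *v p i)) = - (r (Suc i) \<bullet> z (Suc k))" .
  have "z (Suc k) \<bullet> (A *v p i) + \<beta> k * (p k \<bullet> (A *v p i)) = 0"
  proof (cases "i = k")
    case True
    have "r k \<noteq> 0" using Suc.prems by simp
    then have "\<alpha> k * (\<beta> k * (p k \<bullet> (A *v p k))) = r (Suc k) \<bullet> z (Suc k)"
      using rz_pos[of k] direction_energy_pos[of k] by (simp add: \<alpha>_def \<beta>_def)
    then have "\<alpha> k * (z (Suc k) \<bullet> (A *v p k) + \<beta> k * (p k \<bullet> (A *v p k))) = 0"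
      using energy_product True by (simp add: distrib_left)
    then show ?thesis using step_pos True by simp
  next
    case False
    then have "r (Suc i) \<bullet> z (Suc k) = 0"
      using orth_precond[of "Suc i"] Suc.prems(2) by (simp add: rz_commute[of _ "Suc k"])
    moreover have "p k \<bullet> (A *v p i) = 0" using Suc False by simp
    ultimately show ?thesis using energy_product step_pos by simp
  qed
  then show ?case using orth[of i] Suc.prems(2) by (simp add: p_Suc inner_simps)
qed simp

definition direction_space :: "nat \<Rightarrow> (real^'n) set" where
  "direction_space k = span (p ` {..<k})"

lemma subspace_direction_space: "subspace (direction_space k)"
  unfolding direction_space_def by (rule subspace_span)

lemma direction_space_mono: "v \<in> direction_space k \<Longrightarrow> k \<le> m \<Longrightarrow> v \<in> direction_space m"
  unfolding direction_space_def
  using span_mono[OF image_mono, of "{..<k}" "{..<m}" p] by (simp add: subset_iff)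

lemma direction_in_direction_space: "k < m \<Longrightarrow> p k \<in> direction_space m"
  unfolding direction_space_def by (rule span_base) simp

lemma precond_residual_in_direction_space:
  assumes "k < m"
  shows "z k \<in> direction_space m"
proof (cases k)
  case 0
  then show ?thesis using direction_in_direction_space[OF assms] by (simp add: iterates_0)
next
  case (Suc i)
  have "p (Suc i) - \<beta> i *\<^sub>R p i \<in> direction_space m"
    using assms Suc
    by (intro subspace_diff subspace_scale subspace_direction_space direction_in_direction_space) auto
  then show ?thesis by (simp add: Suc p_Suc)
qed

lemma iterate_in_direction_space: "x k \<in> direction_space k"
proof (induction k)
  case (Suc k)
  then have "x k \<in> direction_space (Suc k)" by (rule direction_space_mono) simp
  then show ?case unfolding x_Suc
    by (intro subspace_add subspace_scale subspace_direction_space direction_in_direction_space) auto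
qed (simp add: iterates_0 subspace_0 subspace_direction_space)

lemma iterate_minimizes_energy_error:
  assumes nonzero: "\<And>j. j < k \<Longrightarrow> r j \<noteq> 0" and solution: "A *v xs = b"
    and y_in_space: "y \<in> direction_space k"
  shows "(xs - x k) \<bullet> (A *v (xs - x k)) \<le> (xs - y) \<bullet> (A *v (xs - y))"
proof -
  define d where "d = x k - y"
  define e where "e = xs - x k"
  have residual: "A *v e = r k"
    by (simp add: e_def residual_eq solution matrix_vector_mult_diff_distrib)
  have "d \<in> direction_space k"
    unfolding d_def
    by (intro subspace_diff subspace_direction_space iterate_in_direction_space y_in_space)
  then have orth: "r k \<bullet> d = 0" unfolding direction_space_def
    by (induction rule: span_induct_alt)
       (use residual_orthogonal_and_directions_conjugate[of k] nonzero in \<open>auto simp: inner_simps\<close>)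
  have "e \<bullet> (A *v d) = d \<bullet> r k"
    using inner_symmetric_matrix_commute[OF A_sym] residual by metis
  then have "(e + d) \<bullet> (A *v (e + d)) = e \<bullet> (A *v e) + d \<bullet> (A *v d)"
    using orth by (simp add: matrix_vector_right_distrib inner_simps residual inner_commute)
  moreover have "e + d = xs - y" by (simp add: d_def e_def)
  ultimately show ?thesis using A_psd[of d] unfolding e_def[symmetric] by simp
qed

lemma precond_matrix_maps_direction_space:
  assumes nonzero: "\<And>j. j < k \<Longrightarrow> r j \<noteq> 0" and y_in_space: "y \<in> direction_space k"
  shows "B *v (A *v y) \<in> direction_space (Suc k)"
  using y_in_space unfolding direction_space_def[of k]
proof (induction rule: span_induct_alt)
  case base
  then show ?case by (simp add: subspace_0 subspace_direction_space)
next
  case (step c v w)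
  then obtain i where v_eq: "i < k" "v = p i" by auto
  have "z (Suc i) = z i - \<alpha> i *\<^sub>R (B *v (A *v p i))"
    by (simp add: z_eq r_Suc matrix_vector_mult_diff_distrib matrix_vector_mult_scaleR)
  then have "B *v (A *v v) = (1 / \<alpha> i) *\<^sub>R (z i - z (Suc i))"
    using step_size_pos[OF nonzero[OF v_eq(1)]] v_eq(2) by simp
  moreover have "\<dots> \<in> direction_space (Suc k)"
    using v_eq(1)
    by (intro subspace_diff subspace_scale subspace_direction_space
        precond_residual_in_direction_space) auto
  ultimately have "c *\<^sub>R (B *v (A *v v)) + B *v (A *v w) \<in> direction_space (Suc k)"
    using step.IH by (intro subspace_add subspace_scale subspace_direction_space) auto
  then show ?case by (simp add: matrix_vector_right_distrib matrix_vector_mult_scaleR)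
qed

lemma polynomial_in_direction_space:
  assumes B_eq: "B = G ** transpose G" and A_diag: "transpose G ** A ** G = diagm \<mu>"
    and solution: "A *v (G *v y) = b"
    and nonzero: "\<And>j. j < k \<Longrightarrow> r j \<noteq> 0" and degree_le: "degree q \<le> k"
  shows "G *v (diagm (\<lambda>i. poly q (\<mu> i)) *v y) - poly q 0 *\<^sub>R (G *v y) \<in> direction_space k"
  using nonzero degree_le
proof (induction k arbitrary: q)
  case 0
  then obtain c where "q = [:c:]" using degree_eq_zeroE by auto
  moreover have "diagm (\<lambda>i. c) *v y = c *\<^sub>R y" by (simp add: diagm_mult_vec vec_eq_iff)
  ultimately show ?case
    by (simp add: matrix_vector_mult_scaleR subspace_0 subspace_direction_space)
next
  case (Suc k)
  obtain c s where q_eq: "q = pCons c s" by (metis pCons_cases)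
  then have degree_le: "degree s \<le> k" using Suc.prems(2) by (auto split: if_splits)
  have precond_matrix_eigen: "B *v (A *v (G *v v)) = G *v (diagm \<mu> *v v)" for v
    by (simp add: B_eq matrix_vector_mul_assoc matrix_mul_assoc flip: A_diag)
  define e where "e = G *v (diagm (\<lambda>i. poly s (\<mu> i)) *v y) - poly s 0 *\<^sub>R (G *v y)"
  have "diagm (\<lambda>i. poly q (\<mu> i)) *v y = c *\<^sub>R y + diagm \<mu> *v (diagm (\<lambda>i. poly s (\<mu> i)) *v y)"
    by (simp add: q_eq diagm_mult_vec vec_eq_iff algebra_simps)
  then have "G *v (diagm (\<lambda>i. poly q (\<mu> i)) *v y)
      = c *\<^sub>R (G *v y) + B *v (A *v (G *v (diagm (\<lambda>i. poly s (\<mu> i)) *v y)))"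
    by (simp add: matrix_vector_right_distrib matrix_vector_mult_scaleR precond_matrix_eigen)
  moreover have "z 0 = B *v (A *v (G *v y))" by (simp add: z_eq iterates_0 solution)
  ultimately have "G *v (diagm (\<lambda>i. poly q (\<mu> i)) *v y) - poly q 0 *\<^sub>R (G *v y)
      = B *v (A *v e) + poly s 0 *\<^sub>R z 0"
    by (simp add: q_eq e_def matrix_vector_mult_diff_distrib matrix_vector_mult_scaleR)
  moreover have "e \<in> direction_space k" unfolding e_def using Suc degree_le by simp
  then have "B *v (A *v e) \<in> direction_space (Suc k)"
    using Suc.prems(1) by (intro precond_matrix_maps_direction_space) auto
  ultimately show ?case
    by (simp add: subspace_add subspace_scale subspace_direction_space
        precond_residual_in_direction_space)
qed

lemma polynomial_energy_error_bound:
  assumes B_eq: "B = G ** transpose G" and A_diag: "transpose G ** A ** G = diagm \<mu>"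
    and \<mu>_nonneg: "\<And>i. 0 \<le> \<mu> i"
    and solution: "A *v (G *v y) = b"
    and residual_polynomial: "degree q \<le> k" "poly q 0 = 1" "\<And>i. \<bar>poly q (\<mu> i)\<bar> \<le> \<epsilon>"
  shows "(G *v y - x k) \<bullet> (A *v (G *v y - x k)) \<le> \<epsilon>\<^sup>2 * ((G *v y) \<bullet> (A *v (G *v y)))"
proof (cases "\<exists>j<k. r j = 0")
  case True
  then have "r k = 0" using residual_zero_stays less_imp_le by blast
  then have "A *v (G *v y - x k) = 0"
    by (simp add: residual_eq solution matrix_vector_mult_diff_distrib)
  then show ?thesis using A_psd by simp
next
  case False
  define v where "v = G *v (diagm (\<lambda>i. poly q (\<mu> i)) *v y)"
  have "v - G *v y \<in> direction_space k"
    using polynomial_in_direction_space[OF B_eq A_diag solution _ residual_polynomial(1)] False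
    by (simp add: v_def residual_polynomial(2))
  then have "G *v y - v \<in> direction_space k"
    using subspace_neg[OF subspace_direction_space] by fastforce
  then have "(G *v y - x k) \<bullet> (A *v (G *v y - x k))
      \<le> (G *v y - (G *v y - v)) \<bullet> (A *v (G *v y - (G *v y - v)))"
    using False by (intro iterate_minimizes_energy_error solution) auto
  also have "\<dots> = (\<Sum>i\<in>UNIV. (poly q (\<mu> i))\<^sup>2 * (\<mu> i * (y $ i)\<^sup>2))"
    by (simp add: v_def inner_congruence A_diag inner_diagm diagm_mult_vec[of "\<lambda>i. poly q (\<mu> i)"]
        power_mult_distrib mult_ac)
  also have "\<dots> \<le> (\<Sum>i\<in>UNIV. \<epsilon>\<^sup>2 * (\<mu> i * (y $ i)\<^sup>2))"
  proof (intro sum_mono mult_right_mono)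
    fix i
    have "\<bar>poly q (\<mu> i)\<bar> \<le> \<bar>\<epsilon>\<bar>" using residual_polynomial(3)[of i] by linarith
    then show "(poly q (\<mu> i))\<^sup>2 \<le> \<epsilon>\<^sup>2" by (simp add: abs_le_square_iff)
  qed (simp add: \<mu>_nonneg)
  also have "\<dots> = \<epsilon>\<^sup>2 * ((G *v y) \<bullet> (A *v (G *v y)))"
    by (simp add: inner_congruence A_diag inner_diagm sum_distrib_left)
  finally show ?thesis .
qed

end

fun cheb :: "nat \<Rightarrow> real poly" where
  "cheb 0 = 1"
| "cheb (Suc 0) = [:0, 1:]"
| "cheb (Suc (Suc k)) = [:0, 2:] * cheb (Suc k) - cheb k"

lemma degree_cheb_le: "degree (cheb k) \<le> k"
proof (induction k rule: induct_nat_012)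
  case (ge2 k)
  have "degree ([:0, 2:] * cheb (Suc k)) \<le> degree [:0, 2::real:] + degree (cheb (Suc k))"
    by (rule degree_mult_le)
  then show ?case using ge2 by (auto intro!: degree_diff_le)
qed auto

lemma poly_cheb_cos: "poly (cheb k) (cos \<theta>) = cos (real k * \<theta>)"
proof (induction k rule: induct_nat_012)
  case (ge2 k)
  have "cos (real (Suc (Suc k)) * \<theta>) + cos (real k * \<theta>) = 2 * cos \<theta> * cos (real (Suc k) * \<theta>)"
    using cos_plus_cos[of "real (Suc (Suc k)) * \<theta>" "real k * \<theta>"]
    by (simp add: algebra_simps add_divide_distrib)
  then show ?case using ge2 by simp
qed simp_all

lemma abs_poly_cheb_le_1: "\<bar>t\<bar> \<le> 1 \<Longrightarrow> \<bar>poly (cheb k) t\<bar> \<le> 1"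
  using poly_cheb_cos[of k "arccos t"] cos_arccos_abs[of t] abs_cos_le_one[of "real k * arccos t"]
  by simp

lemma poly_cheb_half_sum:
  assumes "u * v = 1"
  shows "poly (cheb k) ((u + v) / 2) = (u ^ k + v ^ k) / 2"
proof (induction k rule: induct_nat_012)
  case (ge2 k)
  have "(u + v) * (u * u ^ k + v * v ^ k)
      = u * (u * u ^ k) + v * (v * v ^ k) + (u * v) * (u ^ k + v ^ k)"
    by (simp add: algebra_simps)
  then show ?case using ge2 assms by (simp add: field_simps)
qed simp_all

lemma poly_cheb_ge:
  fixes s :: real
  assumes s_gt_1: "1 < s"
  shows "((s + 1) / (s - 1)) ^ k / 2 \<le> poly (cheb k) ((s\<^sup>2 + 1) / (s\<^sup>2 - 1))"
proof -
  define u v where "u = (s + 1) / (s - 1)" and "v = (s - 1) / (s + 1)"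
  have uv_mult: "u * v = 1" "0 < v" using s_gt_1 by (simp_all add: u_def v_def)
  have "(s\<^sup>2 + 1) / (s\<^sup>2 - 1) = (u + v) / 2"
    using s_gt_1 power_strict_mono[of 1 s 2]
    unfolding u_def v_def by (simp add: field_simps power2_eq_square)
  then have "poly (cheb k) ((s\<^sup>2 + 1) / (s\<^sup>2 - 1)) = (u ^ k + v ^ k) / 2"
    using poly_cheb_half_sum[OF uv_mult(1), of k] by (simp only:)
  then show ?thesis using uv_mult(2) by (simp add: u_def)
qed

lemma chebyshev_residual_polynomial:
  fixes a \<kappa> :: real
  assumes "0 < a" "1 < \<kappa>"
  obtains q where "degree q \<le> k" "poly q 0 = 1"
    "\<And>m. a \<le> m \<Longrightarrow> m \<le> \<kappa> * a \<Longrightarrow> \<bar>poly q m\<bar> \<le> 2 * ((sqrt \<kappa> - 1) / (sqrt \<kappa> + 1)) ^ k"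
proof -
  define \<zeta> where "\<zeta> = (sqrt \<kappa> - 1) / (sqrt \<kappa> + 1)"
  define L where "L = [:(\<kappa> + 1) / (\<kappa> - 1), - 2 / ((\<kappa> - 1) * a):]"
  define T where "T = poly (cheb k) ((\<kappa> + 1) / (\<kappa> - 1))"
  have sqrt_gt: "0 < sqrt \<kappa> - 1" "0 < sqrt \<kappa> + 1" using assms by (simp_all add: add_pos_pos)
  have lower: "((sqrt \<kappa> + 1) / (sqrt \<kappa> - 1)) ^ k / 2 \<le> T"
    using poly_cheb_ge[of "sqrt \<kappa>" k] assms by (simp add: T_def)
  moreover have "0 < ((sqrt \<kappa> + 1) / (sqrt \<kappa> - 1)) ^ k / 2"
    using sqrt_gt by (simp only: divide_pos_pos zero_less_power zero_less_numeral)
  ultimately have T_pos: "0 < T" by linarith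
  have "1 = ((sqrt \<kappa> + 1) / (sqrt \<kappa> - 1)) ^ k / 2 * (2 * \<zeta> ^ k)"
    using sqrt_gt unfolding \<zeta>_def by (simp add: power_divide)
  also have "\<dots> \<le> T * (2 * \<zeta> ^ k)"
    using lower sqrt_gt by (intro mult_right_mono) (auto simp: \<zeta>_def)
  finally have inverse_T: "1 / T \<le> 2 * \<zeta> ^ k" using T_pos by (simp add: field_simps)
  show thesis
  proof (rule that[of "smult (1 / T) (pcompose (cheb k) L)"])
    have "degree L \<le> 1" by (simp add: L_def)
    then have "degree (pcompose (cheb k) L) \<le> k * 1"
      unfolding degree_pcompose by (intro mult_le_mono degree_cheb_le)
    then show "degree (smult (1 / T) (pcompose (cheb k) L)) \<le> k"
      using degree_smult_le[of "1 / T" "pcompose (cheb k) L"] by linarith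
    show "poly (smult (1 / T) (pcompose (cheb k) L)) 0 = 1"
      using T_pos by (simp add: poly_pcompose L_def T_def)
    fix m assume m_bounds: "a \<le> m" "m \<le> \<kappa> * a"
    have "poly L m = ((\<kappa> + 1) * a - 2 * m) / ((\<kappa> - 1) * a)"
      using assms by (simp add: L_def diff_divide_distrib)
    moreover have "\<bar>(\<kappa> + 1) * a - 2 * m\<bar> \<le> (\<kappa> - 1) * a"
      using m_bounds by (simp add: abs_le_iff algebra_simps)
    ultimately have "\<bar>poly L m\<bar> \<le> 1" using assms by (simp add: abs_mult)
    then have "\<bar>poly (cheb k) (poly L m)\<bar> \<le> 1" by (rule abs_poly_cheb_le_1)
    then have "\<bar>poly (smult (1 / T) (pcompose (cheb k) L)) m\<bar> \<le> 1 / T"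
      using T_pos by (simp add: poly_pcompose abs_mult divide_right_mono)
    then show "\<bar>poly (smult (1 / T) (pcompose (cheb k) L)) m\<bar> \<le> 2 * ((sqrt \<kappa> - 1) / (sqrt \<kappa> + 1)) ^ k"
      using inverse_T by (simp add: \<zeta>_def)
  qed
qed

theorem pcg_energy_error_bound:
  fixes A P :: "real^'n^'n"
  assumes A_sym: "transpose A = A" and P_sym_pos: "transpose P = P" "pos_def_matrix P"
    and bounds: "0 < a" "1 < \<kappa>" and lower: "a *\<^sub>R P \<preceq> A" and upper: "A \<preceq> (\<kappa> * a) *\<^sub>R P"
    and solution: "A *v xs = b"
  shows "(xs - pcg A P b k) \<bullet> (A *v (xs - pcg A P b k))
    \<le> (2 * ((sqrt \<kappa> - 1) / (sqrt \<kappa> + 1)) ^ k)\<^sup>2 * (xs \<bullet> (A *v xs))"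
proof -
  interpret pcg_iteration A P b
    using A_sym P_sym_pos pos_def_matrix_loewner_le[OF P_sym_pos(2) bounds(1) lower] by unfold_locales
  obtain G :: "real^'n^'n" and \<mu> where whitening: "transpose G ** P ** G = mat 1"
    and A_diag: "transpose G ** A ** G = diagm \<mu>"
    by (rule simultaneous_diagonalization[OF P_sym_pos A_sym])
  have \<mu>_bounds: "a \<le> \<mu> i \<and> \<mu> i \<le> \<kappa> * a" for i
  proof -
    let ?g = "G *v axis i 1"
    have "?g \<bullet> (P *v ?g) = 1" by (simp add: inner_congruence whitening inner_axis_axis)
    moreover have "?g \<bullet> (A *v ?g) = \<mu> i"
      by (simp add: inner_congruence A_diag inner_axis' diagm_mult_vec)
    ultimately show ?thesis using lower upper unfolding loewner_le_def
      by (metis inner_scaleR_right mult.right_neutral scaleR_matrix_vector_assoc)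
  qed
  obtain y where xs_eq: "xs = G *v y"
  proof -
    have "G ** (transpose G ** P) = mat 1"
      using whitening by (rule matrix_left_right_inverse[THEN iffD1])
    then have "xs = G *v ((transpose G ** P) *v xs)" by (simp add: matrix_vector_mul_assoc)
    then show thesis by (rule that)
  qed
  obtain q where "degree q \<le> k" "poly q 0 = 1"
    "\<And>m. a \<le> m \<Longrightarrow> m \<le> \<kappa> * a \<Longrightarrow> \<bar>poly q m\<bar> \<le> 2 * ((sqrt \<kappa> - 1) / (sqrt \<kappa> + 1)) ^ k"
    using chebyshev_residual_polynomial[OF bounds, of k] by blast
  moreover have "0 \<le> \<mu> i" for i using \<mu>_bounds[of i] bounds(1) by linarith
  ultimately show ?thesis unfolding pcg_eq_x xs_eq using \<mu>_bounds solution
    by (intro polynomial_energy_error_bound[OF matrix_inv_eq_whitening[OF whitening] A_diag])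
       (auto simp: xs_eq)
qed

corollary pcg_error_bound:
  fixes A P :: "real^'n^'n"
  assumes A_sym: "transpose A = A" and P_sym_pos: "transpose P = P" "pos_def_matrix P"
    and bounds: "0 < a" "1 < \<kappa>" and lower: "a *\<^sub>R P \<preceq> A" and upper: "A \<preceq> (\<kappa> * a) *\<^sub>R P"
    and coercive: "0 < \<rho>" "\<rho> *\<^sub>R mat 1 \<preceq> A"
  shows "norm (pcg A P b k - matrix_inv A *v b) \<le> 2 * ((sqrt \<kappa> - 1) / (sqrt \<kappa> + 1)) ^ k * (norm b / \<rho>)"
proof -
  define xs where "xs = matrix_inv A *v b"
  define d where "d = xs - pcg A P b k"
  define c where "c = 2 * ((sqrt \<kappa> - 1) / (sqrt \<kappa> + 1)) ^ k"
  have c_nonneg: "0 \<le> c" using bounds(2) by (simp add: c_def)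
  have solution: "A *v xs = b"
    using pos_def_matrix_inv_right[OF pos_def_matrix_loewner_le[OF P_sym_pos(2) bounds(1) lower]]
    by (simp add: xs_def matrix_vector_mul_assoc)
  have energy_ge: "\<rho> * (norm v)\<^sup>2 \<le> v \<bullet> (A *v v)" for v
    using coercive(2) unfolding loewner_le_def
    by (metis inner_scaleR_right matrix_vector_mul_lid power2_norm_eq_inner scaleR_matrix_vector_assoc)
  have "norm xs * (\<rho> * norm xs) \<le> norm xs * norm b"
    using energy_ge[of xs] norm_cauchy_schwarz[of xs b] by (simp add: solution power2_eq_square mult_ac)
  then have "\<rho> * norm xs \<le> norm b" by (cases "xs = 0") auto
  then have norm_xs_le: "norm xs \<le> norm b / \<rho>" using coercive(1) by (simp add: field_simps)
  have "\<rho> * (norm d)\<^sup>2 \<le> c\<^sup>2 * (xs \<bullet> (A *v xs))"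
    using energy_ge[of d] pcg_energy_error_bound[OF A_sym P_sym_pos bounds lower upper solution, of k]
    by (simp add: d_def c_def)
  also have "\<dots> \<le> c\<^sup>2 * (norm b / \<rho> * norm b)"
    using norm_cauchy_schwarz[of xs b] mult_right_mono[OF norm_xs_le norm_ge_zero[of b]]
    by (intro mult_left_mono) (auto simp: solution)
  finally have "(norm d)\<^sup>2 \<le> (c * (norm b / \<rho>))\<^sup>2"
    using coercive(1) by (simp add: field_simps power2_eq_square)
  then have "norm d \<le> c * (norm b / \<rho>)"
    by (rule power2_le_imp_le) (use c_nonneg coercive(1) in simp)
  then show ?thesis by (simp add: d_def c_def xs_def norm_minus_commute)
qed

lemma pcg_iters_sufficient:
  assumes "0 < \<rho>" "0 < e" "0 \<le> R"
  shows "2 * (3/5) ^ pcg_iters R e \<rho> * (R / \<rho>) \<le> e"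
proof (cases "R = 0")
  case False
  define X where "X = R / (e * \<rho>)"
  define k where "k = pcg_iters R e \<rho>"
  have X_pos: "0 < X" using False assms by (simp add: X_def)
  have k_ge: "4 + 2 * ln X \<le> real k" unfolding k_def pcg_iters_def X_def[symmetric] by linarith
  have "exp (1/2 :: real) \<le> 5/3"
  proof (rule power2_le_imp_le)
    have "(exp (1/2 :: real))\<^sup>2 = exp 1" by (simp flip: exp_of_nat_mult)
    then show "(exp (1/2 :: real))\<^sup>2 \<le> (5/3)\<^sup>2" using e_less_272 by (simp add: power2_eq_square)
  qed simp
  then have "(3/5) ^ k \<le> exp (- (1/2 :: real)) ^ k"
    by (intro power_mono) (auto simp: exp_minus field_simps)
  also have "\<dots> = exp (- (real k / 2))" by (simp flip: exp_of_nat_mult)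
  also have "\<dots> \<le> exp (- 2 - ln X)" using k_ge by simp
  also have "\<dots> = exp (- 2) / X" using X_pos by (simp add: exp_diff)
  also have "\<dots> \<le> (1/2) / X"
  proof (intro divide_right_mono)
    have "(2 :: real) \<le> exp 2" using exp_ge_add_one_self[of "2 :: real"] by simp
    then show "exp (- 2) \<le> (1/2 :: real)" by (simp add: exp_minus field_simps)
  qed (use X_pos in simp)
  finally have "2 * (3/5) ^ k * (R / \<rho>) \<le> 1 / X * (R / \<rho>)" using assms by (intro mult_right_mono) auto
  also have "\<dots> = e" using False assms by (simp add: X_def)
  finally show ?thesis by (simp add: k_def)
qed (use assms in simp)

definition pcg_accurate :: "real^'n^'n \<Rightarrow> real^'n^'n \<Rightarrow> real \<Rightarrow> bool" where
  "pcg_accurate A P \<rho> \<longleftrightarrow>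
    (\<forall>b R e. norm b \<le> R \<longrightarrow> 0 < e \<longrightarrow> norm (pcg A P b (pcg_iters R e \<rho>) - matrix_inv A *v b) \<le> e)"

theorem pcg_accurate_of_loewner_bounds:
  fixes A P :: "real^'n^'n"
  assumes "transpose A = A" "transpose P = P" "pos_def_matrix P" and \<rho>_pos: "0 < \<rho>"
    and "\<rho> *\<^sub>R mat 1 \<preceq> A" "\<rho> *\<^sub>R P \<preceq> A" "A \<preceq> (16 * \<rho>) *\<^sub>R P"
  shows "pcg_accurate A P \<rho>"
  unfolding pcg_accurate_def
proof (intro allI impI)
  fix b :: "real^'n" and R e :: real assume norm_b_le: "norm b \<le> R" and e_pos: "0 < e"
  have "norm (pcg A P b (pcg_iters R e \<rho>) - matrix_inv A *v b)
      \<le> 2 * ((sqrt 16 - 1) / (sqrt 16 + 1)) ^ pcg_iters R e \<rho> * (norm b / \<rho>)"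
    using assms by (intro pcg_error_bound) auto
  also have "\<dots> = 2 * (3/5) ^ pcg_iters R e \<rho> * (norm b / \<rho>)" by simp
  also have "\<dots> \<le> 2 * (3/5) ^ pcg_iters R e \<rho> * (R / \<rho>)"
    using norm_b_le \<rho>_pos by (intro mult_left_mono divide_right_mono) auto
  also have "\<dots> \<le> e"
    using \<rho>_pos e_pos order_trans[OF norm_ge_zero norm_b_le] by (rule pcg_iters_sufficient)
  finally show "norm (pcg A P b (pcg_iters R e \<rho>) - matrix_inv A *v b) \<le> e" .
qed

section \<open>Gaussian vectors\<close>

lemma nn_integral_normal_density: "0 < \<sigma> \<Longrightarrow> (\<integral>\<^sup>+t. ennreal (normal_density \<mu> \<sigma> t) \<partial>lborel) = 1"
  by (subst nn_integral_eq_integral) simp_all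

lemma nn_integral_normal_density_exp_square:
  assumes \<sigma>_pos: "0 < \<sigma>" and c_less: "2 * c * \<sigma>\<^sup>2 < 1"
  shows "(\<integral>\<^sup>+t. ennreal (normal_density 0 \<sigma> t) * ennreal (exp (c * t\<^sup>2)) \<partial>lborel)
      = ennreal (1 / sqrt (1 - 2 * c * \<sigma>\<^sup>2))"
proof -
  define D where "D = 1 - 2 * c * \<sigma>\<^sup>2"
  have D_pos: "0 < D" using c_less by (simp add: D_def)
  define \<tau> where "\<tau> = \<sigma> / sqrt D"
  have \<tau>_pos: "0 < \<tau>" using \<sigma>_pos D_pos by (simp add: \<tau>_def)
  have "normal_density 0 \<sigma> t * exp (c * t\<^sup>2) = (1 / sqrt D) * normal_density 0 \<tau> t" for t
  proof -
    have exponent: "c * t\<^sup>2 - t\<^sup>2 / (2 * \<sigma>\<^sup>2) = - t\<^sup>2 / (2 * \<tau>\<^sup>2)"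
      using \<sigma>_pos D_pos by (simp add: \<tau>_def power_divide field_simps) (simp add: D_def algebra_simps)
    have factor: "1 / sqrt (2 * pi * \<sigma>\<^sup>2) = (1 / sqrt D) * (1 / sqrt (2 * pi * \<tau>\<^sup>2))"
      using D_pos \<sigma>_pos by (simp add: \<tau>_def real_sqrt_mult)
    have "normal_density 0 \<sigma> t * exp (c * t\<^sup>2)
        = (1 / sqrt (2 * pi * \<sigma>\<^sup>2)) * exp (c * t\<^sup>2 - t\<^sup>2 / (2 * \<sigma>\<^sup>2))"
      by (simp add: normal_density_def exp_diff exp_minus field_simps)
    then show ?thesis unfolding exponent factor by (simp add: normal_density_def)
  qed
  then have "(\<integral>\<^sup>+t. ennreal (normal_density 0 \<sigma> t) * ennreal (exp (c * t\<^sup>2)) \<partial>lborel)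
      = (\<integral>\<^sup>+t. ennreal (1 / sqrt D) * ennreal (normal_density 0 \<tau> t) \<partial>lborel)"
    using D_pos by (simp flip: ennreal_mult')
  also have "\<dots> = ennreal (1 / sqrt D)"
    using \<tau>_pos by (simp add: nn_integral_cmult nn_integral_normal_density)
  finally show ?thesis by (simp add: D_def)
qed

lemma nn_integral_normal_density_exp:
  assumes \<sigma>_pos: "0 < \<sigma>"
  shows "(\<integral>\<^sup>+t. ennreal (normal_density 0 \<sigma> t) * ennreal (exp t) \<partial>lborel) = ennreal (exp (\<sigma>\<^sup>2 / 2))"
proof -
  have "normal_density 0 \<sigma> t * exp t = exp (\<sigma>\<^sup>2 / 2) * normal_density (\<sigma>\<^sup>2) \<sigma> t" for t
  proof -
    have "- t\<^sup>2 / (2 * \<sigma>\<^sup>2) + t = \<sigma>\<^sup>2 / 2 + - (t - \<sigma>\<^sup>2)\<^sup>2 / (2 * \<sigma>\<^sup>2)"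
      using \<sigma>_pos by (simp add: field_simps power2_eq_square)
    then have "exp (- t\<^sup>2 / (2 * \<sigma>\<^sup>2)) * exp t = exp (\<sigma>\<^sup>2 / 2) * exp (- (t - \<sigma>\<^sup>2)\<^sup>2 / (2 * \<sigma>\<^sup>2))"
      by (simp only: flip: exp_add)
    then show ?thesis by (simp add: normal_density_def)
  qed
  then show ?thesis
    using \<sigma>_pos
    by (simp add: nn_integral_cmult nn_integral_normal_density ennreal_mult'
        flip: ennreal_mult'[of _ "exp _"])
qed

lemma borel_measurable_vecI:
  fixes f :: "'a \<Rightarrow> real^'n"
  assumes "\<And>i. (\<lambda>x. f x $ i) \<in> borel_measurable M"
  shows "f \<in> borel_measurable M"
proof (rule borel_measurable_euclidean_space[THEN iffD2], rule)
  fix b :: "real^'n" assume "b \<in> Basis"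
  then obtain i where "b = axis i 1" by (auto simp: Basis_vec_def)
  then show "(\<lambda>x. f x \<bullet> b) \<in> borel_measurable M" using assms[of i] by (simp add: inner_axis)
qed

lemma borel_measurable_matrix_vector_mult [measurable (raw)]:
  fixes C :: "real^'n^'m"
  assumes "f \<in> borel_measurable N"
  shows "(\<lambda>x. C *v f x) \<in> borel_measurable N"
  using assms by (rule measurable_compose)
    (intro borel_measurable_continuous_onI matrix_vector_mult_linear_continuous_on)

lemma (in prob_space) distributed_linear_combination_normal:
  assumes finite_I: "finite I" and indep: "indep_vars (\<lambda>_. borel) X I" and \<sigma>_pos: "0 < \<sigma>"
    and normal: "\<And>i. i \<in> I \<Longrightarrow> distributed M lborel (X i) (normal_density 0 \<sigma>)"
    and nonzero: "\<exists>i\<in>I. c i \<noteq> 0"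
  shows "distributed M lborel (\<lambda>\<omega>. \<Sum>i\<in>I. c i * X i \<omega>) (normal_density 0 (\<sigma> * sqrt (\<Sum>i\<in>I. (c i)\<^sup>2)))"
proof -
  define J where "J = {i\<in>I. c i \<noteq> 0}"
  have J_subset: "finite J" "J \<noteq> {}" "J \<subseteq> I" using finite_I nonzero by (auto simp: J_def)
  have "distributed M lborel (\<lambda>x. \<Sum>i\<in>J. c i * X i x) (normal_density (\<Sum>i\<in>J. 0) (sqrt (\<Sum>i\<in>J. (\<bar>c i\<bar> * \<sigma>)\<^sup>2)))"
  proof (rule sum_indep_normal)
    show "indep_vars (\<lambda>i. borel) (\<lambda>i x. c i * X i x) J"
      by (rule indep_vars_compose2[OF indep_vars_subset[OF indep J_subset(3)]]) simp
    fix i assume i_in_J: "i \<in> J"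
    then show "0 < \<bar>c i\<bar> * \<sigma>" using \<sigma>_pos by (simp add: J_def)
    have "distributed M lborel (\<lambda>x. 0 + c i * X i x) (normal_density (0 + c i * 0) (\<bar>c i\<bar> * \<sigma>))"
      using i_in_J by (intro normal_density_affine normal \<sigma>_pos) (auto simp: J_def)
    then show "distributed M lborel (\<lambda>x. c i * X i x) (normal_density 0 (\<bar>c i\<bar> * \<sigma>))" by simp
  qed (use J_subset in auto)
  moreover have "(\<Sum>i\<in>J. c i * X i x) = (\<Sum>i\<in>I. c i * X i x)" for x
    using finite_I by (intro sum.mono_neutral_left) (auto simp: J_def)
  moreover have "(\<Sum>i\<in>J. (\<bar>c i\<bar> * \<sigma>)\<^sup>2) = \<sigma>\<^sup>2 * (\<Sum>i\<in>I. (c i)\<^sup>2)"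
    using finite_I by (subst sum.mono_neutral_left[of I J])
      (auto simp: J_def power_mult_distrib sum_distrib_left mult.commute)
  ultimately show ?thesis using \<sigma>_pos by (simp add: real_sqrt_mult)
qed

locale gaussian_vector = prob_space +
  fixes X :: "'a \<Rightarrow> real^'n" and \<sigma> :: real
  assumes \<sigma>_pos: "0 < \<sigma>"
    and normal_components: "\<And>i. distributed M lborel (\<lambda>\<omega>. X \<omega> $ i) (normal_density 0 \<sigma>)"
    and indep_components: "indep_vars (\<lambda>_. borel) (\<lambda>i \<omega>. X \<omega> $ i) UNIV"
begin

lemma measurable_vector [measurable]: "X \<in> borel_measurable M"
proof (rule borel_measurable_vecI)
  show "(\<lambda>\<omega>. X \<omega> $ i) \<in> borel_measurable M" for i
    using distributed_measurable[OF normal_components[of i]] by simp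
qed

lemma distributed_inner:
  assumes "a \<noteq> 0"
  shows "distributed M lborel (\<lambda>\<omega>. a \<bullet> X \<omega>) (normal_density 0 (\<sigma> * norm a))"
proof -
  have "\<exists>i\<in>UNIV. a $ i \<noteq> 0" using assms by (simp add: vec_eq_iff)
  from distributed_linear_combination_normal[OF finite indep_components \<sigma>_pos normal_components this]
  show ?thesis by (simp add: inner_vec_def norm_vec_def L2_set_def)
qed

lemma nn_integral_exp_inner:
  "(\<integral>\<^sup>+\<omega>. ennreal (exp (a \<bullet> X \<omega>)) \<partial>M) = ennreal (exp (\<sigma>\<^sup>2 * (norm a)\<^sup>2 / 2))"
proof (cases "a = 0")
  case False
  have "(\<integral>\<^sup>+\<omega>. ennreal (exp (a \<bullet> X \<omega>)) \<partial>M)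
      = (\<integral>\<^sup>+t. ennreal (normal_density 0 (\<sigma> * norm a) t) * ennreal (exp t) \<partial>lborel)"
    by (rule distributed_nn_integral[OF distributed_inner[OF False], symmetric]) measurable
  also have "\<dots> = ennreal (exp (\<sigma>\<^sup>2 * (norm a)\<^sup>2 / 2))"
    using False \<sigma>_pos by (subst nn_integral_normal_density_exp) (auto simp: power_mult_distrib)
  finally show ?thesis .
qed (simp add: emeasure_space_1)

lemma nn_integral_exp_inner_square:
  assumes "2 * c * (\<sigma> * norm a)\<^sup>2 < 1"
  shows "(\<integral>\<^sup>+\<omega>. ennreal (exp (c * (a \<bullet> X \<omega>)\<^sup>2)) \<partial>M) = ennreal (1 / sqrt (1 - 2 * c * (\<sigma> * norm a)\<^sup>2))"
proof (cases "a = 0")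
  case False
  have "(\<integral>\<^sup>+\<omega>. ennreal (exp (c * (a \<bullet> X \<omega>)\<^sup>2)) \<partial>M)
      = (\<integral>\<^sup>+t. ennreal (normal_density 0 (\<sigma> * norm a) t) * ennreal (exp (c * t\<^sup>2)) \<partial>lborel)"
    by (rule distributed_nn_integral[OF distributed_inner[OF False], symmetric]) measurable
  also have "\<dots> = ennreal (1 / sqrt (1 - 2 * c * (\<sigma> * norm a)\<^sup>2))"
    using False \<sigma>_pos assms by (intro nn_integral_normal_density_exp_square) auto
  finally show ?thesis .
qed (simp add: emeasure_space_1)

lemma inner_moments:
  shows integrable_inner: "integrable M (\<lambda>\<omega>. a \<bullet> X \<omega>)"
    and expectation_inner: "expectation (\<lambda>\<omega>. a \<bullet> X \<omega>) = 0"
    and integrable_inner_square: "integrable M (\<lambda>\<omega>. (a \<bullet> X \<omega>)\<^sup>2)"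
    and expectation_inner_square: "expectation (\<lambda>\<omega>. (a \<bullet> X \<omega>)\<^sup>2) = (\<sigma> * norm a)\<^sup>2"
proof -
  have "integrable M (\<lambda>\<omega>. a \<bullet> X \<omega>) \<and> expectation (\<lambda>\<omega>. a \<bullet> X \<omega>) = 0 \<and>
    integrable M (\<lambda>\<omega>. (a \<bullet> X \<omega>)\<^sup>2) \<and> expectation (\<lambda>\<omega>. (a \<bullet> X \<omega>)\<^sup>2) = (\<sigma> * norm a)\<^sup>2"
  proof (cases "a = 0")
    case False
    note dist = distributed_inner[OF False]
    have scale_pos: "0 < \<sigma> * norm a" using \<sigma>_pos False by simp
    have "integrable M (\<lambda>\<omega>. a \<bullet> X \<omega>)" "integrable M (\<lambda>\<omega>. (a \<bullet> X \<omega>)\<^sup>2)"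
      using distributed_integrable[OF dist, of "\<lambda>t. t"] distributed_integrable[OF dist, of "\<lambda>t. t\<^sup>2"]
        integrable_normal_moment[OF scale_pos, of 0 1] integrable_normal_moment[OF scale_pos, of 0 2]
      by simp_all
    moreover have "expectation (\<lambda>\<omega>. a \<bullet> X \<omega>) = 0"
      using normal_distributed_expectation[OF scale_pos dist] .
    moreover from this have "expectation (\<lambda>\<omega>. (a \<bullet> X \<omega>)\<^sup>2) = (\<sigma> * norm a)\<^sup>2"
      using normal_distributed_variance[OF scale_pos dist] by simp
    ultimately show ?thesis by simp
  qed simp
  then show "integrable M (\<lambda>\<omega>. a \<bullet> X \<omega>)" "expectation (\<lambda>\<omega>. a \<bullet> X \<omega>) = 0"
    "integrable M (\<lambda>\<omega>. (a \<bullet> X \<omega>)\<^sup>2)" "expectation (\<lambda>\<omega>. (a \<bullet> X \<omega>)\<^sup>2) = (\<sigma> * norm a)\<^sup>2"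
    by blast+
qed

lemma nn_integral_exp_weighted_squares:
  assumes "\<And>i. 2 * d i * \<sigma>\<^sup>2 < 1"
  shows "(\<integral>\<^sup>+\<omega>. ennreal (exp (\<Sum>i\<in>UNIV. d i * (X \<omega> $ i)\<^sup>2)) \<partial>M)
      = ennreal (\<Prod>i\<in>UNIV. 1 / sqrt (1 - 2 * d i * \<sigma>\<^sup>2))"
proof -
  have "(\<integral>\<^sup>+\<omega>. ennreal (exp (\<Sum>i\<in>UNIV. d i * (X \<omega> $ i)\<^sup>2)) \<partial>M)
      = (\<integral>\<^sup>+\<omega>. (\<Prod>i\<in>UNIV. ennreal (exp (d i * (X \<omega> $ i)\<^sup>2))) \<partial>M)"
    by (simp add: exp_sum prod_ennreal)
  also have "\<dots> = (\<Prod>i\<in>UNIV. \<integral>\<^sup>+\<omega>. ennreal (exp (d i * (X \<omega> $ i)\<^sup>2)) \<partial>M)"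
    by (rule indep_vars_nn_integral) (auto intro!: indep_vars_compose2[OF indep_components])
  also have "\<dots> = (\<Prod>i\<in>UNIV. ennreal (1 / sqrt (1 - 2 * d i * \<sigma>\<^sup>2)))"
    using nn_integral_exp_inner_square[of _ "axis _ 1"] assms by (simp add: inner_axis')
  also have "\<dots> = ennreal (\<Prod>i\<in>UNIV. 1 / sqrt (1 - 2 * d i * \<sigma>\<^sup>2))"
    using assms by (subst prod_ennreal) (auto simp: less_imp_le)
  finally show ?thesis .
qed

end

lemma nn_integral_lborel_vec_prod:
  fixes f :: "'n::finite \<Rightarrow> real \<Rightarrow> ennreal"
  assumes [measurable]: "\<And>i. f i \<in> borel_measurable borel"
  shows "(\<integral>\<^sup>+x. (\<Prod>i\<in>UNIV. f i (x $ i)) \<partial>(lborel :: (real^'n) measure)) = (\<Prod>i\<in>UNIV. \<integral>\<^sup>+t. f i t \<partial>lborel)"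
proof -
  define ix :: "real^'n \<Rightarrow> 'n" where "ix b = (SOME i. b = axis i 1)" for b
  have ix_axis: "ix (axis i 1) = i" for i by (simp add: ix_def axis_eq_axis)
  have Basis: "(Basis :: (real^'n) set) = (\<lambda>i. axis i 1) ` UNIV" by (auto simp: Basis_vec_def)
  have inj_axis: "inj (\<lambda>i::'n. axis i (1::real))" by (simp add: inj_def axis_eq_axis)
  have "(\<integral>\<^sup>+x. (\<Prod>b\<in>Basis. f (ix b) (x \<bullet> b)) \<partial>lborel) = (\<Prod>b\<in>Basis. \<integral>\<^sup>+t. f (ix b) t \<partial>lborel)"
    by (rule nn_integral_lborel_prod) auto
  then show ?thesis unfolding Basis by (simp add: prod.reindex[OF inj_axis] ix_axis inner_axis)
qed

definition gauss :: "real \<Rightarrow> (real^'n) measure" where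
  "gauss \<sigma> = density lborel (\<lambda>x. ennreal (\<Prod>i\<in>UNIV. normal_density 0 \<sigma> (x $ i)))"

lemma borel_measurable_gauss_density [measurable]:
  "(\<lambda>x::real^'n. \<Prod>i\<in>UNIV. normal_density 0 \<sigma> (x $ i)) \<in> borel_measurable borel"
  by (intro borel_measurable_prod) measurable

lemma sets_gauss [measurable_cong, simp]: "sets (gauss \<sigma>) = sets borel"
  by (simp add: gauss_def)

lemma space_gauss [simp]: "space (gauss \<sigma>) = UNIV"
  by (simp add: gauss_def)

lemma emeasure_gauss_box:
  fixes A :: "'n::finite \<Rightarrow> real set"
  assumes [measurable]: "\<And>i. A i \<in> sets borel"
  shows "emeasure (gauss \<sigma>) {x. \<forall>i. x $ i \<in> A i}
      = (\<Prod>i\<in>UNIV. emeasure (density lborel (normal_density 0 \<sigma>)) (A i))"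
proof -
  let ?box = "{x::real^'n. \<forall>i. x $ i \<in> A i}"
  have [measurable]: "?box \<in> sets borel" by measurable
  have "emeasure (gauss \<sigma>) ?box
      = (\<integral>\<^sup>+x. ennreal (\<Prod>i\<in>UNIV. normal_density 0 \<sigma> (x $ i)) * indicator ?box x \<partial>lborel)"
    unfolding gauss_def by (rule emeasure_density) measurable
  also have "\<dots> = (\<integral>\<^sup>+x. (\<Prod>i\<in>UNIV. ennreal (normal_density 0 \<sigma> (x $ i)) * indicator (A i) (x $ i)) \<partial>lborel)"
  proof -
    have "(indicator ?box x :: ennreal) = (\<Prod>i\<in>UNIV. indicator (A i) (x $ i))" for x
      by (auto simp: indicator_def prod_zero_iff)
    then show ?thesis by (simp add: prod.distrib prod_ennreal)
  qed
  also have "\<dots> = (\<Prod>i\<in>UNIV. \<integral>\<^sup>+t. ennreal (normal_density 0 \<sigma> t) * indicator (A i) t \<partial>lborel)"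
    by (rule nn_integral_lborel_vec_prod) measurable
  finally show ?thesis by (simp add: emeasure_density)
qed

context
  fixes \<sigma> :: real
  assumes \<sigma>_pos: "0 < \<sigma>"
begin

interpretation normal: prob_space "density lborel (normal_density 0 \<sigma>)"
  using \<sigma>_pos by (rule prob_space_normal_density)

lemma prob_space_gauss: "prob_space (gauss \<sigma> :: (real^'n) measure)"
proof
  show "emeasure (gauss \<sigma> :: (real^'n) measure) (space (gauss \<sigma>)) = 1"
    using emeasure_gauss_box[of "\<lambda>_. UNIV" \<sigma>] normal.emeasure_space_1 by simp
qed

interpretation gauss: prob_space "gauss \<sigma> :: (real^'n) measure"
  by (rule prob_space_gauss)

lemma distr_gauss_component:
  "distr (gauss \<sigma> :: (real^'n) measure) lborel (\<lambda>x. x $ i) = density lborel (normal_density 0 \<sigma>)"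
proof (rule measure_eqI)
  fix A assume "A \<in> sets (distr (gauss \<sigma> :: (real^'n) measure) lborel (\<lambda>x. x $ i))"
  then have [measurable]: "A \<in> sets borel" by simp
  have "emeasure (distr (gauss \<sigma> :: (real^'n) measure) lborel (\<lambda>x. x $ i)) A
      = emeasure (gauss \<sigma> :: (real^'n) measure) {x. \<forall>k. x $ k \<in> (if k = i then A else UNIV)}"
    by (subst emeasure_distr) (auto intro!: arg_cong2[where f = emeasure] split: if_splits)
  also have "\<dots> = (\<Prod>k\<in>UNIV. emeasure (density lborel (normal_density 0 \<sigma>)) (if k = i then A else UNIV))"
    by (rule emeasure_gauss_box) simp
  also have "\<dots> = (\<Prod>k\<in>UNIV. if k = i then emeasure (density lborel (normal_density 0 \<sigma>)) A else 1)"
    using normal.emeasure_space_1 by (intro prod.cong) auto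
  finally show "emeasure (distr (gauss \<sigma> :: (real^'n) measure) lborel (\<lambda>x. x $ i)) A
      = emeasure (density lborel (normal_density 0 \<sigma>)) A"
    by simp
qed simp

lemma indep_gauss_components:
  "prob_space.indep_vars (gauss \<sigma> :: (real^'n) measure) (\<lambda>_. borel) (\<lambda>i x. x $ i) UNIV"
proof -
  let ?N = "gauss \<sigma> :: (real^'n) measure"
  have [measurable]: "(\<lambda>x. x $ i) \<in> measurable ?N borel" for i by measurable
  interpret P: product_prob_space "\<lambda>i. distr ?N borel (\<lambda>x. x $ i)" UNIV
    by (intro product_prob_spaceI gauss.prob_space_distr) measurable
  have component: "distr ?N borel (\<lambda>x. x $ i) = density lborel (normal_density 0 \<sigma>)" for i
    using distr_gauss_component[of i] by (simp add: distr_cong[OF refl, of borel lborel])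
  have "distr ?N (Pi\<^sub>M UNIV (\<lambda>_. borel)) (\<lambda>x. \<lambda>i\<in>UNIV. x $ i)
      = Pi\<^sub>M UNIV (\<lambda>i. distr ?N borel (\<lambda>x. x $ i))"
  proof (rule P.PiM_eqI)
    fix A :: "'n \<Rightarrow> real set" assume "\<And>i. i \<in> UNIV \<Longrightarrow> A i \<in> sets (distr ?N borel (\<lambda>x. x $ i))"
    then have [measurable]: "A i \<in> sets borel" for i by simp
    have "emeasure (distr ?N (Pi\<^sub>M UNIV (\<lambda>_. borel)) (\<lambda>x. \<lambda>i\<in>UNIV. x $ i)) (Pi\<^sub>E UNIV A)
        = emeasure ?N {x. \<forall>i. x $ i \<in> A i}"
      by (subst emeasure_distr)
         (auto intro!: arg_cong2[where f = emeasure] sets_PiM_I_finite measurable_restrict)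
    then show "emeasure (distr ?N (Pi\<^sub>M UNIV (\<lambda>_. borel)) (\<lambda>x. \<lambda>i\<in>UNIV. x $ i)) (Pi\<^sub>E UNIV A)
        = (\<Prod>i\<in>UNIV. emeasure (distr ?N borel (\<lambda>x. x $ i)) (A i))"
      by (simp add: component emeasure_gauss_box)
  qed (auto intro!: sets_PiM_cong)
  then show ?thesis by (subst gauss.indep_vars_iff_distr_eq_PiM') auto
qed

lemma gaussian_vector_gauss: "gaussian_vector (gauss \<sigma> :: (real^'n) measure) (\<lambda>x. x) \<sigma>"
proof
  show "distributed (gauss \<sigma> :: (real^'n) measure) lborel (\<lambda>x. x $ i) (normal_density 0 \<sigma>)" for i
    by (auto simp: distributed_def distr_gauss_component)
qed (rule \<sigma>_pos indep_gauss_components)+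

lemma nn_integral_gauss_shift:
  fixes v :: "real^'n"
  assumes [measurable]: "f \<in> borel_measurable borel"
  shows "(\<integral>\<^sup>+x. f x \<partial>gauss \<sigma>)
    = (\<integral>\<^sup>+x. f (v + x) * ennreal (exp (- (v \<bullet> x) / \<sigma>\<^sup>2 - (norm v)\<^sup>2 / (2 * \<sigma>\<^sup>2))) \<partial>gauss \<sigma>)"
proof -
  let ?g = "\<lambda>x::real^'n. \<Prod>i\<in>UNIV. normal_density 0 \<sigma> (x $ i)"
  let ?e = "\<lambda>x. exp (- (v \<bullet> x) / \<sigma>\<^sup>2 - (norm v)\<^sup>2 / (2 * \<sigma>\<^sup>2))"
  have nonneg: "0 \<le> ?g x" for x by (simp add: prod_nonneg)
  have shift1: "normal_density 0 \<sigma> (a + t)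
      = normal_density 0 \<sigma> t * exp (- (a * t) / \<sigma>\<^sup>2 - a\<^sup>2 / (2 * \<sigma>\<^sup>2))" for a t
  proof -
    have "- (a + t)\<^sup>2 / (2 * \<sigma>\<^sup>2) = - t\<^sup>2 / (2 * \<sigma>\<^sup>2) + (- (a * t) / \<sigma>\<^sup>2 - a\<^sup>2 / (2 * \<sigma>\<^sup>2))"
      using \<sigma>_pos by (simp add: field_simps power2_eq_square)
    then show ?thesis by (simp add: normal_density_def flip: exp_add)
  qed
  have shift: "?g (v + x) = ?g x * ?e x" for x
  proof -
    have "?g (v + x) = ?g x * exp (\<Sum>i\<in>UNIV. - (v $ i * x $ i) / \<sigma>\<^sup>2 - (v $ i)\<^sup>2 / (2 * \<sigma>\<^sup>2))"
      by (simp add: shift1 prod.distrib exp_sum)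
    also have "(\<Sum>i\<in>UNIV. - (v $ i * x $ i) / \<sigma>\<^sup>2 - (v $ i)\<^sup>2 / (2 * \<sigma>\<^sup>2))
        = - (v \<bullet> x) / \<sigma>\<^sup>2 - (norm v)\<^sup>2 / (2 * \<sigma>\<^sup>2)"
      by (simp add: sum_subtractf sum_divide_distrib sum_negf inner_vec_def norm_vec_def L2_set_def
          sum_nonneg)
    finally show ?thesis .
  qed
  have "(\<integral>\<^sup>+x. f x \<partial>gauss \<sigma>) = (\<integral>\<^sup>+x. ennreal (?g x) * f x \<partial>lborel)"
    unfolding gauss_def by (rule nn_integral_density) measurable
  also have "\<dots> = (\<integral>\<^sup>+x. ennreal (?g x) * f x \<partial>distr lborel borel ((+) v))"
    by (simp only: lborel_distr_plus)
  also have "\<dots> = (\<integral>\<^sup>+x. ennreal (?g (v + x)) * f (v + x) \<partial>lborel)"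
    by (rule nn_integral_distr) measurable
  also have "\<dots> = (\<integral>\<^sup>+x. ennreal (?g x) * (f (v + x) * ennreal (?e x)) \<partial>lborel)"
    unfolding shift by (simp add: ennreal_mult' nonneg mult_ac)
  also have "\<dots> = (\<integral>\<^sup>+x. f (v + x) * ennreal (?e x) \<partial>gauss \<sigma>)"
    unfolding gauss_def by (rule nn_integral_density[symmetric]) measurable
  finally show ?thesis .
qed

end

lemma (in prob_space) exp_expectation_le_nn_integral_exp:
  assumes G_integrable: "integrable M G"
  shows "ennreal (exp (expectation G)) \<le> (\<integral>\<^sup>+x. ennreal (exp (G x)) \<partial>M)"
proof (cases "(\<integral>\<^sup>+x. ennreal (exp (G x)) \<partial>M) = \<infinity>")
  case False
  then have "integrable M (\<lambda>x. exp (G x))"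
    using G_integrable by (intro integrableI_nonneg) (auto simp: less_top)
  moreover from this have "exp (expectation G) \<le> expectation (\<lambda>x. exp (G x))"
    using G_integrable by (intro jensens_inequality[where I = UNIV]) (auto simp: exp_convex)
  ultimately show ?thesis by (simp add: nn_integral_eq_integral)
qed simp

lemma exp_expectation_le_nn_integral_gauss_shift:
  fixes v :: "real^'n"
  assumes \<sigma>_pos: "0 < \<sigma>" and [measurable]: "f \<in> borel_measurable borel"
    and G_integrable: "integrable (gauss \<sigma>) G"
    and exp_G_le: "\<And>x. ennreal (exp (G x)) \<le> f (v + x)"
  shows "ennreal (exp ((\<integral>x. G x \<partial>gauss \<sigma>) - (norm v)\<^sup>2 / (2 * \<sigma>\<^sup>2))) \<le> (\<integral>\<^sup>+x. f x \<partial>gauss \<sigma>)"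
proof -
  interpret gaussian_vector "gauss \<sigma> :: (real^'n) measure" "\<lambda>x. x" \<sigma>
    using \<sigma>_pos by (rule gaussian_vector_gauss)
  define G' where "G' x = G x + (- (v \<bullet> x) / \<sigma>\<^sup>2 - (norm v)\<^sup>2 / (2 * \<sigma>\<^sup>2))" for x
  have "integrable (gauss \<sigma>) G'"
    unfolding G'_def using integrable_inner
    by (intro Bochner_Integration.integrable_add Bochner_Integration.integrable_diff G_integrable
        integrable_divide integrable_minus integrable_const)
  moreover have "(\<integral>x. G' x \<partial>gauss \<sigma>) = (\<integral>x. G x \<partial>gauss \<sigma>) - (norm v)\<^sup>2 / (2 * \<sigma>\<^sup>2)"
    using G_integrable integrable_inner[of v] expectation_inner[of v] prob_space by (simp add: G'_def)
  ultimately have "ennreal (exp ((\<integral>x. G x \<partial>gauss \<sigma>) - (norm v)\<^sup>2 / (2 * \<sigma>\<^sup>2)))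
      \<le> (\<integral>\<^sup>+x. ennreal (exp (G' x)) \<partial>gauss \<sigma>)"
    using exp_expectation_le_nn_integral_exp by metis
  also have "\<dots> \<le> (\<integral>\<^sup>+x. f (v + x) * ennreal (exp (- (v \<bullet> x) / \<sigma>\<^sup>2 - (norm v)\<^sup>2 / (2 * \<sigma>\<^sup>2))) \<partial>gauss \<sigma>)"
    unfolding G'_def exp_add
    by (intro nn_integral_mono) (simp add: ennreal_mult' exp_G_le mult_right_mono)
  also have "\<dots> = (\<integral>\<^sup>+x. f x \<partial>gauss \<sigma>)"
    using \<sigma>_pos by (rule nn_integral_gauss_shift[symmetric]) measurable
  finally show ?thesis .
qed

lemma inverse_sqrt_le_exp:
  fixes t d :: real
  assumes t_bounds: "0 \<le> t" "2 * t < 1" and d_bounds: "0 \<le> d" "d \<le> 1"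
  shows "1 / sqrt (1 - 2 * (t * d)) \<le> exp (t / (1 - 2 * t) * d)"
proof -
  have product_le: "t * d \<le> t" using t_bounds d_bounds by (simp add: mult_left_le)
  then have "1 / (1 - 2 * (t * d)) = 1 + 2 * (t * d) / (1 - 2 * (t * d))"
    using t_bounds by (simp add: field_simps)
  also have "\<dots> \<le> 1 + 2 * (t * d) / (1 - 2 * t)"
    using t_bounds d_bounds product_le by (intro add_left_mono divide_left_mono) auto
  also have "\<dots> \<le> exp (2 * (t * d) / (1 - 2 * t))" by (rule exp_ge_add_one_self)
  also have "\<dots> = (exp (t / (1 - 2 * t) * d))\<^sup>2" by (simp add: mult_ac flip: exp_of_nat_mult)
  finally have "sqrt (1 / (1 - 2 * (t * d))) \<le> exp (t / (1 - 2 * t) * d)" by (intro real_le_lsqrt) auto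
  then show ?thesis by (simp add: real_sqrt_divide)
qed

context gaussian_vector
begin

text \<open>The square in the exponent is linearised by an independent Gaussian vector
  (Hubbard--Stratonovich), after which the random vector only enters through its moment generating
  function.\<close>

lemma nn_integral_exp_norm_square:
  fixes C :: "real^'m^'n"
  assumes gram_C: "transpose C ** C = diagm d" and \<theta>_nonneg: "0 \<le> \<theta>"
    and d_less: "\<And>i. 2 * (\<theta> * \<sigma>\<^sup>2 * d i) < 1"
  shows "(\<integral>\<^sup>+\<omega>. ennreal (exp (\<theta> * (norm (transpose C *v X \<omega>))\<^sup>2)) \<partial>M)
    = ennreal (\<Prod>i\<in>UNIV. 1 / sqrt (1 - 2 * (\<theta> * \<sigma>\<^sup>2 * d i)))"
proof -
  let ?N = "gauss 1 :: (real^'m) measure"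
  interpret N: gaussian_vector ?N "\<lambda>x. x" 1 by (rule gaussian_vector_gauss) simp
  interpret NM: pair_sigma_finite ?N M ..
  define c where "c = sqrt (2 * \<theta>)"
  have c_square: "c\<^sup>2 = 2 * \<theta>" using \<theta>_nonneg by (simp add: c_def)
  have "(\<integral>\<^sup>+\<omega>. ennreal (exp (\<theta> * (norm (transpose C *v X \<omega>))\<^sup>2)) \<partial>M)
      = (\<integral>\<^sup>+\<omega>. (\<integral>\<^sup>+x. ennreal (exp ((c *\<^sub>R (transpose C *v X \<omega>)) \<bullet> x)) \<partial>?N) \<partial>M)"
    by (subst N.nn_integral_exp_inner) (simp add: power_mult_distrib c_square)
  also have "\<dots> = (\<integral>\<^sup>+\<omega>. (\<integral>\<^sup>+x. ennreal (exp ((c *\<^sub>R (C *v x)) \<bullet> X \<omega>)) \<partial>?N) \<partial>M)"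
    by (simp add: inner_commute[of "C *v _"] inner_matrix_transpose)
  also have "\<dots> = (\<integral>\<^sup>+x. (\<integral>\<^sup>+\<omega>. ennreal (exp ((c *\<^sub>R (C *v x)) \<bullet> X \<omega>)) \<partial>M) \<partial>?N)"
    by (rule NM.Fubini') measurable
  also have "\<dots> = (\<integral>\<^sup>+x. ennreal (exp (\<Sum>i\<in>UNIV. (\<theta> * \<sigma>\<^sup>2 * d i) * (x $ i)\<^sup>2)) \<partial>?N)"
  proof -
    have "\<sigma>\<^sup>2 * (norm (c *\<^sub>R (C *v x)))\<^sup>2 / 2 = (\<Sum>i\<in>UNIV. (\<theta> * \<sigma>\<^sup>2 * d i) * (x $ i)\<^sup>2)" for x
      by (simp add: power_mult_distrib c_square norm_matrix_vector_power2 gram_C inner_diagm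
          sum_distrib_left mult_ac)
    then show ?thesis by (simp only: nn_integral_exp_inner)
  qed
  also have "\<dots> = ennreal (\<Prod>i\<in>UNIV. 1 / sqrt (1 - 2 * (\<theta> * \<sigma>\<^sup>2 * d i)))"
    using N.nn_integral_exp_weighted_squares[of "\<lambda>i. \<theta> * \<sigma>\<^sup>2 * d i"] d_less by simp
  finally show ?thesis .
qed

lemma nn_integral_exp_norm_square_le:
  fixes C :: "real^'m^'n"
  assumes contraction: "\<And>x. norm (C *v x) \<le> norm x" and \<theta>_bounds: "0 \<le> \<theta>" "2 * (\<theta> * \<sigma>\<^sup>2) < 1"
  shows "(\<integral>\<^sup>+\<omega>. ennreal (exp (\<theta> * (norm (transpose C *v X \<omega>))\<^sup>2)) \<partial>M)
    \<le> ennreal (exp (\<theta> * \<sigma>\<^sup>2 / (1 - 2 * (\<theta> * \<sigma>\<^sup>2)) * trace (transpose C ** C)))"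
proof -
  define t where "t = \<theta> * \<sigma>\<^sup>2"
  have t_bounds: "0 \<le> t" "2 * t < 1" using \<theta>_bounds by (auto simp: t_def)
  have "transpose (transpose C ** C) = transpose C ** C" by (simp add: matrix_transpose_mul)
  then obtain Q d where Q_orthogonal: "orthogonal_matrix Q"
    and gram_C: "transpose C ** C = spectral_matrix Q d"
    by (rule symmetric_matrix_diagonalizable)
  have Q_orthonormal: "transpose Q ** Q = mat 1" using Q_orthogonal by (simp add: orthogonal_matrix_def)
  have "(norm (C *v column i Q))\<^sup>2 = d i" for i
    by (simp add: norm_matrix_vector_power2 gram_C inner_spectral_matrix_column[OF Q_orthonormal])
  moreover have "(norm (C *v column i Q))\<^sup>2 \<le> 1" for i
    using contraction[of "column i Q"]
    by (simp add: norm_column_orthonormal[OF Q_orthonormal] power_le_one)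
  ultimately have d_bounds: "0 \<le> d i" "d i \<le> 1" for i by (metis zero_le_power2, metis)
  have "transpose (C ** Q) ** (C ** Q) = transpose Q ** (transpose C ** C) ** Q"
    by (simp add: matrix_transpose_mul matrix_mul_assoc)
  then have gram_CQ: "transpose (C ** Q) ** (C ** Q) = diagm d"
    by (simp add: gram_C compress_spectral_matrix[OF Q_orthonormal])
  have product_less: "2 * (t * d i) < 1" for i
    using mult_left_le[OF d_bounds(2)[of i] t_bounds(1)] t_bounds(2) by linarith
  have factor: "1 / sqrt (1 - 2 * (t * d i)) \<le> exp (t / (1 - 2 * t) * d i)" for i
    using t_bounds d_bounds by (intro inverse_sqrt_le_exp)
  have "norm (transpose (C ** Q) *v y) = norm (transpose C *v y)" for y
    using norm_orthonormal_columns[of "transpose Q"] Q_orthogonal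
    by (simp add: matrix_transpose_mul orthogonal_matrix_def flip: matrix_vector_mul_assoc)
  then have "(\<integral>\<^sup>+\<omega>. ennreal (exp (\<theta> * (norm (transpose C *v X \<omega>))\<^sup>2)) \<partial>M)
      = ennreal (\<Prod>i\<in>UNIV. 1 / sqrt (1 - 2 * (t * d i)))"
    using nn_integral_exp_norm_square[OF gram_CQ \<theta>_bounds(1)] product_less by (simp add: t_def)
  also have "\<dots> \<le> ennreal (\<Prod>i\<in>UNIV. exp (t / (1 - 2 * t) * d i))"
    using factor product_less by (intro ennreal_leI prod_mono) (auto simp: less_imp_le)
  also have "(\<Prod>i\<in>UNIV. exp (t / (1 - 2 * t) * d i)) = exp (t / (1 - 2 * t) * trace (transpose C ** C))"
    by (simp add: gram_C trace_spectral_matrix[OF Q_orthonormal] sum_distrib_left exp_sum)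
  finally show ?thesis by (simp add: t_def)
qed

end

section \<open>The null space of a Gaussian matrix\<close>

lemma min_at_0_of_derivative_sign:
  fixes f h :: "real \<Rightarrow> real"
  assumes deriv: "\<And>t. (f has_real_derivative t * h t) (at t)" and h_nonneg: "\<And>t. 0 \<le> h t"
  shows "f 0 \<le> f t"
proof (cases "0 \<le> t")
  case True
  then show ?thesis
    by (rule DERIV_nonneg_imp_nondecreasing) (use deriv h_nonneg in \<open>blast intro: mult_nonneg_nonneg\<close>)
next
  case False
  then have "t \<le> 0" by simp
  then show ?thesis
    by (rule DERIV_nonpos_imp_nonincreasing) (use deriv h_nonneg in \<open>blast intro: mult_nonpos_nonneg\<close>)
qed

lemma ln_one_plus_four_square_ge:
  fixes t :: real
  shows "ln 5 + 8/5 * t - t\<^sup>2 / 2 \<le> ln (1 + 4 * (1 + t)\<^sup>2)"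
proof -
  define f where "f t = ln (1 + 4 * (1 + t)\<^sup>2) + t\<^sup>2 / 2 - 8/5 * t" for t :: real
  define h where "h t = (4 * (1 + t)\<^sup>2 - 32/5 * (1 + t) + 13/5) / (1 + 4 * (1 + t)\<^sup>2)" for t :: real
  have argument_pos: "0 < 1 + 4 * (1 + t)\<^sup>2" for t :: real by (simp add: add_pos_nonneg)
  have "(f has_real_derivative t * h t) (at t)" for t
  proof -
    have "(f has_real_derivative (8 * (1 + t)) / (1 + 4 * (1 + t)\<^sup>2) + t - 8/5) (at t)"
      unfolding f_def using argument_pos[of t] by (auto intro!: derivative_eq_intros simp: field_simps)
    also have "(8 * (1 + t)) / (1 + 4 * (1 + t)\<^sup>2) + t - 8/5 = t * h t"
      unfolding h_def using argument_pos[of t] by (simp add: field_simps power2_eq_square)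
    finally show ?thesis .
  qed
  moreover have "0 \<le> h t" for t
  proof -
    have "4 * (1 + t)\<^sup>2 - 32/5 * (1 + t) + 13/5 = (2 * (1 + t) - 8/5)\<^sup>2 + 1/25"
      by (simp add: power2_eq_square field_simps)
    then show ?thesis using argument_pos[of t] by (simp add: h_def)
  qed
  ultimately have "f 0 \<le> f t" by (rule min_at_0_of_derivative_sign)
  then show ?thesis by (simp add: f_def)
qed

lemma ln_5_ge: "8/5 \<le> ln (5::real)"
proof -
  have "exp (8/5::real) ^ 5 = exp 1 ^ 8" by (simp flip: exp_of_nat_mult)
  also have "\<dots> \<le> (272/100) ^ 8" using e_less_272 by (intro power_mono) auto
  also have "\<dots> \<le> (5::real) ^ 5" by (simp add: power_divide)
  finally have "exp (8/5::real) \<le> 5" by (rule power_le_imp_le_base[where n = 4, simplified]) simp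
  then show ?thesis by (subst ln_ge_iff) simp_all
qed

lemma ln_16_div_ge:
  fixes \<delta> :: real
  assumes "0 < \<delta>" "\<delta> < 1"
  shows "2 \<le> ln (16 / \<delta>)"
proof -
  have "exp (2::real) = (exp 1)\<^sup>2" by (simp flip: exp_of_nat_mult)
  also have "\<dots> \<le> 4\<^sup>2" using e_less_272 by (intro power_mono) auto
  also have "\<dots> \<le> 16 / \<delta>" using assms by (simp add: field_simps)
  finally show ?thesis using assms by (simp add: ln_ge_iff)
qed

lemma (in prob_space) prob_less_ge_of_nn_integral_le:
  assumes [measurable]: "f \<in> borel_measurable M" and integral_le: "(\<integral>\<^sup>+\<omega>. f \<omega> \<partial>M) \<le> ennreal K"
    and K_\<delta>_pos: "0 < K" "0 < \<delta>"
  shows "1 - \<delta> \<le> prob {\<omega> \<in> space M. f \<omega> < ennreal (K / \<delta>)}"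
proof -
  have "f \<omega> < ennreal (K / \<delta>) \<longleftrightarrow> \<not> 1 \<le> ennreal (\<delta> / K) * f \<omega>" for \<omega>
    using K_\<delta>_pos
    by (cases "f \<omega>")
       (simp_all add: ennreal_mult_top ennreal_less_iff not_le field_simps
          flip: ennreal_mult' ennreal_1)
  then have good: "{\<omega> \<in> space M. f \<omega> < ennreal (K / \<delta>)}
      = space M - {\<omega> \<in> space M. 1 \<le> ennreal (\<delta> / K) * f \<omega>}"
    by auto
  have "emeasure M {\<omega> \<in> space M. 1 \<le> ennreal (\<delta> / K) * f \<omega>}
      \<le> ennreal (\<delta> / K) * (\<integral>\<^sup>+\<omega>. f \<omega> * indicator (space M) \<omega> \<partial>M)"
    by (rule nn_integral_Markov_inequality) measurable
  also have "(\<integral>\<^sup>+\<omega>. f \<omega> * indicator (space M) \<omega> \<partial>M) = (\<integral>\<^sup>+\<omega>. f \<omega> \<partial>M)"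
    by (simp cong: nn_integral_cong_simp)
  also have "ennreal (\<delta> / K) * \<dots> \<le> ennreal (\<delta> / K) * ennreal K"
    using integral_le by (rule mult_left_mono) simp
  also have "\<dots> = ennreal \<delta>" using K_\<delta>_pos by (simp flip: ennreal_mult')
  finally have "prob {\<omega> \<in> space M. 1 \<le> ennreal (\<delta> / K) * f \<omega>} \<le> \<delta>"
    using K_\<delta>_pos by (simp add: emeasure_eq_measure)
  then show ?thesis unfolding good by (subst prob_compl) auto
qed

locale gaussian_matrix = prob_space +
  fixes Om :: "'a \<Rightarrow> real^'s^'d"
  assumes normal_entries: "\<And>i j. distributed M lborel (\<lambda>\<omega>. Om \<omega> $ i $ j) (\<lambda>x. ennreal (std_normal_density x))"
    and indep_entries: "indep_vars (\<lambda>_. borel) (\<lambda>(i, j) \<omega>. Om \<omega> $ i $ j) UNIV"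
begin

abbreviation col :: "'s \<Rightarrow> 'a \<Rightarrow> real^'d" where "col j \<omega> \<equiv> column j (Om \<omega>)"

sublocale column: gaussian_vector M "col j" 1 for j
proof
  show "distributed M lborel (\<lambda>\<omega>. col j \<omega> $ i) (normal_density 0 1)" for i
    using normal_entries by (simp add: column_def)
  have "indep_vars (\<lambda>i. PiM {(i, j)} (\<lambda>_. borel))
      (\<lambda>i \<omega>. restrict (\<lambda>p. (\<lambda>(i, j) \<omega>. Om \<omega> $ i $ j) p \<omega>) {(i, j)}) UNIV"
    by (rule indep_vars_restrict[OF indep_entries]) (auto simp: disjoint_family_on_def)
  then have "indep_vars (\<lambda>_. borel)
      (\<lambda>i \<omega>. (\<lambda>g. g (i, j)) (restrict (\<lambda>p. (\<lambda>(i, j) \<omega>. Om \<omega> $ i $ j) p \<omega>) {(i, j)})) UNIV"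
    by (rule indep_vars_compose2) (rule measurable_component_singleton, simp)
  then show "indep_vars (\<lambda>_. borel) (\<lambda>i \<omega>. col j \<omega> $ i) UNIV" by (simp add: column_def)
qed simp

lemma indep_columns: "indep_vars (\<lambda>_. borel) col UNIV"
proof -
  define K :: "'s \<Rightarrow> ('d \<times> 's) set" where "K j = UNIV \<times> {j}" for j
  let ?entries = "\<lambda>j \<omega>. restrict (\<lambda>p. (\<lambda>(i, j) \<omega>. Om \<omega> $ i $ j) p \<omega>) (K j)"
  have "indep_vars (\<lambda>j. PiM (K j) (\<lambda>_. borel)) ?entries UNIV"
    by (rule indep_vars_restrict[OF indep_entries]) (auto simp: disjoint_family_on_def K_def)
  then have "indep_vars (\<lambda>_. borel) (\<lambda>j \<omega>. (\<lambda>g. \<chi> i. g (i, j)) (?entries j \<omega>)) UNIV"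
  proof (rule indep_vars_compose2)
    show "(\<lambda>g. \<chi> i. g (i, j)) \<in> Pi\<^sub>M (K j) (\<lambda>_. borel) \<rightarrow>\<^sub>M (borel :: (real^'d) measure)" for j
      by (rule borel_measurable_vecI) (simp, rule measurable_component_singleton, simp add: K_def)
  qed
  moreover have "(\<chi> i. ?entries j \<omega> (i, j)) = col j \<omega>" for j \<omega>
    by (simp add: K_def column_def)
  ultimately show ?thesis by simp
qed

lemma nn_integral_prod_columns:
  assumes [measurable]: "f \<in> borel_measurable borel"
  shows "(\<integral>\<^sup>+\<omega>. (\<Prod>j\<in>UNIV. f (col j \<omega>)) \<partial>M) = (\<Prod>j\<in>UNIV. \<integral>\<^sup>+\<omega>. f (col j \<omega>) \<partial>M)"
  by (rule indep_vars_nn_integral) (auto intro!: indep_vars_compose2[OF indep_columns])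

text \<open>A random function of mean one (lemma nn_integral_tilt) that is large at every unit vector
  orthogonal to all columns. Its average over a Gaussian prior still has mean one, and still is large if
  some image of the prior's index space is such a vector, because the prior can be recentred there.\<close>

definition tilt :: "real^'d \<Rightarrow> 'a \<Rightarrow> real" where
  "tilt y \<omega> = sqrt (1 + 4 * (norm y)\<^sup>2) ^ CARD('s) * exp (- 2 * (\<Sum>j\<in>UNIV. (y \<bullet> col j \<omega>)\<^sup>2))"

definition mixture :: "real \<Rightarrow> real^'m^'d \<Rightarrow> 'a \<Rightarrow> ennreal" where
  "mixture \<sigma> C \<omega> = (\<integral>\<^sup>+x. ennreal (tilt (C *v x) \<omega>) \<partial>gauss \<sigma>)"

lemma nn_integral_tilt: "(\<integral>\<^sup>+\<omega>. ennreal (tilt y \<omega>) \<partial>M) = 1"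
proof -
  define D where "D = sqrt (1 + 4 * (norm y)\<^sup>2)"
  have D_pos: "0 < D" by (simp add: D_def add_pos_nonneg)
  have "2 * (- 2) * (1 * norm y)\<^sup>2 < 1" by (rule le_less_trans[of _ 0]) simp_all
  then have single: "(\<integral>\<^sup>+\<omega>. ennreal (exp (- 2 * (y \<bullet> col j \<omega>)\<^sup>2)) \<partial>M) = ennreal (1 / D)" for j
    by (subst column.nn_integral_exp_inner_square) (simp_all add: D_def)
  have "(\<integral>\<^sup>+\<omega>. ennreal (tilt y \<omega>) \<partial>M)
      = (\<integral>\<^sup>+\<omega>. ennreal (D ^ CARD('s)) * (\<Prod>j\<in>UNIV. ennreal (exp (- 2 * (y \<bullet> col j \<omega>)\<^sup>2))) \<partial>M)"
    using D_pos by (simp add: tilt_def ennreal_mult' sum_distrib_left exp_sum prod_ennreal flip: D_def)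
  also have "\<dots> = ennreal (D ^ CARD('s)) * (\<integral>\<^sup>+\<omega>. (\<Prod>j\<in>UNIV. ennreal (exp (- 2 * (y \<bullet> col j \<omega>)\<^sup>2))) \<partial>M)"
    by (rule nn_integral_cmult) measurable
  also have "(\<integral>\<^sup>+\<omega>. (\<Prod>j\<in>UNIV. ennreal (exp (- 2 * (y \<bullet> col j \<omega>)\<^sup>2))) \<partial>M)
      = (\<Prod>j\<in>(UNIV::'s set). \<integral>\<^sup>+\<omega>. ennreal (exp (- 2 * (y \<bullet> col j \<omega>)\<^sup>2)) \<partial>M)"
    by (rule nn_integral_prod_columns) measurable
  also have "\<dots> = (\<Prod>j\<in>(UNIV::'s set). ennreal (1 / D))"
    by (simp only: single)
  also have "ennreal (D ^ CARD('s)) * \<dots> = 1"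
    using D_pos by (simp add: ennreal_power power_one_over flip: ennreal_mult')
  finally show ?thesis .
qed

lemma tilt_add_null_vector_ge:
  assumes orth: "\<And>j. col j \<omega> \<bullet> y = 0" and unit: "norm y = 1"
  shows "exp (real CARD('s) / 2 * (ln 5 + 8/5 * (y \<bullet> u) - (y \<bullet> u)\<^sup>2 / 2)
      - 2 * (\<Sum>j\<in>UNIV. (col j \<omega> \<bullet> u)\<^sup>2))
    \<le> tilt (y + u) \<omega>"
proof -
  define N where "N = 1 + 4 * (norm (y + u))\<^sup>2"
  have N_pos: "0 < N" by (simp add: N_def add_pos_nonneg)
  have "\<bar>1 + y \<bullet> u\<bar> \<le> norm (y + u)"
    using Cauchy_Schwarz_ineq2[of y "y + u"] unit by (simp add: inner_add_right dot_square_norm)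
  then have "(1 + y \<bullet> u)\<^sup>2 \<le> (norm (y + u))\<^sup>2" by (simp flip: abs_le_square_iff)
  then have "ln (1 + 4 * (1 + y \<bullet> u)\<^sup>2) \<le> ln N"
    unfolding N_def by (subst ln_le_cancel_iff) (auto simp: add_pos_nonneg)
  then have "ln 5 + 8/5 * (y \<bullet> u) - (y \<bullet> u)\<^sup>2 / 2 \<le> ln N"
    using ln_one_plus_four_square_ge[of "y \<bullet> u"] by linarith
  then have "exp (real CARD('s) / 2 * (ln 5 + 8/5 * (y \<bullet> u) - (y \<bullet> u)\<^sup>2 / 2))
      \<le> exp (real CARD('s) / 2 * ln N)"
    by (simp add: mult_left_mono)
  also have "\<dots> = sqrt N ^ CARD('s)"
  proof -
    have "sqrt N = exp (ln N / 2)" using N_pos by (simp flip: ln_sqrt)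
    then show ?thesis by (simp flip: exp_of_nat_mult)
  qed
  finally have "exp (real CARD('s) / 2 * (ln 5 + 8/5 * (y \<bullet> u) - (y \<bullet> u)\<^sup>2 / 2))
        * exp (- 2 * (\<Sum>j\<in>UNIV. (col j \<omega> \<bullet> u)\<^sup>2))
      \<le> sqrt N ^ CARD('s) * exp (- 2 * (\<Sum>j\<in>UNIV. (col j \<omega> \<bullet> u)\<^sup>2))"
    by (rule mult_right_mono) simp
  moreover have "(y + u) \<bullet> col j \<omega> = col j \<omega> \<bullet> u" for j
    using orth[of j] by (simp add: inner_add_left inner_commute)
  ultimately show ?thesis by (simp add: tilt_def N_def mult_exp_exp)
qed

context
  fixes \<sigma> :: real
  assumes \<sigma>_pos: "0 < \<sigma>"
begin

lemma mixture_measurable [measurable]: "mixture \<sigma> (C :: real^'m^'d) \<in> borel_measurable M"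
proof -
  interpret prior: prob_space "gauss \<sigma> :: (real^'m) measure" using \<sigma>_pos by (rule prob_space_gauss)
  show ?thesis unfolding mixture_def tilt_def by (rule prior.borel_measurable_nn_integral) measurable
qed

lemma nn_integral_mixture: "(\<integral>\<^sup>+\<omega>. mixture \<sigma> (C :: real^'m^'d) \<omega> \<partial>M) = 1"
proof -
  let ?N = "gauss \<sigma> :: (real^'m) measure"
  interpret prior: prob_space ?N using \<sigma>_pos by (rule prob_space_gauss)
  interpret pair_sigma_finite ?N M ..
  have "(\<integral>\<^sup>+\<omega>. mixture \<sigma> C \<omega> \<partial>M) = (\<integral>\<^sup>+x. (\<integral>\<^sup>+\<omega>. ennreal (tilt (C *v x) \<omega>) \<partial>M) \<partial>?N)"
    unfolding mixture_def tilt_def by (rule Fubini') measurable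
  also have "\<dots> = 1" using prior.emeasure_space_1 by (simp add: nn_integral_tilt)
  finally show ?thesis .
qed

lemma mixture_ge_of_null_vector:
  fixes C :: "real^'m^'d"
  assumes orth: "\<And>j. col j \<omega> \<bullet> (C *v v) = 0" and unit: "norm (C *v v) = 1"
    and contraction: "\<And>x. norm (C *v x) \<le> norm x"
  shows "ennreal (exp (real CARD('s) / 2 * (ln 5 - \<sigma>\<^sup>2 / 2)
      - 2 * \<sigma>\<^sup>2 * (\<Sum>j\<in>UNIV. (norm (transpose C *v col j \<omega>))\<^sup>2) - (norm v)\<^sup>2 / (2 * \<sigma>\<^sup>2)))
    \<le> mixture \<sigma> C \<omega>"
proof -
  interpret prior: gaussian_vector "gauss \<sigma> :: (real^'m) measure" "\<lambda>x. x" \<sigma>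
    using \<sigma>_pos by (rule gaussian_vector_gauss)
  define s where "s = real CARD('s)"
  define w where "w = transpose C *v (C *v v)"
  define t where "t j = transpose C *v col j \<omega>" for j
  define G where "G x = s / 2 * (ln 5 + 8/5 * (w \<bullet> x) - (w \<bullet> x)\<^sup>2 / 2)
      - 2 * (\<Sum>j\<in>UNIV. (t j \<bullet> x)\<^sup>2)" for x
  note integrable = prior.integrable_inner prior.integrable_inner_square
  have "integrable (gauss \<sigma>) G" unfolding G_def
    by (intro Bochner_Integration.integrable_add Bochner_Integration.integrable_diff
        integrable_mult_right Bochner_Integration.integrable_sum integrable_divide
        prior.integrable_const integrable)
  moreover have "ennreal (exp (G x)) \<le> ennreal (tilt (C *v (v + x)) \<omega>)" for x
    using tilt_add_null_vector_ge[OF orth unit, of "C *v x"]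
    by (simp add: G_def w_def t_def s_def matrix_vector_right_distrib inner_matrix_transpose
        ennreal_leI)
  ultimately have "ennreal (exp (prior.expectation G - (norm v)\<^sup>2 / (2 * \<sigma>\<^sup>2))) \<le> mixture \<sigma> C \<omega>"
    unfolding mixture_def
    by (intro exp_expectation_le_nn_integral_gauss_shift \<sigma>_pos) (simp_all add: tilt_def)
  moreover have "prior.expectation G
      = s / 2 * (ln 5 - (\<sigma> * norm w)\<^sup>2 / 2) - 2 * (\<Sum>j\<in>UNIV. (\<sigma> * norm (t j))\<^sup>2)"
    unfolding G_def using prior.prob_space
    by (simp add: integrable prior.expectation_inner prior.expectation_inner_square)
  moreover have "s / 2 * (ln 5 - \<sigma>\<^sup>2 / 2) \<le> s / 2 * (ln 5 - (\<sigma> * norm w)\<^sup>2 / 2)"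
  proof -
    have "norm w \<le> 1" using contraction_transpose[OF contraction, of "C *v v"] unit by (simp add: w_def)
    then have "\<sigma> * norm w \<le> \<sigma>" using \<sigma>_pos by (simp add: mult_left_le)
    then have "(\<sigma> * norm w)\<^sup>2 \<le> \<sigma>\<^sup>2" using \<sigma>_pos by (intro power_mono) auto
    then show ?thesis by (intro mult_left_mono) (auto simp: s_def)
  qed
  ultimately show ?thesis
    by (elim order_trans[rotated])
      (auto intro!: ennreal_leI simp: s_def t_def power_mult_distrib sum_distrib_left mult.assoc)
qed

end

lemma nn_integral_exp_sum_norm_square_le:
  fixes C :: "real^'m^'d"
  assumes contraction: "\<And>x. norm (C *v x) \<le> norm x" and \<theta>_bounds: "0 \<le> \<theta>" "2 * \<theta> < 1"
  shows "(\<integral>\<^sup>+\<omega>. ennreal (exp (\<theta> * (\<Sum>j\<in>UNIV. (norm (transpose C *v col j \<omega>))\<^sup>2))) \<partial>M)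
    \<le> ennreal (exp (real CARD('s) * (\<theta> / (1 - 2 * \<theta>) * trace (transpose C ** C))))"
proof -
  have "(\<integral>\<^sup>+\<omega>. ennreal (exp (\<theta> * (\<Sum>j\<in>UNIV. (norm (transpose C *v col j \<omega>))\<^sup>2))) \<partial>M)
      = (\<integral>\<^sup>+\<omega>. (\<Prod>j\<in>UNIV. ennreal (exp (\<theta> * (norm (transpose C *v col j \<omega>))\<^sup>2))) \<partial>M)"
    by (simp add: sum_distrib_left exp_sum prod_ennreal)
  also have "\<dots> = (\<Prod>j\<in>(UNIV::'s set). \<integral>\<^sup>+\<omega>. ennreal (exp (\<theta> * (norm (transpose C *v col j \<omega>))\<^sup>2)) \<partial>M)"
    by (rule nn_integral_prod_columns) measurable
  also have "\<dots> \<le> (\<Prod>j\<in>(UNIV::'s set). ennreal (exp (\<theta> / (1 - 2 * \<theta>) * trace (transpose C ** C))))"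
    using column.nn_integral_exp_norm_square_le[OF contraction \<theta>_bounds(1)] \<theta>_bounds(2)
    by (intro prod_mono_ennreal) simp
  also have "\<dots> = ennreal (exp (real CARD('s) * (\<theta> / (1 - 2 * \<theta>) * trace (transpose C ** C))))"
    by (simp add: ennreal_power flip: exp_of_nat_mult)
  finally show ?thesis .
qed

lemma mixture_and_sum_norm_square_bounded:
  fixes C :: "real^'m^'d"
  assumes contraction: "\<And>x. norm (C *v x) \<le> norm x" and \<sigma>_pos: "0 < \<sigma>"
    and \<theta>_bounds: "0 < \<theta>" "2 * \<theta> < 1" and \<delta>_pos: "0 < \<delta>"
  shows "\<exists>E\<in>events. 1 - \<delta> \<le> prob E \<and> (\<forall>\<omega>\<in>E. mixture \<sigma> C \<omega> < ennreal (2 / \<delta>) \<and>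
    \<theta> * (\<Sum>j\<in>UNIV. (norm (transpose C *v col j \<omega>))\<^sup>2)
      < real CARD('s) * (\<theta> / (1 - 2 * \<theta>) * trace (transpose C ** C)) + ln (2 / \<delta>))"
proof -
  let ?T = "\<lambda>\<omega>. \<theta> * (\<Sum>j\<in>UNIV. (norm (transpose C *v col j \<omega>))\<^sup>2)"
  let ?b = "real CARD('s) * (\<theta> / (1 - 2 * \<theta>) * trace (transpose C ** C))"
  define E1 where "E1 = {\<omega> \<in> space M. mixture \<sigma> C \<omega> < ennreal (1 / (\<delta> / 2))}"
  define E2 where "E2 = {\<omega> \<in> space M. ennreal (exp (?T \<omega>)) < ennreal (exp ?b / (\<delta> / 2))}"
  note mixture_measurable[OF \<sigma>_pos, measurable]
  have [measurable]: "E1 \<in> events" "E2 \<in> events" unfolding E1_def E2_def by measurable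
  have "1 - \<delta> / 2 \<le> prob E1"
    unfolding E1_def using \<delta>_pos nn_integral_mixture[OF \<sigma>_pos, of C]
    by (intro prob_less_ge_of_nn_integral_le) simp_all
  moreover have "1 - \<delta> / 2 \<le> prob E2"
    unfolding E2_def using \<delta>_pos \<theta>_bounds nn_integral_exp_sum_norm_square_le[OF contraction, of \<theta>]
    by (intro prob_less_ge_of_nn_integral_le) simp_all
  moreover have "prob E1 + prob E2 \<le> prob (E1 \<inter> E2) + 1"
    using measure_Un3[of E1 M E2] prob_le_1[of "E1 \<union> E2"] by (simp add: fmeasurable_eq_sets)
  ultimately have "1 - \<delta> \<le> prob (E1 \<inter> E2)" by linarith
  moreover have "?T \<omega> < ?b + ln (2 / \<delta>)" if "\<omega> \<in> E2" for \<omega>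
  proof -
    have "exp (?T \<omega>) < exp ?b * (2 / \<delta>)" using that by (simp add: E2_def ennreal_less_iff)
    then have "ln (exp (?T \<omega>)) < ln (exp ?b * (2 / \<delta>))" using \<delta>_pos by (subst ln_less_cancel_iff) auto
    also have "\<dots> = ?b + ln (2 / \<delta>)" using \<delta>_pos by (subst ln_mult) auto
    finally show ?thesis by simp
  qed
  ultimately show ?thesis by (intro bexI[of _ "E1 \<inter> E2"]) (auto simp: E1_def)
qed

lemma null_vector_norm_ge:
  fixes C :: "real^'m^'d"
  defines "s \<equiv> real CARD('s)"
  assumes contraction: "\<And>x. norm (C *v x) \<le> norm x"
    and orth: "\<And>j. col j \<omega> \<bullet> (C *v v) = 0" and unit: "norm (C *v v) = 1"
    and s_ge: "128 \<le> s" and K_bounds: "0 < K" "ln K \<le> s / 64"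
    and mixture_less: "mixture (sqrt (7 / (5 * s))) C \<omega> < ennreal K"
    and sum_columns_le: "(\<Sum>j\<in>UNIV. (norm (transpose C *v col j \<omega>))\<^sup>2) \<le> 9/64 * s\<^sup>2"
  shows "15/14 \<le> (norm v)\<^sup>2"
proof -
  \<comment> \<open>The prior variance 7/(5s) nearly balances the two costs of recentring: the sum over
    the columns, of order variance times s squared, and the Cameron--Martin term, of order
    1/variance.\<close>
  define \<sigma> where "\<sigma> = sqrt (7 / (5 * s))"
  define T where "T = (\<Sum>j\<in>UNIV. (norm (transpose C *v col j \<omega>))\<^sup>2)"
  have \<sigma>_eq: "0 < \<sigma>" "\<sigma>\<^sup>2 = 7 / (5 * s)" using s_ge by (simp_all add: \<sigma>_def)
  have "ennreal (exp (s / 2 * (ln 5 - \<sigma>\<^sup>2 / 2) - 2 * \<sigma>\<^sup>2 * T - (norm v)\<^sup>2 / (2 * \<sigma>\<^sup>2))) \<le> mixture \<sigma> C \<omega>"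
    unfolding s_def T_def by (rule mixture_ge_of_null_vector[OF \<sigma>_eq(1) orth unit contraction])
  also have "\<dots> < ennreal K" using mixture_less by (simp add: \<sigma>_def)
  finally have "exp (s / 2 * (ln 5 - \<sigma>\<^sup>2 / 2) - 2 * \<sigma>\<^sup>2 * T - (norm v)\<^sup>2 / (2 * \<sigma>\<^sup>2)) < K"
    by (simp add: ennreal_less_iff)
  then have "s / 2 * (ln 5 - \<sigma>\<^sup>2 / 2) - 2 * \<sigma>\<^sup>2 * T - (norm v)\<^sup>2 / (2 * \<sigma>\<^sup>2) < ln K"
    using K_bounds(1) ln_less_cancel_iff[of "exp _" K] by simp
  moreover have "4/5 * s - 7/20 \<le> s / 2 * (ln 5 - \<sigma>\<^sup>2 / 2)"
  proof -
    have "s / 2 * (8/5) \<le> s / 2 * ln 5" using ln_5_ge s_ge by (intro mult_left_mono) auto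
    moreover have "s / 2 * (\<sigma>\<^sup>2 / 2) = 7/20" using s_ge by (simp add: \<sigma>_eq)
    ultimately show ?thesis by (simp add: right_diff_distrib)
  qed
  moreover have "2 * \<sigma>\<^sup>2 * T \<le> 63/160 * s"
  proof -
    have "2 * \<sigma>\<^sup>2 * T \<le> 2 * \<sigma>\<^sup>2 * (9/64 * s\<^sup>2)"
      using sum_columns_le by (intro mult_left_mono) (auto simp: T_def)
    also have "\<dots> = 63/160 * s" unfolding \<sigma>_eq(2) using s_ge by (simp add: power2_eq_square)
    finally show ?thesis .
  qed
  moreover have "(norm v)\<^sup>2 / (2 * \<sigma>\<^sup>2) = 5/14 * (norm v)\<^sup>2 * s" using s_ge by (simp add: \<sigma>_eq)
  ultimately have "15/14 * s \<le> (norm v)\<^sup>2 * s" using K_bounds(2) s_ge by linarith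
  then show ?thesis using s_ge by simp
qed

theorem null_space_bound:
  fixes C :: "real^'m^'d"
  assumes contraction: "\<And>x. norm (C *v x) \<le> norm x"
    and trace_le: "trace (transpose C ** C) \<le> real CARD('s) / 8" and \<delta>_bounds: "0 < \<delta>" "\<delta> < 1"
    and card: "64 * ln (16 / \<delta>) \<le> real CARD('s)"
  shows "\<exists>E\<in>events. 1 - \<delta> \<le> prob E \<and>
    (\<forall>\<omega>\<in>E. \<forall>v. transpose (Om \<omega>) *v (C *v v) = 0 \<longrightarrow> 15/14 * (norm (C *v v))\<^sup>2 \<le> (norm v)\<^sup>2)"
proof -
  define s where "s = real CARD('s)"
  have "2 \<le> ln (16 / \<delta>)" using \<delta>_bounds by (rule ln_16_div_ge)
  then have s_ge: "128 \<le> s" using card by (simp add: s_def)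
  have "ln (2 / \<delta>) \<le> ln (16 / \<delta>)" using \<delta>_bounds by (subst ln_le_cancel_iff) (auto simp: divide_simps)
  then have ln_le: "ln (2 / \<delta>) \<le> s / 64" using card by (simp add: s_def)
  have "0 < sqrt (7 / (5 * s))" "0 < (1/32 :: real)" "2 * (1/32) < (1 :: real)" using s_ge by simp_all
  from mixture_and_sum_norm_square_bounded[OF contraction this \<delta>_bounds(1)]
  obtain E where E_prob: "E \<in> events" "1 - \<delta> \<le> prob E"
    and mixture_less: "\<And>\<omega>. \<omega> \<in> E \<Longrightarrow> mixture (sqrt (7 / (5 * s))) C \<omega> < ennreal (2 / \<delta>)"
    and sum_columns_less: "\<And>\<omega>. \<omega> \<in> E \<Longrightarrow> 1/32 * (\<Sum>j\<in>UNIV. (norm (transpose C *v col j \<omega>))\<^sup>2)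
      < s * ((1/32) / (1 - 2 * (1/32)) * trace (transpose C ** C)) + ln (2 / \<delta>)"
    unfolding s_def by blast
  have sum_columns_le: "(\<Sum>j\<in>UNIV. (norm (transpose C *v col j \<omega>))\<^sup>2) \<le> 9/64 * s\<^sup>2" if "\<omega> \<in> E" for \<omega>
  proof -
    have "s * trace (transpose C ** C) \<le> s * (s / 8)"
      using trace_le s_ge by (intro mult_left_mono) (auto simp: s_def)
    then have "s * trace (transpose C ** C) \<le> s\<^sup>2 / 8" by (simp add: power2_eq_square)
    moreover have "128 * s \<le> s\<^sup>2" using s_ge by (simp add: power2_eq_square)
    ultimately show ?thesis using sum_columns_less[OF that] ln_le s_ge by simp
  qed
  have "15/14 * (norm (C *v v))\<^sup>2 \<le> (norm v)\<^sup>2" if \<omega>_in_E: "\<omega> \<in> E"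
    and null: "transpose (Om \<omega>) *v (C *v v) = 0" for \<omega> v
  proof (cases "C *v v = 0")
    case False
    define v' where "v' = v /\<^sub>R norm (C *v v)"
    have "col j \<omega> \<bullet> (C *v v) = 0" for j
      using arg_cong[OF null, of "\<lambda>x. x $ j"]
      by (simp add: matrix_vector_mult_def transpose_def column_def inner_vec_def)
    then have "15/14 \<le> (norm v')\<^sup>2"
      using False mixture_less[OF \<omega>_in_E] sum_columns_le[OF \<omega>_in_E] s_ge ln_le \<delta>_bounds
      by (intro null_vector_norm_ge[OF contraction, of _ _ "2 / \<delta>"])
         (auto simp: v'_def matrix_vector_mult_scaleR s_def)
    then show ?thesis using False by (simp add: v'_def field_simps power_mult_distrib)
  qed simp
  then show ?thesis using E_prob by blast
qed

end

section \<open>The Nystrom preconditioner\<close>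

definition is_pseudoinverse :: "real^'s^'s \<Rightarrow> real^'s^'s \<Rightarrow> bool" where
  "is_pseudoinverse S X \<longleftrightarrow> S ** X ** S = S \<and> X ** S ** X = X \<and>
     transpose (S ** X) = S ** X \<and> transpose (X ** S) = X ** S"

lemma is_pseudoinverse_unique:
  assumes "is_pseudoinverse S X" "is_pseudoinverse S Y"
  shows "X = Y"
proof -
  have X_eqs: "S ** X ** S = S" "X ** S ** X = X"
      "transpose (S ** X) = S ** X" "transpose (X ** S) = X ** S"
    and Y_eqs: "S ** Y ** S = S" "Y ** S ** Y = Y"
      "transpose (S ** Y) = S ** Y" "transpose (Y ** S) = Y ** S"
    using assms by (auto simp: is_pseudoinverse_def)
  have "S ** X = transpose ((S ** Y ** S) ** X)" by (simp only: X_eqs Y_eqs)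
  also have "\<dots> = transpose ((S ** Y) ** (S ** X))" by (simp only: matrix_mul_assoc)
  also have "\<dots> = (S ** X) ** (S ** Y)" by (subst matrix_transpose_mul) (simp only: X_eqs Y_eqs)
  also have "\<dots> = (S ** X ** S) ** Y" by (simp only: matrix_mul_assoc)
  finally have left: "S ** X = S ** Y" by (simp only: X_eqs)
  have "X ** S = transpose (X ** (S ** Y ** S))" by (simp only: X_eqs Y_eqs)
  also have "\<dots> = transpose ((X ** S) ** (Y ** S))" by (simp only: matrix_mul_assoc)
  also have "\<dots> = (Y ** S) ** (X ** S)" by (subst matrix_transpose_mul) (simp only: X_eqs Y_eqs)
  also have "\<dots> = Y ** (S ** X ** S)" by (simp only: matrix_mul_assoc)
  finally have right: "X ** S = Y ** S" by (simp only: X_eqs)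
  have "X = X ** (S ** X)" using X_eqs(2) by (simp only: matrix_mul_assoc)
  also have "\<dots> = (X ** S) ** Y" by (simp only: left matrix_mul_assoc)
  also have "\<dots> = Y" by (simp only: right Y_eqs)
  finally show ?thesis .
qed

lemma is_pseudoinverse_pinv:
  assumes "transpose S = S"
  shows "is_pseudoinverse S (pinv S)"
proof -
  obtain Q l where Q_orthogonal: "orthogonal_matrix Q" and S_eq: "S = spectral_matrix Q l"
    using symmetric_matrix_diagonalizable[OF assms] .
  have Q_orthonormal: "transpose Q ** Q = mat 1" using Q_orthogonal by (simp add: orthogonal_matrix_def)
  have "(\<lambda>i. l i * (1 / l i) * l i) = l" "(\<lambda>i. 1 / l i * l i * (1 / l i)) = (\<lambda>i. 1 / l i)" by auto
  then have existence: "is_pseudoinverse S (spectral_matrix Q (\<lambda>i. 1 / l i))"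
    unfolding is_pseudoinverse_def S_eq spectral_matrix_mult[OF Q_orthonormal] transpose_spectral_matrix
    by (simp only: simp_thms)
  have "is_pseudoinverse S (THE X. is_pseudoinverse S X)"
  proof (rule theI)
    show "Y = spectral_matrix Q (\<lambda>i. 1 / l i)" if "is_pseudoinverse S Y" for Y
      by (rule is_pseudoinverse_unique[OF that existence])
  qed (rule existence)
  then show ?thesis by (simp add: pinv_def is_pseudoinverse_def)
qed

lemma transpose_pinv:
  assumes "transpose S = S"
  shows "transpose (pinv S) = pinv S"
proof (rule is_pseudoinverse_unique)
  show "is_pseudoinverse S (transpose (pinv S))"
    using is_pseudoinverse_pinv[OF assms] assms unfolding is_pseudoinverse_def
    by (metis matrix_mul_assoc matrix_transpose_mul transpose_transpose)
qed (rule is_pseudoinverse_pinv[OF assms])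

definition range_projector :: "real^'s^'d \<Rightarrow> real^'d^'d" where
  "range_projector K = K ** pinv (transpose K ** K) ** transpose K"

context
  fixes K :: "real^'s^'d" and S X :: "real^'s^'s"
  defines "S \<equiv> transpose K ** K" and "X \<equiv> pinv S"
begin

lemma symmetric_gram: "transpose S = S"
  by (simp add: S_def matrix_transpose_mul)

lemma transpose_range_projector: "transpose (range_projector K) = range_projector K"
  by (simp add: range_projector_def matrix_transpose_mul matrix_mul_assoc transpose_pinv)

lemma range_projector_idempotent: "range_projector K ** range_projector K = range_projector K"
proof -
  have "range_projector K ** range_projector K = K ** (X ** S ** X) ** transpose K"
    by (simp only: range_projector_def S_def X_def matrix_mul_assoc)
  also have "X ** S ** X = X"
    using is_pseudoinverse_pinv[OF symmetric_gram] by (simp add: is_pseudoinverse_def X_def)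
  finally show ?thesis by (simp add: range_projector_def S_def X_def)
qed

lemma transpose_mult_range_projector: "transpose K ** range_projector K = transpose K"
proof -
  have inner_inverse: "S ** X ** S = S"
    using is_pseudoinverse_pinv[OF symmetric_gram] by (simp add: is_pseudoinverse_def X_def)
  have "(K ** X ** S) *v y = K *v y" for y
  proof -
    define d where "d = (X ** S) *v y - y"
    have "S *v d = 0"
      using inner_inverse
      by (simp add: d_def matrix_vector_mult_diff_distrib matrix_vector_mul_assoc matrix_mul_assoc)
    then have "K *v d = 0" using norm_matrix_vector_power2[of K d] by (simp add: S_def)
    then show ?thesis
      by (simp add: d_def matrix_vector_mult_diff_distrib matrix_vector_mul_assoc matrix_mul_assoc)
  qed
  then have "K ** X ** S = K" by (simp add: matrix_eq)
  then have "transpose (K ** X ** S) = transpose K" by simp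
  then show ?thesis
    by (simp add: range_projector_def matrix_transpose_mul transpose_pinv symmetric_gram
        matrix_mul_assoc X_def)
       (simp add: S_def matrix_mul_assoc)
qed

end

lemma inner_symmetric_idempotent:
  fixes P :: "real^'n^'n"
  assumes "transpose P = P" "P ** P = P"
  shows "v \<bullet> (P *v v) = (norm (P *v v))\<^sup>2"
  by (simp add: norm_matrix_vector_power2 assms)

lemma norm_complement_symmetric_idempotent:
  fixes P :: "real^'n^'n"
  assumes "transpose P = P" "P ** P = P"
  shows "(norm (v - P *v v))\<^sup>2 = v \<bullet> v - v \<bullet> (P *v v)"
  using inner_symmetric_idempotent[OF assms, of v]
  by (simp add: power2_norm_eq_inner inner_simps inner_commute)

text \<open>Writing H as B times its transpose turns the Nystrom approximation into a compression of H by the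
  orthogonal projector onto the range of the transpose of B applied to the test matrix.\<close>

context
  fixes H :: "real^'d^'d" and B :: "real^'m^'d" and Om :: "real^'s^'d"
  assumes H_eq: "H = B ** transpose B"
begin

lemma nystrom_eq_range_projector:
  "nystrom H Om = B ** range_projector (transpose B ** Om) ** transpose B"
  unfolding nystrom_def range_projector_def H_eq by (simp add: matrix_transpose_mul matrix_mul_assoc)

lemma inner_gram: "v \<bullet> (H *v v) = (transpose B *v v) \<bullet> (transpose B *v v)"
  by (simp add: H_eq inner_matrix_transpose[of v B] flip: matrix_vector_mul_assoc)

lemma inner_nystrom:
  "v \<bullet> (nystrom H Om *v v)
    = (transpose B *v v) \<bullet> (range_projector (transpose B ** Om) *v (transpose B *v v))"
  by (simp add: nystrom_eq_range_projector inner_matrix_transpose[of v B] flip: matrix_vector_mul_assoc)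

lemma inner_diff_nystrom:
  "v \<bullet> (H *v v) - v \<bullet> (nystrom H Om *v v)
    = (norm (transpose B *v v - range_projector (transpose B ** Om) *v (transpose B *v v)))\<^sup>2"
  unfolding inner_gram inner_nystrom
  by (rule norm_complement_symmetric_idempotent[symmetric])
     (rule transpose_range_projector range_projector_idempotent)+

lemma nystrom_psd: "0 \<preceq> nystrom H Om"
  unfolding loewner_le_def inner_nystrom
  by (simp add: inner_symmetric_idempotent[OF transpose_range_projector range_projector_idempotent])

lemma nystrom_loewner_le: "nystrom H Om \<preceq> H"
  unfolding loewner_le_def using inner_diff_nystrom by (smt (verit) zero_le_power2)

lemma loewner_le_nystrom_add:
  assumes c_nonneg: "0 \<le> c"
    and null_space: "\<And>w. transpose Om *v (B *v w) = 0 \<Longrightarrow> (norm (B *v w))\<^sup>2 \<le> c * (norm w)\<^sup>2"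
  shows "H \<preceq> nystrom H Om + c *\<^sub>R mat 1"
  unfolding loewner_le_def
proof
  fix v
  define K where "K = transpose B ** Om"
  define q where "q = transpose B *v v"
  define w where "w = q - range_projector K *v q"
  have "transpose K *v w = 0"
    by (simp add: w_def matrix_vector_mult_diff_distrib matrix_vector_mul_assoc
        transpose_mult_range_projector)
  then have norm_Bw_le: "(norm (B *v w))\<^sup>2 \<le> c * (norm w)\<^sup>2"
    by (intro null_space) (simp add: K_def matrix_transpose_mul matrix_vector_mul_assoc)
  have "w \<bullet> (range_projector K *v q) = 0"
    using inner_symmetric_idempotent[OF transpose_range_projector range_projector_idempotent, of q K]
    by (simp add: w_def inner_simps power2_norm_eq_inner inner_commute)
  then have "(norm w)\<^sup>2 = w \<bullet> q" by (simp add: power2_norm_eq_inner w_def inner_simps)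
  also have "\<dots> = (B *v w) \<bullet> v" by (simp add: q_def inner_matrix_transpose)
  also have "\<dots> \<le> norm (B *v w) * norm v" by (rule norm_cauchy_schwarz)
  finally have "((norm w)\<^sup>2)\<^sup>2 \<le> (norm (B *v w) * norm v)\<^sup>2" by (intro power_mono) auto
  also have "\<dots> \<le> (c * (norm w)\<^sup>2) * (norm v)\<^sup>2"
    using norm_Bw_le by (simp add: power_mult_distrib mult_right_mono)
  finally have "(norm w)\<^sup>2 * (norm w)\<^sup>2 \<le> (norm w)\<^sup>2 * (c * (norm v)\<^sup>2)"
    by (simp add: power2_eq_square mult_ac)
  then have "(norm w)\<^sup>2 \<le> c * (norm v)\<^sup>2"
  proof (cases "w = 0")
    case False
    then have "0 < (norm w)\<^sup>2" by simp
    then show ?thesis using \<open>(norm w)\<^sup>2 * (norm w)\<^sup>2 \<le> _\<close> by (simp only: mult_le_cancel_left_pos)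
  qed (use c_nonneg in simp)
  then show "v \<bullet> (H *v v) \<le> v \<bullet> ((nystrom H Om + c *\<^sub>R mat 1) *v v)"
    using inner_diff_nystrom[of v]
    by (simp add: matrix_add_scaled_id_mult_vec inner_simps power2_norm_eq_inner w_def q_def K_def)
qed

end

lemma psd_matrix_diagonalizable:
  fixes H :: "real^'n^'n"
  assumes "transpose H = H" "0 \<preceq> H"
  obtains Q l where "orthogonal_matrix Q" "H = spectral_matrix Q l" "\<And>i. 0 \<le> l i"
proof -
  obtain Q l where Q_orthogonal: "orthogonal_matrix Q" and H_eq: "H = spectral_matrix Q l"
    using symmetric_matrix_diagonalizable[OF assms(1)] .
  then have "\<forall>i. 0 \<le> l i" using assms(2) spectral_matrix_psd_iff orthogonal_matrix by blast
  then show thesis using that Q_orthogonal H_eq by blast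
qed

lemma psd_matrix_factorization:
  fixes H :: "real^'n^'n"
  assumes "transpose H = H" "0 \<preceq> H"
  obtains B :: "real^'n^'n" where "H = B ** transpose B"
proof -
  obtain Q l where Q_orthogonal: "orthogonal_matrix Q" and H_eq: "H = spectral_matrix Q l"
    and l_nonneg: "\<And>i. 0 \<le> l i"
    using psd_matrix_diagonalizable[OF assms] by blast
  have "spectral_matrix Q (\<lambda>i. sqrt (l i)) ** spectral_matrix Q (\<lambda>i. sqrt (l i)) = H"
    using Q_orthogonal l_nonneg by (simp add: H_eq spectral_matrix_mult orthogonal_matrix)
  then show thesis using that[of "spectral_matrix Q (\<lambda>i. sqrt (l i))"] by simp
qed

context
  fixes Q :: "real^'d^'d" and l :: "'d \<Rightarrow> real" and \<rho> :: real
  assumes Q_orthogonal: "orthogonal_matrix Q" and l_nonneg: "\<And>i. 0 \<le> l i" and \<rho>_pos: "0 < \<rho>"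
begin

lemma spectral_matrix_resolvent:
  "spectral_matrix Q l ** matrix_inv (spectral_matrix Q l + \<rho> *\<^sub>R mat 1)
      = spectral_matrix Q (\<lambda>i. l i / (l i + \<rho>))"
proof -
  have Q_orthonormal: "transpose Q ** Q = mat 1" using Q_orthogonal by (simp add: orthogonal_matrix_def)
  have "l i + \<rho> \<noteq> 0" for i using l_nonneg[of i] \<rho>_pos by linarith
  then have "(spectral_matrix Q l + \<rho> *\<^sub>R mat 1) ** spectral_matrix Q (\<lambda>i. 1 / (l i + \<rho>)) = mat 1"
    by (simp add: spectral_matrix_add_scaleR spectral_matrix_mult[OF Q_orthonormal]
        spectral_matrix_one[OF Q_orthogonal] flip: spectral_matrix_one[OF Q_orthogonal])
  then show ?thesis by (simp add: matrix_inv_unique spectral_matrix_mult[OF Q_orthonormal])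
qed

lemma deff_spectral_matrix: "deff (spectral_matrix Q l) \<rho> = (\<Sum>i\<in>UNIV. l i / (l i + \<rho>))"
  using Q_orthogonal
  by (simp add: deff_def spectral_matrix_resolvent trace_spectral_matrix orthogonal_matrix)

end

lemma regularized_square_root:
  fixes H :: "real^'d^'d"
  assumes H_sym_psd: "transpose H = H" "0 \<preceq> H" and \<rho>_pos: "0 < \<rho>"
  obtains B C D :: "real^'d^'d" where "H = B ** transpose B" "C ** D = B"
    "\<And>w. (norm (D *v w))\<^sup>2 = (norm (B *v w))\<^sup>2 + \<rho> * (norm w)\<^sup>2"
    "\<And>x. norm (C *v x) \<le> norm x" "trace (transpose C ** C) = deff H \<rho>"
proof -
  obtain Q l where Q_orthogonal: "orthogonal_matrix Q" and spectral: "H = spectral_matrix Q l"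
    and l_nonneg: "\<And>i. 0 \<le> l i"
    using psd_matrix_diagonalizable[OF H_sym_psd] by blast
  have Q_orthonormal: "transpose Q ** Q = mat 1" using Q_orthogonal by (simp add: orthogonal_matrix)
  have shift_pos: "0 < l i + \<rho>" for i using l_nonneg[of i] \<rho>_pos by linarith
  define B where "B = spectral_matrix Q (\<lambda>i. sqrt (l i))"
  define C where "C = spectral_matrix Q (\<lambda>i. sqrt (l i / (l i + \<rho>)))"
  define D where "D = spectral_matrix Q (\<lambda>i. sqrt (l i + \<rho>))"
  have gram_B: "B ** transpose B = H" "transpose B ** B = H"
    using l_nonneg by (simp_all add: B_def spectral spectral_matrix_mult[OF Q_orthonormal])
  have gram_C: "transpose C ** C = spectral_matrix Q (\<lambda>i. l i / (l i + \<rho>))"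
    using l_nonneg shift_pos by (simp add: C_def spectral_matrix_mult[OF Q_orthonormal] less_imp_le)
  have gram_D: "transpose D ** D = H + \<rho> *\<^sub>R mat 1"
    using shift_pos
    by (simp add: D_def spectral spectral_matrix_mult[OF Q_orthonormal] spectral_matrix_add_scaleR
        less_imp_le flip: spectral_matrix_one[OF Q_orthogonal])
  show thesis
  proof (rule that[OF gram_B(1)[symmetric]])
    have "sqrt (l i / (l i + \<rho>)) * sqrt (l i + \<rho>) = sqrt (l i)" for i
      using shift_pos[of i] by (simp add: real_sqrt_divide)
    then show "C ** D = B" by (simp add: B_def C_def D_def spectral_matrix_mult[OF Q_orthonormal])
    show "(norm (D *v w))\<^sup>2 = (norm (B *v w))\<^sup>2 + \<rho> * (norm w)\<^sup>2" for w
      unfolding norm_matrix_vector_power2[of D] norm_matrix_vector_power2[of B] gram_D gram_B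
      by (simp add: matrix_add_scaled_id_mult_vec inner_simps power2_norm_eq_inner)
    show "norm (C *v x) \<le> norm x" for x
    proof (rule power2_le_imp_le)
      have "(norm (C *v x))\<^sup>2 \<le> (\<Sum>i\<in>UNIV. 1 * ((transpose Q *v x) $ i)\<^sup>2)"
        unfolding norm_matrix_vector_power2 gram_C inner_spectral_matrix
        using l_nonneg shift_pos \<rho>_pos by (intro sum_mono mult_right_mono) auto
      also have "\<dots> = (norm x)\<^sup>2"
        by (simp only: inner_spectral_matrix[symmetric] spectral_matrix_one[OF Q_orthogonal]
            matrix_vector_mul_lid power2_norm_eq_inner)
      finally show "(norm (C *v x))\<^sup>2 \<le> (norm x)\<^sup>2" .
    qed simp
    show "trace (transpose C ** C) = deff H \<rho>"
      unfolding gram_C spectral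
      by (simp add: trace_spectral_matrix[OF Q_orthonormal]
          deff_spectral_matrix[OF Q_orthogonal l_nonneg \<rho>_pos])
  qed
qed

lemma deff_nonneg:
  assumes "transpose H = H" "0 \<preceq> H" "0 < \<rho>"
  shows "0 \<le> deff H \<rho>"
proof -
  obtain Q l where "orthogonal_matrix Q" "H = spectral_matrix Q l" "\<And>i. 0 \<le> l i"
    using psd_matrix_diagonalizable[OF assms(1,2)] by blast
  then show ?thesis using assms(3) by (simp add: deff_spectral_matrix sum_nonneg)
qed

lemma inner_resolvent_ge:
  fixes H :: "real^'d^'d"
  assumes psd: "0 \<preceq> H" and \<rho>_pos: "0 < \<rho>" and norm_u: "norm u = 1"
    and m_bounds: "0 \<le> m" "\<And>x. m * (u \<bullet> x)\<^sup>2 \<le> x \<bullet> (H *v x)"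
  shows "m / (m + \<rho>) \<le> u \<bullet> ((H ** matrix_inv (H + \<rho> *\<^sub>R mat 1)) *v u)"
proof -
  define x where "x = matrix_inv (H + \<rho> *\<^sub>R mat 1) *v u"
  define g where "g = u \<bullet> x"
  have "pos_def_matrix (H + \<rho> *\<^sub>R mat 1)" using psd \<rho>_pos by (rule pos_def_matrix_add_scaled_id)
  then have "(H + \<rho> *\<^sub>R mat 1) *v x = u"
    by (simp add: x_def matrix_vector_mul_assoc pos_def_matrix_inv_right)
  then have resolvent_eq: "H *v x + \<rho> *\<^sub>R x = u" by (simp add: matrix_add_scaled_id_mult_vec)
  have "g\<^sup>2 \<le> x \<bullet> x"
    using Cauchy_Schwarz_ineq[of u x] norm_u by (simp add: g_def dot_square_norm)
  then have "\<rho> * g\<^sup>2 \<le> \<rho> * (x \<bullet> x)" using \<rho>_pos by (intro mult_left_mono) auto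
  moreover have "g = x \<bullet> (H *v x) + \<rho> * (x \<bullet> x)"
    unfolding g_def by (subst resolvent_eq[symmetric]) (simp add: inner_simps inner_commute)
  ultimately have quadratic: "g * ((m + \<rho>) * g) \<le> g * 1"
    using m_bounds(2)[of x] by (simp add: g_def power2_eq_square algebra_simps)
  have shift_pos: "0 < m + \<rho>" using m_bounds(1) \<rho>_pos by linarith
  have "(m + \<rho>) * g \<le> 1"
  proof (cases "0 < g")
    case True
    then show ?thesis using quadratic by (simp only: mult_le_cancel_left_pos)
  next
    case False
    then have "(m + \<rho>) * g \<le> 0" using shift_pos by (simp add: mult_nonneg_nonpos)
    then show ?thesis by linarith
  qed
  then have "\<rho> * ((m + \<rho>) * g) \<le> \<rho> * 1" using \<rho>_pos by (intro mult_left_mono) auto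
  then have "m \<le> (1 - \<rho> * g) * (m + \<rho>)" by (simp add: algebra_simps)
  then have "m / (m + \<rho>) \<le> 1 - \<rho> * g" using shift_pos by (simp only: pos_divide_le_eq)
  also have "\<dots> = u \<bullet> (H *v x)"
    using arg_cong[OF resolvent_eq, of "\<lambda>y. u \<bullet> y"] norm_u
    by (simp add: g_def inner_simps dot_square_norm)
  finally show ?thesis by (simp add: x_def matrix_vector_mul_assoc)
qed

lemma Min_range_nonneg:
  fixes l :: "'s::finite \<Rightarrow> real"
  assumes "\<And>i. 0 \<le> l i"
  shows "0 \<le> Min (range l)"
  using assms by (auto simp: Min_ge_iff)

text \<open>Each Nystrom eigenvector contributes to the trace defining the effective dimension.\<close>

lemma deff_ge_min_nystrom_eigenvalue:
  fixes H :: "real^'d^'d" and U :: "real^'s^'d"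
  assumes H_sym_psd: "transpose H = H" "0 \<preceq> H" and \<rho>_pos: "0 < \<rho>"
    and U_orthonormal: "transpose U ** U = mat 1"
    and lam_nonneg: "\<And>i. 0 \<le> lam i" and loewner_le_H: "spectral_matrix U lam \<preceq> H"
  shows "real CARD('s) * (Min (range lam) / (Min (range lam) + \<rho>)) \<le> deff H \<rho>"
proof -
  define m where "m = Min (range lam)"
  have m_bounds: "0 \<le> m" "m \<le> lam k" for k
    using Min_range_nonneg[of lam, OF lam_nonneg] by (simp_all add: m_def)
  define F where "F = H ** matrix_inv (H + \<rho> *\<^sub>R mat 1)"
  obtain Q l where Q_orthogonal: "orthogonal_matrix Q" and spectral: "H = spectral_matrix Q l"
    and l_nonneg: "\<And>i. 0 \<le> l i"
    using psd_matrix_diagonalizable[OF H_sym_psd] by blast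
  have F_eq: "F = spectral_matrix Q (\<lambda>i. l i / (l i + \<rho>))"
    unfolding F_def spectral by (rule spectral_matrix_resolvent[OF Q_orthogonal l_nonneg \<rho>_pos])
  have "m / (m + \<rho>) \<le> column k U \<bullet> (F *v column k U)" for k
    unfolding F_def
  proof (rule inner_resolvent_ge[OF H_sym_psd(2) \<rho>_pos norm_column_orthonormal[OF U_orthonormal]
      m_bounds(1)])
    fix x
    have "column k U \<bullet> x = (transpose U *v x) $ k"
      by (simp add: matrix_vector_mult_def transpose_def column_def inner_vec_def)
    then have "m * (column k U \<bullet> x)\<^sup>2 \<le> lam k * ((transpose U *v x) $ k)\<^sup>2"
      using m_bounds by (simp add: mult_right_mono)
    also have "\<dots> \<le> (\<Sum>i\<in>UNIV. lam i * ((transpose U *v x) $ i)\<^sup>2)"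
      by (rule member_le_sum) (auto simp: lam_nonneg)
    also have "\<dots> \<le> x \<bullet> (H *v x)"
      using loewner_le_H by (simp add: loewner_le_def flip: inner_spectral_matrix)
    finally show "m * (column k U \<bullet> x)\<^sup>2 \<le> x \<bullet> (H *v x)" .
  qed
  then have "real CARD('s) * (m / (m + \<rho>)) \<le> (\<Sum>k\<in>UNIV. column k U \<bullet> (F *v column k U))"
    using sum_mono[of "UNIV :: 's set" "\<lambda>_. m / (m + \<rho>)"] by simp
  also have "\<dots> \<le> trace F"
  proof (rule trace_compression_le[OF _ _ U_orthonormal])
    show "transpose F = F" by (simp add: F_eq)
    show "0 \<preceq> F"
      using Q_orthogonal l_nonneg \<rho>_pos by (simp add: F_eq spectral_matrix_psd_iff orthogonal_matrix)
  qed
  finally show ?thesis by (simp add: deff_def F_def m_def)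
qed

lemma min_nystrom_eigenvalue_le:
  fixes H :: "real^'d^'d" and U :: "real^'s^'d"
  assumes H_sym_psd: "transpose H = H" "0 \<preceq> H" and \<rho>_pos: "0 < \<rho>"
    and U_orthonormal: "transpose U ** U = mat 1"
    and lam_nonneg: "\<And>i. 0 \<le> lam i" and loewner_le_H: "spectral_matrix U lam \<preceq> H"
    and card: "2 * deff H \<rho> \<le> real CARD('s)"
  shows "Min (range lam) \<le> \<rho>"
proof -
  define m where "m = Min (range lam)"
  have m_nonneg: "0 \<le> m" unfolding m_def using lam_nonneg by (rule Min_range_nonneg)
  have "real CARD('s) * (m / (m + \<rho>)) \<le> real CARD('s) * (1/2)"
    using deff_ge_min_nystrom_eigenvalue[OF H_sym_psd \<rho>_pos U_orthonormal lam_nonneg loewner_le_H] card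
    unfolding m_def by linarith
  then have "m / (m + \<rho>) \<le> 1/2"
    by (simp only: mult_le_cancel_left_pos zero_less_card_finite of_nat_0_less_iff)
  moreover have "0 < m + \<rho>" using m_nonneg \<rho>_pos by linarith
  ultimately show ?thesis by (simp add: m_def field_simps)
qed

lemma nys_precond_eq:
  "nys_precond U lam \<rho> = (1 / (Min (range lam) + \<rho>)) *\<^sub>R spectral_matrix U (\<lambda>i. lam i + \<rho>)
    + (mat 1 - spectral_matrix U (\<lambda>_. 1))"
  by (simp add: nys_precond_def spectral_matrix_def)

lemma transpose_nys_precond: "transpose (nys_precond U lam \<rho>) = nys_precond U lam \<rho>"
  by (simp add: nys_precond_eq transpose_add transpose_diff transpose_scalar)

context
  fixes U :: "real^'s^'d" and lam :: "'s \<Rightarrow> real" and \<rho> :: real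
  assumes lam_nonneg: "\<And>i. 0 \<le> lam i" and \<rho>_pos: "0 < \<rho>"
begin

lemma inner_nys_precond:
  "(Min (range lam) + \<rho>) * (v \<bullet> (nys_precond U lam \<rho> *v v))
    = v \<bullet> (spectral_matrix U lam *v v) + \<rho> * (v \<bullet> v)
      + Min (range lam) * ((norm v)\<^sup>2 - (norm (transpose U *v v))\<^sup>2)"
proof -
  have "(norm (transpose U *v v))\<^sup>2 = (\<Sum>i\<in>UNIV. ((transpose U *v v) $ i)\<^sup>2)"
    by (simp add: norm_vec_def L2_set_def sum_nonneg)
  moreover have "Min (range lam) + \<rho> \<noteq> 0" using Min_range_nonneg[of lam, OF lam_nonneg] \<rho>_pos by linarith
  ultimately show ?thesis
    by (simp add: nys_precond_eq matrix_vector_mult_add_rdistrib matrix_vector_mult_diff_rdistrib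
        inner_simps inner_spectral_matrix distrib_right sum.distrib sum_distrib_left
        power2_norm_eq_inner field_simps flip: scaleR_matrix_vector_assoc)
qed

lemma id_loewner_le_nys_precond: "mat 1 \<preceq> nys_precond U lam \<rho>"
  unfolding loewner_le_def
proof
  fix v
  have "Min (range lam) * (norm (transpose U *v v))\<^sup>2 \<le> v \<bullet> (spectral_matrix U lam *v v)"
    unfolding inner_spectral_matrix
    by (simp add: norm_vec_def L2_set_def sum_nonneg sum_distrib_left sum_mono mult_right_mono)
  then have "(Min (range lam) + \<rho>) * (v \<bullet> v) \<le> (Min (range lam) + \<rho>) * (v \<bullet> (nys_precond U lam \<rho> *v v))"
    unfolding inner_nys_precond by (simp add: power2_norm_eq_inner algebra_simps)
  moreover have "0 < Min (range lam) + \<rho>" using Min_range_nonneg[of lam, OF lam_nonneg] \<rho>_pos by linarith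
  ultimately show "v \<bullet> (mat 1 *v v) \<le> v \<bullet> (nys_precond U lam \<rho> *v v)" by simp
qed

lemma pos_def_nys_precond: "pos_def_matrix (nys_precond U lam \<rho>)"
  using pos_def_matrix_loewner_le[OF pos_def_matrix_id, of 1] id_loewner_le_nys_precond by simp

lemma nys_precond_loewner_le:
  assumes N_le: "spectral_matrix U lam \<preceq> H" and H_psd: "0 \<preceq> H"
  shows "\<rho> *\<^sub>R nys_precond U lam \<rho> \<preceq> H + \<rho> *\<^sub>R mat 1"
  unfolding loewner_le_def
proof
  fix v
  define m where "m = Min (range lam)"
  define h where "h = v \<bullet> (H *v v) + \<rho> * (v \<bullet> v)"
  have m_bounds: "0 \<le> m" "0 < m + \<rho>"
    using Min_range_nonneg[of lam, OF lam_nonneg] \<rho>_pos by (simp_all add: m_def add_nonneg_pos)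
  have "(m + \<rho>) * (v \<bullet> (nys_precond U lam \<rho> *v v)) \<le> h + m * (v \<bullet> v)"
    using N_le mult_nonneg_nonneg[OF m_bounds(1) zero_le_power2[of "norm (transpose U *v v)"]]
    unfolding m_def inner_nys_precond h_def loewner_le_def
    by (simp add: power2_norm_eq_inner right_diff_distrib add_mono)
  then have "\<rho> * ((m + \<rho>) * (v \<bullet> (nys_precond U lam \<rho> *v v))) \<le> \<rho> * (h + m * (v \<bullet> v))"
    using \<rho>_pos by (intro mult_left_mono) auto
  also have "\<dots> \<le> (m + \<rho>) * h"
    using mult_nonneg_nonneg[OF m_bounds(1) psd_inner_nonneg[OF H_psd, of v]]
    by (simp add: h_def algebra_simps)
  finally have "(m + \<rho>) * (\<rho> * (v \<bullet> (nys_precond U lam \<rho> *v v))) \<le> (m + \<rho>) * h" by (simp add: mult_ac)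
  then have "\<rho> * (v \<bullet> (nys_precond U lam \<rho> *v v)) \<le> h"
    using m_bounds(2) by (simp only: mult_le_cancel_left_pos)
  then show "v \<bullet> ((\<rho> *\<^sub>R nys_precond U lam \<rho>) *v v) \<le> v \<bullet> ((H + \<rho> *\<^sub>R mat 1) *v v)"
    by (simp add: h_def matrix_add_scaled_id_mult_vec inner_simps flip: scaleR_matrix_vector_assoc)
qed

lemma loewner_le_nys_precond:
  assumes U_orthonormal: "transpose U ** U = mat 1"
    and H_le: "H \<preceq> spectral_matrix U lam + c *\<^sub>R mat 1" and c_nonneg: "0 \<le> c"
  shows "H + \<rho> *\<^sub>R mat 1 \<preceq> (Min (range lam) + \<rho> + c) *\<^sub>R nys_precond U lam \<rho>"
  unfolding loewner_le_def
proof
  fix v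
  let ?P = "nys_precond U lam \<rho>"
  have "(norm (transpose U *v v))\<^sup>2 \<le> (norm v)\<^sup>2"
    using bessel_inequality[OF U_orthonormal] by (intro power_mono) auto
  then have "0 \<le> Min (range lam) * ((norm v)\<^sup>2 - (norm (transpose U *v v))\<^sup>2)"
    using Min_range_nonneg[of lam, OF lam_nonneg] by simp
  then have "v \<bullet> (spectral_matrix U lam *v v) + \<rho> * (v \<bullet> v) \<le> (Min (range lam) + \<rho>) * (v \<bullet> (?P *v v))"
    unfolding inner_nys_precond by simp
  moreover have "c * (v \<bullet> v) \<le> c * (v \<bullet> (?P *v v))"
    using id_loewner_le_nys_precond c_nonneg by (simp add: loewner_le_def mult_left_mono)
  moreover have "v \<bullet> (H *v v) \<le> v \<bullet> (spectral_matrix U lam *v v) + c * (v \<bullet> v)"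
    using H_le by (simp add: loewner_le_def matrix_add_scaled_id_mult_vec inner_simps)
  ultimately show "v \<bullet> ((H + \<rho> *\<^sub>R mat 1) *v v) \<le> v \<bullet> (((Min (range lam) + \<rho> + c) *\<^sub>R ?P) *v v)"
    by (simp add: matrix_add_scaled_id_mult_vec inner_simps distrib_right
        flip: scaleR_matrix_vector_assoc)
qed

end

lemma pcg_accurate_nys_precond:
  fixes H :: "real^'d^'d" and Om U :: "real^'s^'d"
  assumes H_sym_psd: "transpose H = H" "0 \<preceq> H" and \<rho>_pos: "0 < \<rho>"
    and approx: "H \<preceq> nystrom H Om + (14 * \<rho>) *\<^sub>R mat 1" and card: "2 * deff H \<rho> \<le> real CARD('s)"
    and U_orthonormal: "transpose U ** U = mat 1" and N_eq: "nystrom H Om = spectral_matrix U lam"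
  shows "pcg_accurate (H + \<rho> *\<^sub>R mat 1) (nys_precond U lam \<rho>) \<rho>"
proof (rule pcg_accurate_of_loewner_bounds[OF _ transpose_nys_precond _ \<rho>_pos])
  let ?P = "nys_precond U lam \<rho>" and ?m = "Min (range lam)"
  obtain B :: "real^'d^'d" where H_eq: "H = B ** transpose B"
    using H_sym_psd by (rule psd_matrix_factorization)
  have N_le: "spectral_matrix U lam \<preceq> H" using nystrom_loewner_le[OF H_eq] by (simp flip: N_eq)
  have lam_nonneg: "0 \<le> lam i" for i
    using nystrom_psd[OF H_eq, of Om] spectral_matrix_psd_iff[OF U_orthonormal] by (simp add: N_eq)
  show pos_def: "pos_def_matrix ?P" by (rule pos_def_nys_precond[OF lam_nonneg \<rho>_pos])
  show "\<rho> *\<^sub>R ?P \<preceq> H + \<rho> *\<^sub>R mat 1"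
    by (rule nys_precond_loewner_le[OF lam_nonneg \<rho>_pos N_le H_sym_psd(2)])
  have "H + \<rho> *\<^sub>R mat 1 \<preceq> (?m + \<rho> + 14 * \<rho>) *\<^sub>R ?P"
    using approx \<rho>_pos
    unfolding N_eq by (intro loewner_le_nys_precond[OF lam_nonneg \<rho>_pos U_orthonormal]) auto
  also have "\<dots> \<preceq> (16 * \<rho>) *\<^sub>R ?P"
    using min_nystrom_eigenvalue_le[OF H_sym_psd \<rho>_pos U_orthonormal lam_nonneg N_le card]
    by (intro scaleR_loewner_le_mono pos_def_matrix_psd pos_def) simp
  finally show "H + \<rho> *\<^sub>R mat 1 \<preceq> (16 * \<rho>) *\<^sub>R ?P" .
  show "\<rho> *\<^sub>R mat 1 \<preceq> H + \<rho> *\<^sub>R mat 1" by (rule scaled_id_loewner_le_add[OF H_sym_psd(2)])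
  show "transpose (H + \<rho> *\<^sub>R mat 1) = H + \<rho> *\<^sub>R mat 1"
    by (simp add: transpose_add transpose_scalar H_sym_psd)
qed

context gaussian_matrix
begin

theorem loewner_le_nystrom_add_event:
  fixes H :: "real^'d^'d"
  assumes H_sym_psd: "transpose H = H" "0 \<preceq> H" and \<rho>_pos: "0 < \<rho>" and \<delta>_bounds: "0 < \<delta>" "\<delta> < 1"
    and card: "8 * deff H \<rho> \<le> real CARD('s)" "64 * ln (16 / \<delta>) \<le> real CARD('s)"
  shows "\<exists>E\<in>events. 1 - \<delta> \<le> prob E \<and> (\<forall>\<omega>\<in>E. H \<preceq> nystrom H (Om \<omega>) + (14 * \<rho>) *\<^sub>R mat 1)"
proof -
  obtain B C D :: "real^'d^'d" where H_eq: "H = B ** transpose B" and B_eq: "C ** D = B"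
    and norm_D: "\<And>w. (norm (D *v w))\<^sup>2 = (norm (B *v w))\<^sup>2 + \<rho> * (norm w)\<^sup>2"
    and contraction: "\<And>x. norm (C *v x) \<le> norm x" and trace_eq: "trace (transpose C ** C) = deff H \<rho>"
    using regularized_square_root[OF H_sym_psd \<rho>_pos] by blast
  obtain E where E_prob: "E \<in> events" "1 - \<delta> \<le> prob E"
    and null_bound: "\<And>\<omega> v. \<omega> \<in> E \<Longrightarrow> transpose (Om \<omega>) *v (C *v v) = 0 \<Longrightarrow>
        15/14 * (norm (C *v v))\<^sup>2 \<le> (norm v)\<^sup>2"
    using null_space_bound[OF contraction _ \<delta>_bounds card(2)] card(1) trace_eq by auto
  have "H \<preceq> nystrom H (Om \<omega>) + (14 * \<rho>) *\<^sub>R mat 1" if \<omega>_in_E: "\<omega> \<in> E" for \<omega>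
  proof (rule loewner_le_nystrom_add[OF H_eq])
    fix w assume "transpose (Om \<omega>) *v (B *v w) = 0"
    then have "15/14 * (norm (B *v w))\<^sup>2 \<le> (norm (D *v w))\<^sup>2"
      using null_bound[OF \<omega>_in_E, of "D *v w"] by (simp add: matrix_vector_mul_assoc B_eq)
    then show "(norm (B *v w))\<^sup>2 \<le> 14 * \<rho> * (norm w)\<^sup>2" by (simp add: norm_D)
  qed (use \<rho>_pos in simp)
  then show ?thesis using E_prob by blast
qed

theorem pcg_accurate_nys_precond_event:
  fixes H :: "real^'d^'d"
  assumes H_sym_psd: "transpose H = H" "0 \<preceq> H" and \<rho>_pos: "0 < \<rho>" and \<delta>_bounds: "0 < \<delta>" "\<delta> < 1"
    and card: "8 * (sqrt (deff H \<rho>) + sqrt (8 * ln (16 / \<delta>)))\<^sup>2 \<le> real CARD('s)"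
  obtains E where "E \<in> events" "1 - \<delta> \<le> prob E"
    "\<And>\<omega> (U :: real^'s^'d) lam. \<omega> \<in> E \<Longrightarrow> transpose U ** U = mat 1 \<Longrightarrow>
      nystrom H (Om \<omega>) = spectral_matrix U lam \<Longrightarrow> pcg_accurate (H + \<rho> *\<^sub>R mat 1) (nys_precond U lam \<rho>) \<rho>"
proof -
  define p q where "p = sqrt (deff H \<rho>)" and "q = sqrt (8 * ln (16 / \<delta>))"
  have pq_squares: "0 \<le> p" "0 \<le> q" "p\<^sup>2 = deff H \<rho>" "q\<^sup>2 = 8 * ln (16 / \<delta>)"
    using deff_nonneg[OF H_sym_psd \<rho>_pos] \<delta>_bounds by (simp_all add: p_def q_def)
  have "p\<^sup>2 \<le> (p + q)\<^sup>2" "q\<^sup>2 \<le> (p + q)\<^sup>2" using pq_squares(1,2) by (auto intro!: power_mono)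
  moreover have "8 * (p + q)\<^sup>2 \<le> real CARD('s)" using card by (simp add: p_def q_def)
  ultimately have sketch_size: "8 * deff H \<rho> \<le> real CARD('s)" "64 * ln (16 / \<delta>) \<le> real CARD('s)"
    using pq_squares(3,4) by linarith+
  obtain E where E_prob: "E \<in> events" "1 - \<delta> \<le> prob E"
    and approx: "\<And>\<omega>. \<omega> \<in> E \<Longrightarrow> H \<preceq> nystrom H (Om \<omega>) + (14 * \<rho>) *\<^sub>R mat 1"
    using loewner_le_nystrom_add_event[OF H_sym_psd \<rho>_pos \<delta>_bounds sketch_size] by blast
  have "2 * deff H \<rho> \<le> real CARD('s)" using sketch_size(1) deff_nonneg[OF H_sym_psd \<rho>_pos] by linarith
  then show thesis using that[OF E_prob] pcg_accurate_nys_precond[OF H_sym_psd \<rho>_pos approx] by blast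
qed

end

section \<open>Subgradients and duality\<close>

definition subgrad :: "('a::real_inner \<Rightarrow> ereal) \<Rightarrow> 'a \<Rightarrow> 'a \<Rightarrow> bool" where
  "subgrad h x y \<longleftrightarrow> \<bar>h x\<bar> \<noteq> \<infinity> \<and> (\<forall>v. h x + ereal (y \<bullet> (v - x)) \<le> h v)"

lemma subgrad_ereal_iff: "subgrad (\<lambda>x. ereal (f x)) x y \<longleftrightarrow> (\<forall>v. f x + y \<bullet> (v - x) \<le> f v)"
  by (simp add: subgrad_def)

lemma subgrad_monotone:
  assumes "subgrad h x y" "subgrad h x' y'"
  shows "0 \<le> (x - x') \<bullet> (y - y')"
proof -
  obtain a b where finite_values: "h x = ereal a" "h x' = ereal b"
    using assms by (auto simp: subgrad_def)
  have "h x + ereal (y \<bullet> (x' - x)) \<le> h x'" "h x' + ereal (y' \<bullet> (x - x')) \<le> h x"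
    using assms by (auto simp: subgrad_def)
  then have "a + y \<bullet> (x' - x) \<le> b" "b + y' \<bullet> (x - x') \<le> a" using finite_values by auto
  then show ?thesis by (simp add: inner_simps inner_commute)
qed

lemma proper_funE:
  assumes "proper_fun h" "h x \<noteq> \<infinity>"
  obtains a where "h x = ereal a"
proof (cases "h x")
  case (real a)
  then show thesis by (rule that)
next
  case PInf
  then show thesis using assms(2) by simp
next
  case MInf
  then show thesis using assms(1) unfolding proper_fun_def by metis
qed

lemma subgradI:
  assumes proper_finite: "proper_fun h" "h x = ereal a"
    and subgradient_ineq: "\<And>v c. h v = ereal c \<Longrightarrow> a + y \<bullet> (v - x) \<le> c"
  shows "subgrad h x y"
proof -
  have "h x + ereal (y \<bullet> (v - x)) \<le> h v" for v
  proof (cases "h v = \<infinity>")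
    case False
    obtain c where finite_value: "h v = ereal c" by (rule proper_funE[OF proper_finite(1) False])
    then show ?thesis using subgradient_ineq[OF finite_value] proper_finite(2) by simp
  qed simp
  then show ?thesis using proper_finite(2) by (simp add: subgrad_def)
qed

lemma subgrad_closed_graph:
  fixes h :: "'a::real_inner \<Rightarrow> ereal"
  assumes closed_proper: "closed_fun h" "proper_fun h"
    and X_lim: "X \<longlonglongrightarrow> x" and Y_lim: "Y \<longlonglongrightarrow> y" and subgrad: "\<And>k. subgrad h (X k) (Y k)"
  shows "subgrad h x y"
proof -
  have limit: "h x \<le> ereal (c - y \<bullet> (v - x))" if finite_value: "h v = ereal c" for v c
  proof -
    have "(X k, c - Y k \<bullet> (v - X k)) \<in> epigraph h" for k
    proof -
      obtain a where "h (X k) = ereal a" using subgrad[of k] by (auto simp: subgrad_def)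
      moreover have "h (X k) + ereal (Y k \<bullet> (v - X k)) \<le> h v" using subgrad by (auto simp: subgrad_def)
      ultimately show ?thesis using finite_value by (auto simp: epigraph_def)
    qed
    moreover have "(\<lambda>k. (X k, c - Y k \<bullet> (v - X k))) \<longlonglongrightarrow> (x, c - y \<bullet> (v - x))"
      by (intro tendsto_intros X_lim Y_lim)
    ultimately have "(x, c - y \<bullet> (v - x)) \<in> epigraph h"
      by (rule closed_sequentially[OF closed_proper(1)[unfolded closed_fun_def]])
    then show ?thesis by (simp add: epigraph_def)
  qed
  obtain v0 where "h v0 \<noteq> \<infinity>" using closed_proper(2) by (auto simp: proper_fun_def)
  then obtain c0 where "h v0 = ereal c0" by (rule proper_funE[OF closed_proper(2)])
  from limit[OF this] have "h x \<noteq> \<infinity>" by auto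
  then obtain a where finite_limit_value: "h x = ereal a" by (rule proper_funE[OF closed_proper(2)])
  show ?thesis
  proof (rule subgradI[OF closed_proper(2) finite_limit_value])
    show "a + y \<bullet> (v - x) \<le> c" if "h v = ereal c" for v c
      using limit[OF that] finite_limit_value by simp
  qed
qed

lemma convex_fun_segment:
  assumes "convex_fun h" "h x = ereal a" "h v = ereal c" "0 \<le> t" "t \<le> 1"
  shows "h (x + t *\<^sub>R (v - x)) \<le> ereal (a + t * (c - a))"
proof -
  have "(x, a) \<in> epigraph h" "(v, c) \<in> epigraph h" using assms by (auto simp: epigraph_def)
  then have "(1 - t) *\<^sub>R (x, a) + t *\<^sub>R (v, c) \<in> epigraph h"
    using assms unfolding convex_fun_def convex_alt by blast
  moreover have "(1 - t) *\<^sub>R x + t *\<^sub>R v = x + t *\<^sub>R (v - x)" "(1 - t) * a + t * c = a + t * (c - a)"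
    by (simp_all add: algebra_simps)
  ultimately show ?thesis by (simp add: epigraph_def)
qed

lemma has_derivative_directional_limit:
  fixes f :: "'a::real_normed_vector \<Rightarrow> real"
  assumes derivative: "(f has_derivative D) (at x)"
  shows "((\<lambda>t. (f (x + t *\<^sub>R v) - f x) / t) \<longlongrightarrow> D v) (at_right 0)"
proof -
  have "((\<lambda>t. f (x + t *\<^sub>R v)) has_derivative (\<lambda>t. D (t *\<^sub>R v))) (at 0)"
    by (rule has_derivative_compose[where g = f and f = "\<lambda>t. x + t *\<^sub>R v", simplified])
       (auto intro!: derivative_eq_intros simp: derivative)
  moreover have "(\<lambda>t. D (t *\<^sub>R v)) = (*) (D v)"
    using has_derivative_linear[OF derivative] by (simp add: fun_eq_iff linear_cmul mult.commute)
  ultimately have "((\<lambda>t. f (x + t *\<^sub>R v)) has_real_derivative D v) (at 0)"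
    by (simp add: has_field_derivative_def)
  from DERIV_D[OF this] show ?thesis using filterlim_at_split by fastforce
qed

lemma subgrad_of_minimizer_add_differentiable:
  fixes h :: "'a::real_inner \<Rightarrow> ereal"
  assumes convex_proper: "convex_fun h" "proper_fun h"
    and deriv: "(f has_derivative (\<lambda>v. G \<bullet> v)) (at x)"
    and minimizer: "\<And>v. ereal (f x) + h x \<le> ereal (f v) + h v"
  shows "subgrad h x (- G)"
proof -
  obtain v0 where "h v0 \<noteq> \<infinity>" using convex_proper(2) by (auto simp: proper_fun_def)
  then have "h x \<noteq> \<infinity>" using minimizer[of v0] by auto
  then obtain a where finite_value: "h x = ereal a" by (rule proper_funE[OF convex_proper(2)])
  show ?thesis
  proof (rule subgradI[OF convex_proper(2) finite_value])
    fix v c assume finite_value_v: "h v = ereal c"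
    have "\<forall>\<^sub>F t in at_right (0::real). a - c \<le> (f (x + t *\<^sub>R (v - x)) - f x) / t"
      using eventually_at_right_real[of 0 1, OF zero_less_one]
    proof eventually_elim
      case (elim t)
      then have t_bounds: "0 < t" "t \<le> 1" by auto
      have "ereal (f x) + ereal a \<le> ereal (f (x + t *\<^sub>R (v - x))) + h (x + t *\<^sub>R (v - x))"
        using minimizer finite_value by metis
      also have "\<dots> \<le> ereal (f (x + t *\<^sub>R (v - x))) + ereal (a + t * (c - a))"
        using convex_fun_segment[OF convex_proper(1) finite_value finite_value_v, of t] t_bounds
        by (intro add_left_mono) auto
      finally have "f x + a \<le> f (x + t *\<^sub>R (v - x)) + (a + t * (c - a))" by simp
      then show ?case using t_bounds by (simp add: field_simps)
    qed
    from tendsto_lowerbound[OF has_derivative_directional_limit[OF deriv] this]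
    show "a + - G \<bullet> (v - x) \<le> c" by simp
  qed
qed

text \<open>Every point minimizes -f + f.\<close>

lemma convex_on_subgrad_gradient:
  fixes f :: "'a::real_inner \<Rightarrow> real"
  assumes convex: "convex_on UNIV f" and deriv: "(f has_derivative (\<lambda>v. G \<bullet> v)) (at x)"
  shows "subgrad (\<lambda>x. ereal (f x)) x G"
proof -
  have "epigraph (\<lambda>x. ereal (f x)) = Convex.epigraph UNIV f"
    by (auto simp: Defs.epigraph_def Convex.epigraph_def)
  then have "convex_fun (\<lambda>x. ereal (f x))" using convex by (simp add: convex_fun_def convex_epigraph)
  moreover have "((\<lambda>v. - f v) has_derivative (\<lambda>v. (- G) \<bullet> v)) (at x)"
    using has_derivative_minus[OF deriv] by simp
  ultimately have "subgrad (\<lambda>x. ereal (f x)) x (- (- G))"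
    by (intro subgrad_of_minimizer_add_differentiable[where f = "\<lambda>v. - f v"])
       (auto simp: proper_fun_def)
  then show ?thesis by simp
qed

lemma prox_subgrad:
  fixes h :: "'a::real_inner \<Rightarrow> ereal"
  assumes convex_proper: "convex_fun h" "proper_fun h"
    and minimizer: "\<And>v. h z + ereal (\<rho> / 2 * (norm (a - z))\<^sup>2) \<le> h v + ereal (\<rho> / 2 * (norm (a - v))\<^sup>2)"
  shows "subgrad h z (\<rho> *\<^sub>R (a - z))"
proof -
  have "((\<lambda>v. a - v) has_derivative (\<lambda>v. - v)) (at z)"
    using has_derivative_diff[OF has_derivative_const has_derivative_ident, of a] by simp
  from has_derivative_mult_right[OF has_derivative_inner[OF this this], of "\<rho> / 2"]
  have "((\<lambda>v. \<rho> / 2 * (norm (a - v))\<^sup>2) has_derivative (\<lambda>v. (- (\<rho> *\<^sub>R (a - z))) \<bullet> v)) (at z)"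
    by (simp add: power2_norm_eq_inner inner_simps inner_commute algebra_simps)
  then have "subgrad h z (- (- (\<rho> *\<^sub>R (a - z))))"
    by (rule subgrad_of_minimizer_add_differentiable[OF convex_proper])
       (use minimizer in \<open>simp add: add.commute\<close>)
  then show ?thesis by simp
qed

lemma fconj_ge: "h x = ereal a \<Longrightarrow> ereal (y \<bullet> x - a) \<le> fconj h y"
  unfolding fconj_def by (rule SUP_upper2[of x]) auto

lemma fconj_subgrad:
  assumes subgrad: "subgrad h x y" and finite_value: "h x = ereal a"
  shows "fconj h y = ereal (y \<bullet> x - a)"
proof (rule antisym)
  show "fconj h y \<le> ereal (y \<bullet> x - a)"
    unfolding fconj_def
  proof (rule SUP_least)
    fix v
    have "h x + ereal (y \<bullet> (v - x)) \<le> h v" using subgrad by (auto simp: subgrad_def)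
    then show "ereal (y \<bullet> v) - h v \<le> ereal (y \<bullet> x - a)"
      using finite_value by (cases "h v") (auto simp: inner_simps)
  qed
qed (rule fconj_ge[of h x a, OF finite_value])

lemma primal_dual_sol_of_subgrad:
  assumes f_subgrad: "subgrad (\<lambda>x. ereal (fsmooth A b g x)) x (- y)" and h_subgrad: "subgrad h x y"
  shows "is_primal_sol A b g h x" "is_dual_sol A b g h y"
proof -
  obtain a where finite_value: "h x = ereal a" using h_subgrad by (auto simp: subgrad_def)
  let ?f = "fsmooth A b g"
  show "is_primal_sol A b g h x"
    unfolding is_primal_sol_def primal_obj_def
  proof
    fix v
    have "h x + ereal (y \<bullet> (v - x)) \<le> h v" "?f x + (- y) \<bullet> (v - x) \<le> ?f v"
      using f_subgrad h_subgrad by (auto simp: subgrad_def)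
    then show "ereal (?f x) + h x \<le> ereal (?f v) + h v" using finite_value by (cases "h v") auto
  qed
  show "is_dual_sol A b g h y" unfolding is_dual_sol_def dual_obj_def
  proof
    fix y'
    have "fconj (\<lambda>x. ereal (?f x)) (- y) + fconj h y = ereal (- y \<bullet> x - ?f x) + ereal (y \<bullet> x - a)"
      by (simp add: fconj_subgrad[OF f_subgrad refl] fconj_subgrad[OF h_subgrad finite_value])
    also have "\<dots> = ereal (- y' \<bullet> x - ?f x) + ereal (y' \<bullet> x - a)" by simp
    also have "\<dots> \<le> fconj (\<lambda>x. ereal (?f x)) (- y') + fconj h y'"
      using fconj_ge[of "\<lambda>x. ereal (?f x)" x "?f x" "- y'", OF refl]
        fconj_ge[of h x a y', OF finite_value]
      by (rule add_mono)
    finally show "- (fconj (\<lambda>x. ereal (?f x)) (- y') + fconj h y')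
        \<le> - (fconj (\<lambda>x. ereal (?f x)) (- y) + fconj h y)"
      by (simp add: ereal_minus_le_minus)
  qed
qed

section \<open>Inexact ADMM\<close>

lemma convergent_almost_decreasing:
  fixes a e :: "nat \<Rightarrow> real"
  assumes almost_decreasing: "\<And>k. 0 \<le> a k" "\<And>k. a (Suc k) \<le> a k + e k"
    and summable_error: "\<And>k. 0 \<le> e k" "summable e"
  shows "convergent a"
proof -
  define c where "c k = a k - (\<Sum>i<k. e i)" for k
  have "decseq c" using almost_decreasing(2) by (intro decseq_SucI) (auto simp: c_def algebra_simps)
  moreover have "- suminf e \<le> c k" for k
    using almost_decreasing(1)[of k] sum_le_suminf[OF summable_error(2), of "{..<k}"] summable_error(1)
    by (simp add: c_def)
  ultimately obtain L where "c \<longlonglongrightarrow> L" using decseq_convergent by metis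
  then have "(\<lambda>k. c k + (\<Sum>i<k. e i)) \<longlonglongrightarrow> L + suminf e"
    using summable_error(2) by (intro tendsto_add summable_LIMSEQ)
  then show ?thesis by (auto simp: c_def convergent_def)
qed

locale inexact_admm =
  fixes f h :: "'a::euclidean_space \<Rightarrow> ereal" and \<rho> :: real
    and x z u xe :: "nat \<Rightarrow> 'a" and e :: "nat \<Rightarrow> real"
  assumes \<rho>_pos: "0 < \<rho>" and f_closed_proper: "closed_fun f" "proper_fun f"
    and h_closed_proper: "closed_fun h" "proper_fun h"
    and exact_update: "\<And>k. subgrad f (xe k) (\<rho> *\<^sub>R (z k - u k - xe k))"
    and z_subgrad: "\<And>k. subgrad h (z k) (\<rho> *\<^sub>R u k)"
    and u_Suc: "\<And>k. u (Suc k) = u k + x (Suc k) - z (Suc k)"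
    and error: "\<And>k. norm (x (Suc k) - xe k) \<le> e k" and summable_error: "summable e"
begin

definition kkt :: "'a \<Rightarrow> 'a \<Rightarrow> bool" where
  "kkt a q \<longleftrightarrow> subgrad f a (- (\<rho> *\<^sub>R q)) \<and> subgrad h a (\<rho> *\<^sub>R q)"

lemma scaled_subgrad_monotone:
  assumes "subgrad \<phi> a (\<rho> *\<^sub>R q)" "subgrad \<phi> a' (\<rho> *\<^sub>R q')"
  shows "0 \<le> (a - a') \<bullet> (q - q')"
proof -
  have "0 \<le> \<rho> * ((a - a') \<bullet> (q - q'))"
    using subgrad_monotone[OF assms] by (simp flip: scaleR_diff_right)
  then show ?thesis using \<rho>_pos by (simp add: zero_le_mult_iff)
qed

text \<open>In the variable z + u, exact ADMM is a Douglas--Rachford iteration, hence firmly nonexpansive.\<close>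

lemma exact_step_firmly_nonexpansive:
  assumes "kkt a q"
  shows "(norm (xe k + u k - (a + q)))\<^sup>2 \<le> (norm (z k + u k - (a + q)))\<^sup>2 - (norm (z k - xe k))\<^sup>2"
proof -
  define X Z Y where "X = xe k - a" "Z = z k - a" "Y = u k - q"
  note XZY = X_Z_Y_def
  have "0 \<le> (xe k - a) \<bullet> ((z k - u k - xe k) - (- q))"
    using assms exact_update by (intro scaled_subgrad_monotone) (auto simp: kkt_def)
  moreover have "(z k - u k - xe k) - (- q) = Z - Y - X" by (simp add: XZY)
  ultimately have "0 \<le> X \<bullet> (Z - Y - X)" by (simp only: XZY(1))
  moreover have "0 \<le> Z \<bullet> Y"
    unfolding XZY using assms z_subgrad by (intro scaled_subgrad_monotone) (auto simp: kkt_def)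
  moreover have "xe k + u k - (a + q) = X + Y" "z k + u k - (a + q) = Z + Y" "z k - xe k = Z - X"
    by (simp_all add: XZY)
  ultimately show ?thesis by (simp add: power2_norm_eq_inner inner_simps inner_commute)
qed

lemma exact_step_le:
  assumes "kkt a q"
  shows "norm (xe k + u k - (a + q)) \<le> norm (z k + u k - (a + q))"
proof (rule power2_le_imp_le)
  show "(norm (xe k + u k - (a + q)))\<^sup>2 \<le> (norm (z k + u k - (a + q)))\<^sup>2"
    using exact_step_firmly_nonexpansive[OF assms, of k] zero_le_power2[of "norm (z k - xe k)"]
    by linarith
qed simp

lemma inexact_step_le: "norm (z (Suc k) + u (Suc k) - w) \<le> norm (xe k + u k - w) + e k"
proof -
  have step: "z (Suc k) + u (Suc k) - w = (xe k + u k - w) + (x (Suc k) - xe k)" by (simp add: u_Suc)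
  show ?thesis
    unfolding step
    using norm_triangle_ineq[of "xe k + u k - w" "x (Suc k) - xe k"] error[of k] by linarith
qed

lemma distance_convergent:
  assumes "kkt a q"
  shows "convergent (\<lambda>k. norm (z k + u k - (a + q)))"
proof (rule convergent_almost_decreasing[OF _ _ _ summable_error])
  show "norm (z (Suc k) + u (Suc k) - (a + q)) \<le> norm (z k + u k - (a + q)) + e k" for k
    using inexact_step_le[of k "a + q"] exact_step_le[OF assms, of k] by linarith
  show "0 \<le> e k" for k using error[of k] norm_ge_zero order_trans by blast
qed simp

lemma exact_residual_tendsto_zero:
  assumes "kkt a q"
  shows "(\<lambda>k. z k - xe k) \<longlonglongrightarrow> 0"
proof -
  obtain L where limit: "(\<lambda>k. norm (z k + u k - (a + q))) \<longlonglongrightarrow> L"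
    using distance_convergent[OF assms] by (auto simp: convergent_def)
  have exact: "(\<lambda>k. norm (xe k + u k - (a + q))) \<longlonglongrightarrow> L"
  proof (rule tendsto_sandwich[of "\<lambda>k. norm (z (Suc k) + u (Suc k) - (a + q)) - e k"])
    show "(\<lambda>k. norm (z (Suc k) + u (Suc k) - (a + q)) - e k) \<longlonglongrightarrow> L"
      using tendsto_diff[OF LIMSEQ_Suc[OF limit] summable_LIMSEQ_zero[OF summable_error]] by simp
    show "\<forall>\<^sub>F k in sequentially. norm (z (Suc k) + u (Suc k) - (a + q)) - e k
        \<le> norm (xe k + u k - (a + q))"
      using inexact_step_le[of _ "a + q"] by (auto simp: algebra_simps)
    show "\<forall>\<^sub>F k in sequentially. norm (xe k + u k - (a + q)) \<le> norm (z k + u k - (a + q))"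
      using exact_step_le[OF assms] by auto
  qed (rule limit)
  have "(\<lambda>k. (norm (z k - xe k))\<^sup>2) \<longlonglongrightarrow> 0"
  proof (rule tendsto_sandwich[of "\<lambda>k. 0"])
    show "(\<lambda>k. (norm (z k + u k - (a + q)))\<^sup>2 - (norm (xe k + u k - (a + q)))\<^sup>2) \<longlonglongrightarrow> 0"
      using tendsto_diff[OF tendsto_power[OF limit, of 2] tendsto_power[OF exact, of 2]] by simp
    show "\<forall>\<^sub>F k in sequentially. (norm (z k - xe k))\<^sup>2
        \<le> (norm (z k + u k - (a + q)))\<^sup>2 - (norm (xe k + u k - (a + q)))\<^sup>2"
      using exact_step_firmly_nonexpansive[OF assms] by (auto simp: algebra_simps)
  qed auto
  then show ?thesis using tendsto_real_sqrt by (fastforce simp: tendsto_norm_zero_iff)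
qed

lemma component_distances_le:
  assumes "kkt a q"
  shows "norm (z k - a) \<le> norm (z k + u k - (a + q))" "norm (u k - q) \<le> norm (z k + u k - (a + q))"
proof -
  have "0 \<le> (z k - a) \<bullet> (u k - q)"
    using assms z_subgrad by (intro scaled_subgrad_monotone) (auto simp: kkt_def)
  then have "(norm (z k - a))\<^sup>2 + (norm (u k - q))\<^sup>2 \<le> (norm (z k + u k - (a + q)))\<^sup>2"
    by (simp add: power2_norm_eq_inner inner_simps inner_commute)
  then have "(norm (z k - a))\<^sup>2 \<le> (norm (z k + u k - (a + q)))\<^sup>2"
    "(norm (u k - q))\<^sup>2 \<le> (norm (z k + u k - (a + q)))\<^sup>2"
    by (smt (verit) zero_le_power2)+
  then show "norm (z k - a) \<le> norm (z k + u k - (a + q))" "norm (u k - q) \<le> norm (z k + u k - (a + q))"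
    by (auto intro: power2_le_imp_le)
qed

lemma ex_convergent_subsequence:
  assumes "kkt a q"
  obtains r a' q' where "strict_mono (r :: nat \<Rightarrow> nat)" "(\<lambda>k. z (r k)) \<longlonglongrightarrow> a'" "(\<lambda>k. u (r k)) \<longlonglongrightarrow> q'"
proof -
  obtain K where distance_le: "\<And>k. norm (z k + u k - (a + q)) \<le> K"
    using convergent_imp_Bseq[OF distance_convergent[OF assms]] by (auto simp: Bseq_def)
  have bounded: "\<forall>k. (z k, u k) \<in> cball a K \<times> cball q K"
    using component_distances_le[OF assms, THEN order_trans, OF distance_le]
    by (simp add: dist_norm norm_minus_commute)
  have "seq_compact (cball a K \<times> cball q K)"
    by (intro compact_imp_seq_compact compact_Times compact_cball)
  then obtain l r where subseq: "strict_mono (r :: nat \<Rightarrow> nat)" "((\<lambda>k. (z k, u k)) \<circ> r) \<longlonglongrightarrow> l"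
    using bounded by (rule seq_compactE)
  then show thesis
    using that[OF subseq(1)] tendsto_fst[OF subseq(2)] tendsto_snd[OF subseq(2)] by (simp add: o_def)
qed

lemma kkt_of_subsequence_limit:
  assumes residual: "(\<lambda>k. z k - xe k) \<longlonglongrightarrow> 0" and subseq: "strict_mono (r :: nat \<Rightarrow> nat)"
    and z_lim: "(\<lambda>k. z (r k)) \<longlonglongrightarrow> a" and u_lim: "(\<lambda>k. u (r k)) \<longlonglongrightarrow> q"
  shows "kkt a q"
  unfolding kkt_def
proof
  have xe_lim: "(\<lambda>k. xe (r k)) \<longlonglongrightarrow> a"
    using tendsto_diff[OF z_lim LIMSEQ_subseq_LIMSEQ[OF residual subseq]] by (simp add: o_def)
  have "(\<lambda>k. \<rho> *\<^sub>R (z (r k) - u (r k) - xe (r k))) \<longlonglongrightarrow> \<rho> *\<^sub>R (a - q - a)"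
    by (intro tendsto_intros z_lim u_lim xe_lim)
  then show "subgrad f a (- (\<rho> *\<^sub>R q))"
    using exact_update by (intro subgrad_closed_graph[OF f_closed_proper xe_lim]) auto
  show "subgrad h a (\<rho> *\<^sub>R q)"
    by (rule subgrad_closed_graph[OF h_closed_proper z_lim, of "\<lambda>k. \<rho> *\<^sub>R u (r k)"])
       (auto intro!: tendsto_intros u_lim z_subgrad)
qed

theorem converges_to_kkt_point:
  assumes "kkt a q"
  obtains a' q' where "kkt a' q'" "x \<longlonglongrightarrow> a'" "u \<longlonglongrightarrow> q'"
proof -
  note residual = exact_residual_tendsto_zero[OF assms]
  obtain r a' q' where subseq: "strict_mono (r :: nat \<Rightarrow> nat)"
    and zr_lim: "(\<lambda>k. z (r k)) \<longlonglongrightarrow> a'" and ur_lim: "(\<lambda>k. u (r k)) \<longlonglongrightarrow> q'"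
    using ex_convergent_subsequence[OF assms] by blast
  have kkt_limit: "kkt a' q'" by (rule kkt_of_subsequence_limit[OF residual subseq zr_lim ur_lim])
  then obtain L where limit: "(\<lambda>k. norm (z k + u k - (a' + q'))) \<longlonglongrightarrow> L"
    using distance_convergent by (auto simp: convergent_def)
  have "(\<lambda>k. norm (z (r k) + u (r k) - (a' + q'))) \<longlonglongrightarrow> norm (a' + q' - (a' + q'))"
    by (intro tendsto_intros zr_lim ur_lim)
  then have "L = 0" using LIMSEQ_unique[OF LIMSEQ_subseq_LIMSEQ[OF limit subseq]] by (simp add: o_def)
  then have distance_lim: "(\<lambda>k. norm (z k + u k - (a' + q'))) \<longlonglongrightarrow> 0" using limit by simp
  have z_lim: "z \<longlonglongrightarrow> a'" and u_lim: "u \<longlonglongrightarrow> q'"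
    using component_distances_le[OF kkt_limit]
    by (auto intro!: LIM_zero_cancel[of z] LIM_zero_cancel[of u] Lim_null_comparison[OF _ distance_lim])
  have "(\<lambda>k. x (Suc k) - xe k) \<longlonglongrightarrow> 0"
    by (rule Lim_null_comparison[OF _ summable_LIMSEQ_zero[OF summable_error]]) (simp add: error)
  from tendsto_add[OF this tendsto_diff[OF z_lim residual]]
  have "(\<lambda>k. x (Suc k)) \<longlonglongrightarrow> a'" by simp
  then show thesis using that kkt_limit u_lim by (simp add: filterlim_sequentially_Suc)
qed

end

section \<open>Convergence of NysADMM\<close>

lemma constant_derivative_imp_affine:
  fixes F :: "'a::real_normed_vector \<Rightarrow> 'b::real_normed_vector"
  assumes derivative: "\<And>x. (F has_derivative L) (at x)"
  shows "F x - F y = L (x - y)"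
proof -
  have L_linear: "bounded_linear L" using derivative has_derivative_bounded_linear by blast
  have "((\<lambda>x. F x - L x) has_derivative (\<lambda>v. 0)) (at x)" for x
    using has_derivative_diff[OF derivative bounded_linear_imp_has_derivative[OF L_linear]] by simp
  then obtain c where "\<And>x. F x - L x = c"
    using has_derivative_zero_constant[of UNIV "\<lambda>x. F x - L x"] by auto
  from this[of x] this[of y] show ?thesis
    using linear_diff[OF bounded_linear.linear[OF L_linear], of x y] by (simp add: algebra_simps)
qed

lemma closed_fun_ereal_continuous:
  fixes f :: "'a::topological_space \<Rightarrow> real"
  assumes "continuous_on UNIV f"
  shows "closed_fun (\<lambda>x. ereal (f x))"
proof -
  have "closed {p :: 'a \<times> real. f (fst p) \<le> snd p}"
    by (intro closed_Collect_le continuous_intros continuous_on_compose2[OF assms]) auto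
  moreover have "epigraph (\<lambda>x. ereal (f x)) = {p. f (fst p) \<le> snd p}"
    by (auto simp: Defs.epigraph_def)
  ultimately show ?thesis by (simp add: closed_fun_def)
qed

lemma fsmooth_has_derivative:
  fixes A :: "real^'d^'n"
  assumes g_derivative: "(g has_derivative (\<lambda>v. G \<bullet> v)) (at x)"
  shows "(fsmooth A b g has_derivative (\<lambda>v. (transpose A *v (A *v x - b) + G) \<bullet> v)) (at x)"
proof -
  have fsmooth: "fsmooth A b g = (\<lambda>x. 1/2 * ((A *v x - b) \<bullet> (A *v x - b)) + g x)"
    by (simp add: fsmooth_def fun_eq_iff power2_norm_eq_inner)
  have "((\<lambda>x. A *v x) has_derivative (\<lambda>v. A *v v)) (at x)"
    by (rule bounded_linear_imp_has_derivative) (rule matrix_vector_mul_bounded_linear)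
  from has_derivative_diff[OF this has_derivative_const[of b]]
  have residual: "((\<lambda>x. A *v x - b) has_derivative (\<lambda>v. A *v v)) (at x)" by simp
  have "1/2 * ((A *v x - b) \<bullet> (A *v v) + (A *v v) \<bullet> (A *v x - b)) + G \<bullet> v
      = (transpose A *v (A *v x - b) + G) \<bullet> v" for v
    by (simp add: inner_commute[of "A *v v"] inner_matrix_transpose[of "A *v x - b"] inner_add_left)
  moreover note has_derivative_mult_right[OF has_derivative_inner[OF residual residual], of "1/2"]
  from has_derivative_add[OF this g_derivative]
  have "((\<lambda>x. 1/2 * ((A *v x - b) \<bullet> (A *v x - b)) + g x) has_derivative
      (\<lambda>v. 1/2 * ((A *v x - b) \<bullet> (A *v v) + (A *v v) \<bullet> (A *v x - b)) + G \<bullet> v)) (at x)" .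
  ultimately show ?thesis by (simp only: fsmooth)
qed

lemma fsmooth_subgrad:
  fixes A :: "real^'d^'n"
  assumes g_convex_derivative: "convex_on UNIV g" "(g has_derivative (\<lambda>v. G \<bullet> v)) (at x)"
  shows "subgrad (\<lambda>x. ereal (fsmooth A b g x)) x (transpose A *v (A *v x - b) + G)"
  unfolding subgrad_ereal_iff
proof
  fix v
  have "(norm (A *v v - b))\<^sup>2 = (norm (A *v x - b))\<^sup>2 + 2 * ((A *v x - b) \<bullet> (A *v (v - x)))
      + (norm (A *v (v - x)))\<^sup>2"
    by (simp add: power2_norm_eq_inner matrix_vector_mult_diff_distrib inner_simps inner_commute)
  moreover have "(A *v x - b) \<bullet> (A *v (v - x)) = (transpose A *v (A *v x - b)) \<bullet> (v - x)"
    by (rule inner_matrix_transpose)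
  moreover have "g x + G \<bullet> (v - x) \<le> g v"
    using convex_on_subgrad_gradient[OF g_convex_derivative] by (simp add: subgrad_ereal_iff)
  ultimately show "fsmooth A b g x + (transpose A *v (A *v x - b) + G) \<bullet> (v - x) \<le> fsmooth A b g v"
    using zero_le_power2[of "norm (A *v (v - x))"] unfolding fsmooth_def inner_add_left by linarith
qed

lemma psd_gram_add:
  fixes A :: "real^'d^'n"
  assumes "0 \<preceq> Hg"
  shows "0 \<preceq> transpose A ** A + Hg"
  unfolding loewner_le_def
  using psd_inner_nonneg[OF assms] norm_matrix_vector_power2[of A]
  by (simp add: matrix_vector_mult_add_rdistrib inner_add_right)
     (metis add_nonneg_nonneg zero_le_power2)

text \<open>The gradient of the smooth part is affine, so its linearisation is exact.\<close>

lemma nys_rhs_solution_subgrad: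
  fixes A :: "real^'d^'n" and Hg :: "real^'d^'d"
  defines "H \<equiv> transpose A ** A + Hg"
  assumes g_convex_derivative: "convex_on UNIV g" "\<And>x. (g has_derivative (\<lambda>v. gradg x \<bullet> v)) (at x)"
    and g_hessian: "\<And>x. (gradg has_derivative (\<lambda>v. Hg *v v)) (at x)" and Hg_psd: "0 \<preceq> Hg"
    and \<rho>_pos: "0 < \<rho>"
    and y_eq: "y = matrix_inv (H + \<rho> *\<^sub>R mat 1) *v nys_rhs A b Hg gradg \<rho> x z u"
  shows "subgrad (\<lambda>x. ereal (fsmooth A b g x)) y (\<rho> *\<^sub>R (z - u - y))"
proof -
  have "pos_def_matrix (H + \<rho> *\<^sub>R mat 1)"
    unfolding H_def by (intro pos_def_matrix_add_scaled_id psd_gram_add Hg_psd \<rho>_pos)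
  then have "(H + \<rho> *\<^sub>R mat 1) *v y = nys_rhs A b Hg gradg \<rho> x z u"
    by (simp add: y_eq matrix_vector_mul_assoc pos_def_matrix_inv_right)
  then have update: "H *v y + \<rho> *\<^sub>R y = nys_rhs A b Hg gradg \<rho> x z u"
    by (simp add: matrix_add_scaled_id_mult_vec)
  have gradg_affine: "gradg y = gradg x + (Hg *v y - Hg *v x)"
    using constant_derivative_imp_affine[OF g_hessian, of y x]
    by (simp add: matrix_vector_mult_diff_distrib algebra_simps)
  have "transpose A *v (A *v y - b) + gradg y - \<rho> *\<^sub>R (z - u - y)
      = H *v y + \<rho> *\<^sub>R y - nys_rhs A b Hg gradg \<rho> x z u"
    by (simp add: gradg_affine nys_rhs_def H_def matrix_vector_mult_add_rdistrib
        matrix_vector_mult_diff_distrib matrix_vector_mul_assoc algebra_simps)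
  then have "transpose A *v (A *v y - b) + gradg y = \<rho> *\<^sub>R (z - u - y)" by (simp add: update)
  then show ?thesis using fsmooth_subgrad[OF g_convex_derivative, of A b y] by simp
qed

theorem nysadmm_convergence:
  fixes A :: "real^'d^'n" and Hg :: "real^'d^'d" and x z u :: "nat \<Rightarrow> real^'d"
  defines "H \<equiv> transpose A ** A + Hg"
  assumes g_convex_derivative: "convex_on UNIV g" "\<And>x. (g has_derivative (\<lambda>v. gradg x \<bullet> v)) (at x)"
    and g_hessian: "\<And>x. (gradg has_derivative (\<lambda>v. Hg *v v)) (at x)" and Hg_psd: "0 \<preceq> Hg"
    and rho_pos: "0 < \<rho>"
    and h_props: "closed_fun h" "proper_fun h" "convex_fun h" and solution: "is_primal_sol A b g h xs"
    and eps_summable: "summable eps"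
    and x_step: "\<And>k. norm (x (Suc k)
        - matrix_inv (H + \<rho> *\<^sub>R mat 1) *v nys_rhs A b Hg gradg \<rho> (x k) (z k) (u k)) \<le> eps k"
    and z_step: "\<And>k v. h (z (Suc k)) + ereal (\<rho> / 2 * (norm (x (Suc k) - z (Suc k) + u k))\<^sup>2)
      \<le> h v + ereal (\<rho> / 2 * (norm (x (Suc k) - v + u k))\<^sup>2)"
    and u_step: "\<And>k. u (Suc k) = u k + x (Suc k) - z (Suc k)"
  shows "\<exists>xs. is_primal_sol A b g h xs \<and> x \<longlonglongrightarrow> xs"
    and "\<exists>ys. is_dual_sol A b g h ys \<and> (\<lambda>k. \<rho> *\<^sub>R u k) \<longlonglongrightarrow> ys"
proof -
  let ?f = "\<lambda>x. ereal (fsmooth A b g x)"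
  let ?xe = "\<lambda>k. matrix_inv (H + \<rho> *\<^sub>R mat 1) *v nys_rhs A b Hg gradg \<rho> (x k) (z k) (u k)"
  interpret inexact_admm ?f h \<rho> "\<lambda>k. x (Suc k)" "\<lambda>k. z (Suc k)" "\<lambda>k. u (Suc k)"
    "\<lambda>k. ?xe (Suc k)" "\<lambda>k. eps (Suc k)"
  proof
    show "closed_fun ?f"
      using fsmooth_has_derivative[OF g_convex_derivative(2)]
      by (intro closed_fun_ereal_continuous differentiable_imp_continuous_on)
         (auto simp: differentiable_on_def differentiable_def)
    show "subgrad ?f (?xe (Suc k)) (\<rho> *\<^sub>R (z (Suc k) - u (Suc k) - ?xe (Suc k)))" for k
      by (rule nys_rhs_solution_subgrad[OF g_convex_derivative g_hessian Hg_psd rho_pos])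
         (simp add: H_def)
    show "subgrad h (z (Suc k)) (\<rho> *\<^sub>R u (Suc k))" for k
      using prox_subgrad[OF h_props(3,2), of "z (Suc k)" \<rho> "x (Suc k) + u k"] z_step[of k]
      by (simp add: u_step algebra_simps)
    show "summable (\<lambda>k. eps (Suc k))" using eps_summable by (simp add: summable_Suc_iff)
    show "norm (x (Suc (Suc k)) - ?xe (Suc k)) \<le> eps (Suc k)" for k by (rule x_step)
    show "u (Suc (Suc k)) = u (Suc k) + x (Suc (Suc k)) - z (Suc (Suc k))" for k by (rule u_step)
  qed (use rho_pos h_props(1,2) in \<open>simp_all add: proper_fun_def\<close>)
  define G where "G = transpose A *v (A *v xs - b) + gradg xs"
  have "subgrad ?f xs G" unfolding G_def by (rule fsmooth_subgrad[OF g_convex_derivative])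
  moreover have "subgrad h xs (- G)"
    unfolding G_def using solution
    by (intro subgrad_of_minimizer_add_differentiable[where f = "fsmooth A b g"]
        fsmooth_has_derivative g_convex_derivative(2) h_props)
       (simp add: is_primal_sol_def primal_obj_def)
  ultimately have "kkt xs (- G /\<^sub>R \<rho>)" using rho_pos by (simp add: kkt_def)
  then obtain a q where "kkt a q" and limits: "(\<lambda>k. x (Suc k)) \<longlonglongrightarrow> a" "(\<lambda>k. u (Suc k)) \<longlonglongrightarrow> q"
    by (rule converges_to_kkt_point)
  then have "is_primal_sol A b g h a" "is_dual_sol A b g h (\<rho> *\<^sub>R q)"
    using primal_dual_sol_of_subgrad unfolding kkt_def by blast+
  moreover have "x \<longlonglongrightarrow> a" "u \<longlonglongrightarrow> q" using limits by (simp_all add: filterlim_sequentially_Suc)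
  ultimately show "\<exists>xs. is_primal_sol A b g h xs \<and> x \<longlonglongrightarrow> xs"
    "\<exists>ys. is_dual_sol A b g h ys \<and> (\<lambda>k. \<rho> *\<^sub>R u k) \<longlonglongrightarrow> ys"
    by (auto intro!: tendsto_intros)
qed

theorem theorem4p3:
  fixes A :: "real^'d::finite^'n::finite" and b :: "real^'n"
    and g :: "real^'d \<Rightarrow> real" and gradg :: "real^'d \<Rightarrow> real^'d" and Hg :: "real^'d^'d"
    and h :: "real^'d \<Rightarrow> ereal"
    and x0 z0 u0 :: "real^'d" and rho :: real and eps :: "nat \<Rightarrow> real" and \<delta> :: real
    and R :: real
    and M :: "'a measure" and Om :: "'a \<Rightarrow> real^'s::finite^'d"
    and U :: "'a \<Rightarrow> real^'s^'d" and lam :: "'a \<Rightarrow> 's \<Rightarrow> real"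
    and xt zt ut :: "'a \<Rightarrow> nat \<Rightarrow> real^'d"
  defines "H \<equiv> transpose A ** A + Hg"
  assumes g_convex: "convex_on UNIV g"
    and g_grad: "\<And>x. (g has_derivative (\<lambda>v. gradg x \<bullet> v)) (at x)"
    and g_hess: "\<And>x. (gradg has_derivative (\<lambda>v. Hg *v v)) (at x)"
    and Hg_sym: "transpose Hg = Hg" and Hg_psd: "\<And>v. 0 \<le> v \<bullet> (Hg *v v)"
    and h_closed: "closed_fun h" and h_proper: "proper_fun h" and h_convex: "convex_fun h"
    and sol_exists: "\<exists>x. is_primal_sol A b g h x"
    and rho_pos: "rho > 0"
    and eps_pos: "\<And>k. eps k > 0" and eps_summable: "summable eps"
    and delta: "0 < \<delta>" "\<delta> < 1"
    and P: "prob_space M"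
    and Om_gauss: "\<And>i j. distributed M lborel (\<lambda>\<omega>. Om \<omega> $ i $ j) (\<lambda>x. ennreal (std_normal_density x))"
    and Om_indep: "prob_space.indep_vars M (\<lambda>_. borel) (\<lambda>(i, j) \<omega>. Om \<omega> $ i $ j) UNIV"
    and s_bound: "real CARD('s) \<ge> 8 * (sqrt (deff H rho) + sqrt (8 * ln (16 / \<delta>)))^2"
    and U_orth: "\<And>\<omega>. \<omega> \<in> space M \<Longrightarrow> transpose (U \<omega>) ** U \<omega> = mat 1"
    and U_eig: "\<And>\<omega>. \<omega> \<in> space M \<Longrightarrow>
                  nystrom H (Om \<omega>) = U \<omega> ** diagm (lam \<omega>) ** transpose (U \<omega>)"
    and init: "\<And>\<omega>. \<omega> \<in> space M \<Longrightarrow> xt \<omega> 0 = x0 \<and> zt \<omega> 0 = z0 \<and> ut \<omega> 0 = u0"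
    and x_step: "\<And>\<omega> k. \<omega> \<in> space M \<Longrightarrow>
        xt \<omega> (Suc k) = pcg (H + rho *\<^sub>R mat 1) (nys_precond (U \<omega>) (lam \<omega>) rho)
                           (nys_rhs A b Hg gradg rho (xt \<omega> k) (zt \<omega> k) (ut \<omega> k))
                           (pcg_iters R (eps k) rho)"
    and z_step: "\<And>\<omega> k z. \<omega> \<in> space M \<Longrightarrow>
        h (zt \<omega> (Suc k)) + ereal (rho / 2 * (norm (xt \<omega> (Suc k) - zt \<omega> (Suc k) + ut \<omega> k))^2)
        \<le> h z + ereal (rho / 2 * (norm (xt \<omega> (Suc k) - z + ut \<omega> k))^2)"
    and u_step: "\<And>\<omega> k. \<omega> \<in> space M \<Longrightarrow>
        ut \<omega> (Suc k) = ut \<omega> k + xt \<omega> (Suc k) - zt \<omega> (Suc k)"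
    and r_bound: "\<And>\<omega> k. \<omega> \<in> space M \<Longrightarrow>
        norm (nys_rhs A b Hg gradg rho (xt \<omega> k) (zt \<omega> k) (ut \<omega> k)) \<le> R"
  shows "\<exists>E \<in> sets M. measure M E \<ge> 1 - \<delta> \<and>
           (\<forall>\<omega> \<in> E.
              (\<forall>k. norm (xt \<omega> (Suc k) -
                          matrix_inv (H + rho *\<^sub>R mat 1)
                            *v nys_rhs A b Hg gradg rho (xt \<omega> k) (zt \<omega> k) (ut \<omega> k)) \<le> eps k)
            \<and> (\<exists>xs. is_primal_sol A b g h xs \<and> xt \<omega> \<longlonglongrightarrow> xs)
            \<and> (\<exists>ys. is_dual_sol A b g h ys \<and> (\<lambda>k. rho *\<^sub>R ut \<omega> k) \<longlonglongrightarrow> ys))"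
proof -
  interpret gaussian_matrix M Om
    using P Om_gauss Om_indep by (intro gaussian_matrix.intro gaussian_matrix_axioms.intro)
  have Hg_loewner_psd: "0 \<preceq> Hg" using Hg_psd by (simp add: loewner_le_def)
  have H_sym_psd: "transpose H = H" "0 \<preceq> H"
    unfolding H_def
    using Hg_sym psd_gram_add[OF Hg_loewner_psd] by (simp_all add: transpose_add matrix_transpose_mul)
  obtain E where E_prob: "E \<in> sets M" "1 - \<delta> \<le> measure M E"
    and accurate: "\<And>\<omega> (U :: real^'s^'d) lam. \<omega> \<in> E \<Longrightarrow> transpose U ** U = mat 1 \<Longrightarrow>
      nystrom H (Om \<omega>) = spectral_matrix U lam \<Longrightarrow>
      pcg_accurate (H + rho *\<^sub>R mat 1) (nys_precond U lam rho) rho"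
    using pcg_accurate_nys_precond_event[OF H_sym_psd rho_pos delta s_bound] by blast
  obtain xs where solution: "is_primal_sol A b g h xs" using sol_exists by blast
  show ?thesis
  proof (intro bexI[OF _ E_prob(1)] conjI E_prob(2) ballI)
    fix \<omega> assume "\<omega> \<in> E"
    then have \<omega>_in_space: "\<omega> \<in> space M" using E_prob(1) sets.sets_into_space by blast
    show x_error: "\<forall>k. norm (xt \<omega> (Suc k) - matrix_inv (H + rho *\<^sub>R mat 1) *v
        nys_rhs A b Hg gradg rho (xt \<omega> k) (zt \<omega> k) (ut \<omega> k)) \<le> eps k"
      using accurate[OF \<open>\<omega> \<in> E\<close> U_orth[OF \<omega>_in_space] U_eig[OF \<omega>_in_space, folded spectral_matrix_def]]
        r_bound[OF \<omega>_in_space] eps_pos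
      by (simp add: pcg_accurate_def x_step[OF \<omega>_in_space])
    note limits = nysadmm_convergence[OF g_convex g_grad g_hess Hg_loewner_psd rho_pos
        h_closed h_proper h_convex solution eps_summable x_error[rule_format, unfolded H_def]
        z_step[OF \<omega>_in_space] u_step[OF \<omega>_in_space]]
    show "\<exists>xs. is_primal_sol A b g h xs \<and> xt \<omega> \<longlonglongrightarrow> xs"
      and "\<exists>ys. is_dual_sol A b g h ys \<and> (\<lambda>k. rho *\<^sub>R ut \<omega> k) \<longlonglongrightarrow> ys" by (fact limits)+
  qed
qed

end
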